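(* For integers $n,k\ge0$ let $f(n,k)$ be the number of $k$-dimensional flats of $\mathrm{I}(\mathfrak{sl}_n,V\oplus\bigwedge^2)$, and let $F(x,y)=\sum_{n\ge0}\sum_{k\ge0}f(n,k)x^ny^k$. Then $$\begin{aligned}F(x,y)=\;&\frac{2}{y(1-x)}+\frac{1-x+2x^3-2x^4-x^5+x^6-2x^2y+x^3y+x^4y-x^5y}{(1-x)\left(1-x^2(1+y)\right)^2}\\&+\frac{x-x^3+x^4-x^2y+2x^3y-x^4y}{(1-x)(1-2x+x^2-2xy+3x^2y-2x^3y+x^2y^2-2x^3y^2+x^4y^2)}\\&-\frac{8\left(1+x^2-xy-x^3y+x^4y+x^2y^2+x^3y^2-x^3y^3+x^4y^3-x^5y^3+x^6y^3\right)}{y\left(\beta+x\sqrt{\gamma}+\sqrt{\zeta+\eta\sqrt{\gamma}}\right)\left(\beta-x\sqrt{\gamma}+\sqrt{\zeta-\eta\sqrt{\gamma}}\right)}\end{aligned}$$ in the fraction field of $R=\mathbb{Q}[[x,y]]$, where $$\begin{aligned}\beta&=1-x+x^2-xy-x^2y-x^3y+x^2y^2-x^3y^2+x^4y^2,\\ \gamma&=1-2y-2x^2y+y^2+8x^2y^2+x^4y^2-2x^2y^3-2x^4y^3+x^4y^4,\\ \zeta&=1+x^4-2x^2y-2x^4y-7x^4y^2-2x^4y^3-2x^6y^3+x^4y^4+x^8y^4,\\ \eta&=2x^2(1+y)(1+x^2y).\end{aligned}$$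
   Context: $R=\mathbb{Q}[[x,y]]$; for $f\in R$ with $f(0,0)=1$, $\sqrt f$ denotes the unique square root of $f$ in $R$ with constant term $1$. Let $\mathfrak h=\mathbb{R}^n$ with coordinates $x_1,\dots,x_n$, $\mathfrak h_s=\{x_1+\cdots+x_n=0\}$, $W=\{x_1\ge\cdots\ge x_n\}$, $W_s=W\cap\mathfrak h_s$. The incidence geometry $\mathrm{I}(\mathfrak{sl}_n,V\oplus\bigwedge^2)$ is the arrangement in $\mathfrak h_s$ of the kernels of the weights $x_i$ ($1\le i\le n$) and $x_i+x_j$ ($1\le i<j\le n$) restricted to $\mathfrak h_s$, considered only inside $W_s$. A flat is a subset of $W_s$ of the form $W_s\cap\bigcap_{\lambda\in I}\ker\lambda$ where $I$ is a (possibly empty) set of weights; different $I$ giving the same subset give the same flat. The dimension of a flat is the dimension of its linear span. For $n=0$ and $n=1$, $\mathfrak h_s=\{0\}$ and there is exactly one flat, of dimension $0$. *)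

theory Defs
  imports
    "HOL-Analysis.Finite_Function_Topology"
    "HOL-Computational_Algebra.Formal_Power_Series"
    "HOL-Computational_Algebra.Polynomial_Factorial"
begin

section \<open>The incidence geometry\<close>

(* Since the dimension n varies, R^n is the space of finitely supported functions nat to real
   whose support lies in {1..n}; on that type the library provides the real vector space
   structure, span and dim. *)

type_synonym rvec = "nat \<Rightarrow>\<^sub>0 real"

definition h :: "nat \<Rightarrow> rvec set" where
  "h n = {v. Poly_Mapping.keys v \<subseteq> {1..n}}"

definition h_s :: "nat \<Rightarrow> rvec set" where
  "h_s n = {v \<in> h n. (\<Sum>i = 1..n. Poly_Mapping.lookup v i) = 0}"

definition W :: "nat \<Rightarrow> rvec set" where
  "W n = {v \<in> h n. \<forall>i j. 1 \<le> i \<and> i \<le> j \<and> j \<le> n \<longrightarrow>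
                 Poly_Mapping.lookup v i \<ge> Poly_Mapping.lookup v j}"

definition W_s :: "nat \<Rightarrow> rvec set" where
  "W_s n = W n \<inter> h_s n"

definition weights :: "nat \<Rightarrow> (rvec \<Rightarrow> real) set" where
  "weights n =
     {(\<lambda>v. Poly_Mapping.lookup v i) | i. 1 \<le> i \<and> i \<le> n} \<union>
     {(\<lambda>v. Poly_Mapping.lookup v i + Poly_Mapping.lookup v j) | i j. 1 \<le> i \<and> i < j \<and> j \<le> n}"

definition weight_kernel :: "nat \<Rightarrow> (rvec \<Rightarrow> real) \<Rightarrow> rvec set" where
  "weight_kernel n w = {v \<in> h_s n. w v = 0}"

(* For I = {} the intersection is UNIV, so that W_s n is itself a flat. *)
definition flats :: "nat \<Rightarrow> rvec set set" where
  "flats n = {W_s n \<inter> (\<Inter>w\<in>I. weight_kernel n w) | I. I \<subseteq> weights n}"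

definition num_flats :: "nat \<Rightarrow> nat \<Rightarrow> nat" where
  "num_flats n k = card {A \<in> flats n. dim (span A) = k}"


section \<open>Power series in two variables\<close>

unbundle fps_syntax

(* Q[[x,y]] is represented as Q[[y]][[x]]: the coefficient of x^n y^k of f is f $ n $ k. *)
type_synonym R = "rat fps fps"

definition X :: R where "X = fps_X"

definition Y :: R where "Y = fps_const fps_X"

definition F :: R where
  "F = Abs_fps (\<lambda>n. Abs_fps (\<lambda>k. of_nat (num_flats n k)))"

definition sqrt_R :: "R \<Rightarrow> R" where
  "sqrt_R f = (THE g. g ^ 2 = f \<and> g $ 0 $ 0 = 1)"

lemma sqrt_R_ex1:
  fixes f :: R
  assumes "f $ 0 $ 0 = 1"
  shows "\<exists>!g. g ^ 2 = f \<and> g $ 0 $ 0 = 1"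
proof (rule ex_ex1I)
  define rt :: "rat fps \<Rightarrow> rat fps" where "rt = fps_radical (\<lambda>_ _. 1) 2"
  have rt: "rt a ^ 2 = a" "rt a $ 0 = 1" if "a $ 0 = 1" for a
    using power_radical[of a "\<lambda>_ _. 1" 1] that by (simp_all add: rt_def numeral_2_eq_2)
  define b where "b = rt (1 + fps_X)"
  have b: "b ^ 2 = 1 + fps_X" "b $ 0 = 1"
    unfolding b_def by (rule rt; simp)+
  define B :: R where "B = Abs_fps (\<lambda>n. fps_const (b $ n))"
  have B: "B ^ 2 = 1 + fps_X"
  proof (rule fps_ext)
    fix n
    have "(B ^ 2) $ n = fps_const ((b ^ 2) $ n)"
      unfolding power2_eq_square B_def fps_mult_nth
      by (simp add: fps_eq_iff fps_sum_nth)
    then show "(B ^ 2) $ n = (1 + fps_X) $ n"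
      by (simp add: b(1) fps_X_def)
  qed
  define a where "a = f $ 0"
  have a: "a $ 0 = 1" using assms by (simp add: a_def)
  then have inv: "inverse a * a = 1" by (simp add: inverse_mult_eq_1)
  define s where "s = fps_const (inverse a) * f - 1"
  have s0: "s $ 0 = 0" by (simp add: s_def inv flip: a_def)
  define g where "g = fps_const (rt a) * (B oo s)"
  have "g ^ 2 = fps_const (rt a ^ 2) * ((B ^ 2) oo s)"
    by (simp only: g_def power_mult_distrib fps_compose_power[OF s0] fps_const_power)
  also have "\<dots> = fps_const a * (1 + s)"
    using s0 by (simp add: rt(1)[OF a] B fps_compose_add_distrib)
  also have "1 + s = fps_const (inverse a) * f"
    by (simp add: s_def)
  also have "fps_const a * (fps_const (inverse a) * f) = fps_const (inverse a * a) * f"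
    by (simp only: fps_const_mult[symmetric] mult.assoc mult.left_commute)
  also have "\<dots> = f" by (simp add: inv)
  finally have "g ^ 2 = f" .
  moreover have "g $ 0 $ 0 = 1"
    by (simp add: g_def B_def b(2) rt(2)[OF a])
  ultimately show "\<exists>g. g ^ 2 = f \<and> g $ 0 $ 0 = 1" by blast
next
  fix g k :: R
  assume *: "g ^ 2 = f \<and> g $ 0 $ 0 = 1" "k ^ 2 = f \<and> k $ 0 $ 0 = 1"
  then have "g = k \<or> g = - k" using power2_eq_iff[of g k] by metis
  moreover have "g \<noteq> - k"
  proof
    assume "g = - k"
    then have "g $ 0 $ 0 = - (k $ 0 $ 0)" by simp
    with *(1)[THEN conjunct2] *(2)[THEN conjunct2] show False by linarith
  qed
  ultimately show "g = k" by blast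
qed

definition \<beta> :: R where
  "\<beta> = 1 - X + X^2 - X*Y - X^2*Y - X^3*Y + X^2*Y^2 - X^3*Y^2 + X^4*Y^2"

definition \<gamma> :: R where
  "\<gamma> = 1 - 2*Y - 2*X^2*Y + Y^2 + 8*X^2*Y^2 + X^4*Y^2 - 2*X^2*Y^3 - 2*X^4*Y^3 + X^4*Y^4"

definition \<zeta> :: R where
  "\<zeta> = 1 + X^4 - 2*X^2*Y - 2*X^4*Y - 7*X^4*Y^2 - 2*X^4*Y^3 - 2*X^6*Y^3 + X^4*Y^4 + X^8*Y^4"

definition \<eta> :: R where
  "\<eta> = 2*X^2*(1 + Y)*(1 + X^2*Y)"

end

theory Submission
  imports Defs
begin

text \<open>
The flat generated by a point \<open>x\<close> of \<open>W_s\<close> is determined by the set of pairs \<open>i \<le> j\<close> with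
\<open>x\<^sub>i + x\<^sub>j = 0\<close>, where \<open>i = j\<close> stands for the weight \<open>x\<^sub>i\<close>; conversely every flat is generated by a
generic point of it. So the flats correspond to the possible vanishing sets. Read the
coordinates of \<open>x\<close> by decreasing absolute value. An absolute value \<open>t > 0\<close> that occurs with both
signs, \<open>p\<close> times as \<open>t\<close> and \<open>q\<close> times as \<open>- t\<close>, contributes a \<open>p \<times> q\<close> box of vanishing sums; between
two such layers only the numbers of positive and negative entries are visible, not their relative
order; the zeros form a core in the middle. This is a \<open>pattern\<close>. It determines the vanishing
set and is determined by it (\<open>list_zeros_realizes\<close>, \<open>pattern_zeros_injective\<close>).

The condition \<open>x\<^sub>1 + \<dots> + x\<^sub>n = 0\<close> restricts the patterns. Summation by parts writes the sum of the
coordinates as a combination, with positive and otherwise arbitrary coefficients, of the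
heights: the partial sums of the signs, read from the outside. The sum can vanish
exactly if all heights are zero (\<open>balanced\<close> patterns) or if the unmatched entries can be ordered,
and given signs in a core without zeros, such that heights of both signs occur. The second
alternative fails if and only if no choice makes a height negative, or no choice makes a height
positive, or the pattern is one of a small \<open>exceptional\<close> family (\<open>feasible_necessary\<close>, \<open>feasible_sufficient\<close>). A flat has one degree of freedom
for every layer and every unmatched entry, and the condition on the sum removes one of
them unless the pattern is balanced (\<open>dim_flat_of\<close>).

With \<open>x\<close> marking the number of coordinates and \<open>y\<close> the degrees of freedom, let \<open>T\<close>, \<open>N\<close>, \<open>B\<close>, \<open>E\<close>
count all patterns, those without negative heights, the balanced and the exceptional ones.
Inclusion and exclusion gives \<open>y F = T - 2 N + (1 + y) B - E\<close> (\<open>wgf_feasible\<close>). The series \<open>T\<close>, \<open>B\<close> and \<open>E\<close>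
are rational. For \<open>N\<close>, the patterns are lattice paths above a floor, refined by the
starting height; peeling off the outermost entry yields an infinite linear system
(\<open>wgf_nonneg_system\<close>). It has only one solution, and this solution is written down in terms of the
two small roots \<open>r\<^sub>+\<close>, \<open>r\<^sub>-\<close> of the kernel
\<open>(1 - xyt)(1 - xy/t)(1 - xt)(1 - x/t) - x\<^sup>2y\<close> (\<open>nonneg_system_solution\<close>). The kernel is a quadratic
polynomial in \<open>t + 1/t\<close> whose discriminant is \<open>x\<^sup>2\<gamma>\<close>, and passing from \<open>t + 1/t\<close> to \<open>t\<close> costs
the square roots of \<open>\<zeta> \<plusminus> \<eta>\<surd>\<gamma>\<close>; the two factors in the last denominator of the formula
are \<open>1 - r\<^sub>+\<close> and \<open>1 - r\<^sub>-\<close> up to units (\<open>kernel_factorization\<close>).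
\<close>

section \<open>Patterns of vanishing sums\<close>

text \<open>\<open>Layer b a p q c\<close> describes the coordinates of absolute value at least \<open>t\<close>, where \<open>t\<close> is the
largest absolute value that occurs with both signs: \<open>a\<close> positive and \<open>b\<close> negative ones of larger
absolute value, \<open>p\<close> copies of \<open>t\<close> and \<open>q\<close> copies of \<open>- t\<close>; the pattern \<open>c\<close> describes the rest. \<open>Core b a z\<close> has \<open>z\<close> zeros,
\<open>a\<close> positive and \<open>b\<close> negative coordinates, and no two opposite ones besides the zeros.\<close>
datatype pattern = Core nat nat nat | Layer nat nat nat nat pattern

fun psize :: "pattern \<Rightarrow> nat" where
  "psize (Core b a z) = b + a + z"
| "psize (Layer b a p q c) = b + a + p + q + psize c"

text \<open>Every unmatched coordinate and the common absolute value of every layer can be varied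
independently.\<close>
fun pfree :: "pattern \<Rightarrow> nat" where
  "pfree (Core b a z) = b + a"
| "pfree (Layer b a p q c) = b + a + 1 + pfree c"

text \<open>Without zeros, the vanishing sums do not show how many of the coordinates of the core are
positive; then \<open>b\<close> counts all of them and \<open>a\<close> is \<open>0\<close>.\<close>
fun wf_pattern :: "pattern \<Rightarrow> bool" where
  "wf_pattern (Core b a z) \<longleftrightarrow> (z = 0 \<longrightarrow> a = 0)"
| "wf_pattern (Layer b a p q c) \<longleftrightarrow> 0 < p \<and> 0 < q \<and> wf_pattern c"

text \<open>Count a positive coordinate as a step up and a negative one as a step down, starting at height
\<open>s\<close>. The condition says that the height stays nonnegative for every order of the unmatched
coordinates inside a segment; the worst order takes the \<open>b\<close> steps down first. A final segment
without zeros may even consist of steps down only, which is why all its entries are counted by \<open>b\<close>.\<close>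
fun nonneg :: "int \<Rightarrow> pattern \<Rightarrow> bool" where
  "nonneg s (Core b a z) \<longleftrightarrow> int b \<le> s"
| "nonneg s (Layer b a p q c) \<longleftrightarrow> int b \<le> s \<and> nonneg (s - int b + int a + int p - int q) c"

text \<open>The pattern of \<open>- x\<close>.\<close>
fun dual :: "pattern \<Rightarrow> pattern" where
  "dual (Core b a z) = (if z = 0 then Core b a z else Core a b z)"
| "dual (Layer b a p q c) = Layer a b q p (dual c)"

text \<open>The patterns all of whose heights are zero: the sum of the coordinates vanishes identically.\<close>
fun balanced :: "pattern \<Rightarrow> bool" where
  "balanced (Core b a z) \<longleftrightarrow> a = 0 \<and> b = 0"
| "balanced (Layer b a p q c) \<longleftrightarrow> a = 0 \<and> b = 0 \<and> p = q \<and> balanced c"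

text \<open>The patterns for which heights of either sign can be produced but not at the same time: except for
a single segment all heights are zero, and that segment consists of one positive and one
negative entry, or of one or two entries of unknown sign.\<close>
fun exceptional :: "pattern \<Rightarrow> bool" where
  "exceptional (Core b a z) \<longleftrightarrow> (if z = 0 then b = 1 \<or> b = 2 else a = 1 \<and> b = 1)"
| "exceptional (Layer b a p q c) \<longleftrightarrow>
     p = q \<and> (a = 1 \<and> b = 1 \<and> balanced c \<or> a = 0 \<and> b = 0 \<and> exceptional c)"

definition feasible :: "pattern \<Rightarrow> bool" where
  "feasible c \<longleftrightarrow> balanced c \<or> \<not> (nonneg 0 c \<or> nonneg 0 (dual c) \<or> exceptional c)"

definition pdim :: "pattern \<Rightarrow> nat" where
  "pdim c = (if balanced c then pfree c else pfree c - 1)"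

lemma dual_dual [simp]: "wf_pattern c \<Longrightarrow> dual (dual c) = c"
  by (induction c) auto

lemma wf_dual [simp]: "wf_pattern c \<Longrightarrow> wf_pattern (dual c)"
  by (induction c) auto

lemma psize_dual [simp]: "psize (dual c) = psize c"
  by (induction c) auto

lemma pfree_dual [simp]: "pfree (dual c) = pfree c"
  by (induction c) auto

lemma balanced_dual [simp]: "balanced (dual c) = balanced c"
  by (induction c) auto

lemma balanced_imp_nonneg: "balanced c \<Longrightarrow> nonneg 0 c"
  by (induction c) auto

text \<open>If no order leads below or above zero, then every segment is empty and every layer has \<open>p = q\<close>.\<close>
lemma nonneg_both: "wf_pattern c \<Longrightarrow> nonneg s c \<Longrightarrow> nonneg (- s) (dual c) \<Longrightarrow> s = 0 \<and> balanced c"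
proof (induction c arbitrary: s)
  case (Core b a z)
  then show ?case by (auto split: if_splits)
next
  case (Layer b a p q c)
  from Layer.prems have "int b \<le> s" "int a \<le> - s" by auto
  then have 0: "s = 0" "a = 0" "b = 0" by auto
  with Layer.prems have "nonneg (int p - int q) c" "nonneg (- (int p - int q)) (dual c)" "wf_pattern c" by auto
  with Layer.IH[of "int p - int q"] 0 show ?case by simp
qed

lemma exceptional_not_nonneg:
  "wf_pattern c \<Longrightarrow> exceptional c \<Longrightarrow> \<not> nonneg 0 c \<and> \<not> nonneg 0 (dual c) \<and> \<not> balanced c"
  by (induction c) (auto split: if_splits)

lemma pfree_pos: "\<not> balanced c \<Longrightarrow> 0 < pfree c"
  by (cases c) auto

abbreviation "patterns \<equiv> {c. wf_pattern c}"

section \<open>Points realizing a pattern\<close>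

text \<open>The pairs of positions, counted from \<open>l\<close>, at which a list with the given pattern has opposite
entries.\<close>
fun pattern_zeros :: "nat \<Rightarrow> pattern \<Rightarrow> (nat \<times> nat) set" where
  "pattern_zeros l (Core b a z) = {(i, j). l + a \<le> i \<and> i \<le> j \<and> j < l + a + z}"
| "pattern_zeros l (Layer b a p q c) =
     {l + a..<l + a + p} \<times> {l + a + p + psize c..<l + a + p + psize c + q} \<union> pattern_zeros (l + a + p) c"

definition list_zeros :: "real list \<Rightarrow> (nat \<times> nat) set" where
  "list_zeros xs = {(i, j). i \<le> j \<and> j < length xs \<and> xs ! i + xs ! j = 0}"

text \<open>The parameter \<open>R\<close> is \<open>\<ge>\<close> for arbitrary points of the chamber and \<open>>\<close> for points that have no more
coincidences than the pattern forces.\<close>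
fun realizes :: "(real \<Rightarrow> real \<Rightarrow> bool) \<Rightarrow> pattern \<Rightarrow> real list \<Rightarrow> bool" where
  "realizes R (Core b a z) xs \<longleftrightarrow> (\<exists>as bs. xs = as @ replicate z 0 @ bs \<and> length as = a \<and> length bs = b \<and>
     sorted_wrt R as \<and> sorted_wrt R bs \<and>
     (\<forall>x\<in>set as \<union> set bs. \<forall>y\<in>set as \<union> set bs. x + y \<noteq> 0) \<and>
     (0 < z \<longrightarrow> (\<forall>x\<in>set as. 0 < x) \<and> (\<forall>x\<in>set bs. x < 0)))"
| "realizes R (Layer b a p q c) xs \<longleftrightarrow> (\<exists>as t ys bs. xs = as @ replicate p t @ ys @ replicate q (- t) @ bs \<and>
     length as = a \<and> length bs = b \<and> sorted_wrt R as \<and> sorted_wrt R bs \<and>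
     0 < t \<and> (\<forall>x\<in>set as. t < x) \<and> (\<forall>x\<in>set bs. x < - t) \<and> (\<forall>y\<in>set ys. \<bar>y\<bar> < t) \<and>
     (\<forall>x\<in>set as. \<forall>y\<in>set bs. x + y \<noteq> 0) \<and> realizes R c ys)"

text \<open>The linear hull of the points realizing a pattern: only the equations are kept, not
the inequalities.\<close>
fun compat :: "pattern \<Rightarrow> real list \<Rightarrow> bool" where
  "compat (Core b a z) xs \<longleftrightarrow> (\<exists>as bs. xs = as @ replicate z 0 @ bs \<and> length as = a \<and> length bs = b)"
| "compat (Layer b a p q c) xs \<longleftrightarrow> (\<exists>as t ys bs. xs = as @ replicate p t @ ys @ replicate q (- t) @ bs \<and>
     length as = a \<and> length bs = b \<and> compat c ys)"

lemma realizes_imp_compat: "realizes R c xs \<Longrightarrow> compat c xs"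
proof (induction c arbitrary: xs)
  case (Core b a z)
  then show ?case unfolding realizes.simps compat.simps by blast
next
  case (Layer b a p q c)
  from Layer.prems obtain as t ys bs where "xs = as @ replicate p t @ ys @ replicate q (- t) @ bs"
    "length as = a" "length bs = b" "realizes R c ys"
    unfolding realizes.simps by blast
  with Layer.IH[of ys] show ?case unfolding compat.simps by blast
qed

lemma compat_length: "compat c xs \<Longrightarrow> length xs = psize c"
  by (induction c arbitrary: xs) auto

lemma pattern_zeros_shift: "(i, j) \<in> pattern_zeros (l + m) c \<longleftrightarrow> l \<le> i \<and> l \<le> j \<and> (i - l, j - l) \<in> pattern_zeros m c"
proof (induction c arbitrary: m)
  case (Layer b a p q c)
  show ?case using Layer.IH[of "m + a + p"] by (auto simp: add.assoc)
qed auto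

lemma pattern_zeros_bounds: "(i, j) \<in> pattern_zeros l c \<Longrightarrow> l \<le> i \<and> i \<le> j \<and> j < l + psize c"
proof (induction c arbitrary: l)
  case (Layer b a p q c)
  show ?case using Layer.IH[of "l + a + p"] Layer.prems by auto
qed auto

text \<open>An opposite pair must have equal absolute values. Outside the layer of \<open>t\<close> there are no opposite
pairs by assumption, inside it the pairs are those of the inner list, and on it they form the box.\<close>
lemma list_zeros_realizes:
  assumes "realizes R c xs" "wf_pattern c"
  shows "list_zeros xs = pattern_zeros 0 c"
  using assms
proof (induction c arbitrary: xs)
  case (Core b a z)
  then obtain as bs where xs: "xs = as @ replicate z 0 @ bs" "length as = a" "length bs = b"
    and no: "\<forall>x\<in>set as \<union> set bs. \<forall>y\<in>set as \<union> set bs. x + y \<noteq> 0"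
    by auto
  have mid: "xs ! i = 0" if "a \<le> i" "i < a + z" for i
    using that xs by (auto simp: nth_append)
  have out: "xs ! i \<in> set as \<union> set bs" if "i < a \<or> a + z \<le> i" "i < length xs" for i
    using that xs by (auto simp: nth_append)
  have nz: "x \<noteq> 0" if "x \<in> set as \<union> set bs" for x using no that by force
  have "xs ! i + xs ! j = 0 \<longleftrightarrow> a \<le> i \<and> j < a + z" if "i \<le> j" "j < length xs" for i j
  proof (cases "a \<le> i \<and> i < a + z"; cases "a \<le> j \<and> j < a + z")
    assume "a \<le> i \<and> i < a + z" "a \<le> j \<and> j < a + z"
    then show ?thesis using mid by simp
  next
    assume *: "a \<le> i \<and> i < a + z" "\<not> (a \<le> j \<and> j < a + z)"
    then show ?thesis using mid[of i] nz[OF out[of j]] that by auto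
  next
    assume *: "\<not> (a \<le> i \<and> i < a + z)" "(a \<le> j \<and> j < a + z)"
    then show ?thesis using mid[of j] nz[OF out[of i]] that by auto
  next
    assume *: "\<not> (a \<le> i \<and> i < a + z)" "\<not> (a \<le> j \<and> j < a + z)"
    have "xs ! i \<in> set as \<union> set bs" by (rule out) (use that * in auto)
    moreover have "xs ! j \<in> set as \<union> set bs" by (rule out) (use that * in auto)
    ultimately have "xs ! i + xs ! j \<noteq> 0" using no by blast
    then show ?thesis using * that by auto
  qed
  moreover have "length xs = a + z + b" using xs by simp
  ultimately show ?case by (auto simp: list_zeros_def)
next
  case (Layer b a p q c)
  then obtain as t ys bs where xs: "xs = as @ replicate p t @ ys @ replicate q (- t) @ bs"
    "length as = a" "length bs = b" and t: "0 < t" "\<forall>x\<in>set as. t < x" "\<forall>x\<in>set bs. x < - t" "\<forall>y\<in>set ys. \<bar>y\<bar> < t"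
    and no: "\<forall>x\<in>set as. \<forall>y\<in>set bs. x + y \<noteq> 0" and ys: "realizes R c ys"
    by auto
  have m: "length ys = psize c" using compat_length[OF realizes_imp_compat[OF ys]] .
  let ?m = "psize c"
  have len: "length xs = a + p + ?m + q + b" using xs m by simp
  have r1: "xs ! i \<in> set as" if "i < a" for i using that xs by (auto simp: nth_append)
  have r2: "xs ! i = t" if "a \<le> i" "i < a + p" for i using that xs by (auto simp: nth_append)
  have r3: "xs ! i = ys ! (i - (a + p))" "ys ! (i - (a + p)) \<in> set ys" if "a + p \<le> i" "i < a + p + ?m" for i
    using that xs m by (auto simp: nth_append)
  have r4: "xs ! i = - t" if "a + p + ?m \<le> i" "i < a + p + ?m + q" for i
    using that xs m by (auto simp: nth_append)
  have r5: "xs ! i \<in> set bs" if "a + p + ?m + q \<le> i" "i < length xs" for i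
    using that xs m by (auto simp: nth_append intro!: nth_mem)
  have b1: "t < xs ! i" if "i < a" for i using r1[OF that] t by blast
  have b3: "\<bar>xs ! i\<bar> < t" if "a + p \<le> i" "i < a + p + ?m" for i using r3[OF that] t by simp
  have b5: "xs ! i < - t" if "a + p + ?m + q \<le> i" "i < length xs" for i using r5[OF that] t by blast
  have IH: "list_zeros ys = pattern_zeros 0 c" using Layer.IH[OF ys] Layer.prems by simp
  have "xs ! i + xs ! j = 0 \<longleftrightarrow> (a \<le> i \<and> i < a + p \<and> a + p + ?m \<le> j \<and> j < a + p + ?m + q) \<or>
      (a + p \<le> i \<and> a + p \<le> j \<and> (i - (a + p), j - (a + p)) \<in> list_zeros ys)" if ij: "i \<le> j" "j < length xs" for i j
  proof -
    consider "i < a" | "a \<le> i" "i < a + p" | "a + p \<le> i" "i < a + p + ?m" | "a + p + ?m \<le> i" by linarith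
    then show ?thesis
    proof cases
      case 1
      have "xs ! i + xs ! j \<noteq> 0"
      proof (cases "a + p + ?m + q \<le> j")
        case True
        then show ?thesis using r1[OF 1] r5[OF True ij(2)] no by blast
      next
        case False
        then have "- t \<le> xs ! j"
          using b1[of j] r2[of j] b3[of j] r4[of j] t(1) by (cases "j < a"; cases "j < a + p"; cases "j < a + p + ?m") auto
        then show ?thesis using b1[OF 1] by linarith
      qed
      then show ?thesis using 1 by auto
    next
      case 2
      have "xs ! i + xs ! j = 0 \<longleftrightarrow> a + p + ?m \<le> j \<and> j < a + p + ?m + q"
        using r2[OF 2] r2[of j] b3[of j] r4[of j] b5[of j] t(1) ij 2
        by (cases "j < a + p"; cases "j < a + p + ?m"; cases "j < a + p + ?m + q") auto
      then show ?thesis using 2 by auto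
    next
      case 3
      have "xs ! i + xs ! j = 0 \<longleftrightarrow> j < a + p + ?m \<and> ys ! (i - (a + p)) + ys ! (j - (a + p)) = 0"
        using b3[OF 3] r3[OF 3] r3[of j] r4[of j] b5[of j] t(1) ij 3
        by (cases "j < a + p + ?m"; cases "j < a + p + ?m + q") auto
      then show ?thesis using 3 ij m by (auto simp: list_zeros_def)
    next
      case 4
      have "xs ! i < 0" "xs ! j < 0"
        using r4[of i] r4[of j] b5[of i] b5[of j] 4 ij t(1)
        by (cases "i < a + p + ?m + q"; cases "j < a + p + ?m + q"; force)+
      then show ?thesis using 4 ij m by (auto simp: list_zeros_def)
    qed
  qed
  then have "(i, j) \<in> list_zeros xs \<longleftrightarrow> (i, j) \<in> pattern_zeros 0 (Layer b a p q c)" for i j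
    using pattern_zeros_shift[of i j "a + p" 0 c] len m unfolding IH[symmetric]
    by (auto simp: list_zeros_def[of xs]) (auto simp: list_zeros_def)
  then show ?case by auto
qed

text \<open>The box of a layer is nonempty, so its equations force one common value \<open>t\<close> on
the rows and \<open>- t\<close> on the columns.\<close>
lemma compat_iff:
  assumes "wf_pattern c"
  shows "compat c xs \<longleftrightarrow> length xs = psize c \<and> (\<forall>(i, j)\<in>pattern_zeros 0 c. xs ! i + xs ! j = 0)"
  using assms
proof (induction c arbitrary: xs)
  case (Core b a z)
  show ?case
  proof
    assume "compat (Core b a z) xs"
    then show "length xs = psize (Core b a z) \<and> (\<forall>(i, j)\<in>pattern_zeros 0 (Core b a z). xs ! i + xs ! j = 0)"
      by (auto simp: nth_append)
  next
    assume r: "length xs = psize (Core b a z) \<and> (\<forall>(i, j)\<in>pattern_zeros 0 (Core b a z). xs ! i + xs ! j = 0)"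
    have "xs = take a xs @ take z (drop a xs) @ drop (a + z) xs"
      by (metis append_take_drop_id drop_drop add.commute)
    moreover have "take z (drop a xs) = replicate z 0"
    proof (rule nth_equalityI)
      fix i assume "i < length (take z (drop a xs))"
      then have "(a + i, a + i) \<in> pattern_zeros 0 (Core b a z)" by simp
      then have "xs ! (a + i) + xs ! (a + i) = 0" using r by blast
      then show "take z (drop a xs) ! i = replicate z 0 ! i"
        using \<open>i < length (take z (drop a xs))\<close> r by simp
    qed (use r in simp)
    ultimately show "compat (Core b a z) xs" using r
      unfolding compat.simps by - (rule exI[where x = "take a xs"], rule exI[where x = "drop (a + z) xs"], simp)
  qed
next
  case (Layer b a p q c)
  let ?m = "psize c"
  have pq: "0 < p" "0 < q" "wf_pattern c" using Layer.prems by auto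
  show ?case
  proof
    assume "compat (Layer b a p q c) xs"
    then obtain as t ys bs where xs: "xs = as @ replicate p t @ ys @ replicate q (- t) @ bs"
      "length as = a" "length bs = b" and ys: "compat c ys" by auto
    have m: "length ys = ?m" using compat_length[OF ys] .
    have "xs ! i + xs ! j = 0" if "(i, j) \<in> pattern_zeros 0 (Layer b a p q c)" for i j
    proof -
      from that consider "a \<le> i" "i < a + p" "a + p + ?m \<le> j" "j < a + p + ?m + q" | "(i, j) \<in> pattern_zeros (a + p + 0) c"
        by auto
      then show ?thesis
      proof cases
        case 1
        then show ?thesis using xs m by (auto simp: nth_append)
      next
        case 2
        then have *: "a + p \<le> i" "a + p \<le> j" "(i - (a + p), j - (a + p)) \<in> pattern_zeros 0 c"
          using pattern_zeros_shift[of i j "a + p" 0 c] by auto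
        then have "ys ! (i - (a + p)) + ys ! (j - (a + p)) = 0"
          using Layer.IH[OF pq(3), of ys] ys by auto
        moreover have "j < a + p + ?m" "i \<le> j" using pattern_zeros_bounds[OF *(3)] * by auto
        ultimately show ?thesis using xs m * by (auto simp: nth_append)
      qed
    qed
    then show "length xs = psize (Layer b a p q c) \<and> (\<forall>(i, j)\<in>pattern_zeros 0 (Layer b a p q c). xs ! i + xs ! j = 0)"
      using xs m by auto
  next
    assume r: "length xs = psize (Layer b a p q c) \<and> (\<forall>(i, j)\<in>pattern_zeros 0 (Layer b a p q c). xs ! i + xs ! j = 0)"
    define as where "as = take a xs"
    define ps where "ps = take p (drop a xs)"
    define ys where "ys = take ?m (drop (a + p) xs)"
    define qs where "qs = take q (drop (a + p + ?m) xs)"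
    define bs where "bs = drop (a + p + ?m + q) xs"
    have split: "xs = as @ ps @ ys @ qs @ bs"
      unfolding as_def ps_def ys_def qs_def bs_def
      by (metis append_take_drop_id drop_drop add.commute)
    define t where "t = xs ! a"
    have rel: "xs ! i + xs ! j = 0" if "a \<le> i" "i < a + p" "a + p + ?m \<le> j" "j < a + p + ?m + q" for i j
      using r that by auto
    have Q: "xs ! j = - t" if "a + p + ?m \<le> j" "j < a + p + ?m + q" for j
      using rel[of a j] that pq by (simp add: t_def)
    have P: "xs ! i = t" if "a \<le> i" "i < a + p" for i
      using rel[of i "a + p + ?m"] Q[of "a + p + ?m"] that pq by simp
    have "ps = replicate p t"
      by (rule nth_equalityI) (use r P in \<open>auto simp: ps_def\<close>)
    moreover have "qs = replicate q (- t)"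
      by (rule nth_equalityI) (use r Q in \<open>auto simp: qs_def\<close>)
    moreover have "compat c ys"
    proof (subst Layer.IH[OF pq(3)], intro conjI ballI)
      show "length ys = psize c" using r by (simp add: ys_def)
      fix x assume x: "x \<in> pattern_zeros 0 c"
      obtain i j where ij: "x = (i, j)" by (cases x)
      then have "(a + p + i, a + p + j) \<in> pattern_zeros (a + p + 0) c"
        using x pattern_zeros_shift[of "a + p + i" "a + p + j" "a + p" 0 c] by simp
      then have "xs ! (a + p + i) + xs ! (a + p + j) = 0" using r by auto
      moreover have "j < ?m" "i \<le> j" using pattern_zeros_bounds x ij by force+
      ultimately show "case x of (i, j) \<Rightarrow> ys ! i + ys ! j = 0"
        using r ij by (auto simp: ys_def add.assoc)
    qed
    ultimately show "compat (Layer b a p q c) xs"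
      using split r unfolding compat.simps
      by - (rule exI[where x = as], rule exI[where x = t], rule exI[where x = ys], rule exI[where x = bs],
        simp add: as_def bs_def)
  qed
qed

text \<open>The smallest row and the largest column of the vanishing set delimit the outermost box, or the
central square of zeros; the two cases differ by the presence of a diagonal pair.
Row and column lengths give \<open>p\<close> and \<open>q\<close>, and the remaining pairs determine the inner pattern.\<close>
lemma pattern_zeros_injective:
  assumes "wf_pattern c" "wf_pattern c'" "psize c = psize c'" "pattern_zeros l c = pattern_zeros l c'"
  shows "c = c'"
  using assms
proof (induction c arbitrary: l c')
  case (Core b a z)
  have diag: "(i, i) \<in> pattern_zeros l (Core b a z) \<longleftrightarrow> i \<in> {l + a..<l + a + z}" for i by auto
  show ?case
  proof (cases c')
    case (Core b' a' z')
    have "{l + a..<l + a + z} = {l + a'..<l + a' + z'}"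
      using diag Core.prems(4) Core by (intro set_eqI) (metis (no_types, lifting) atLeastLessThan_iff case_prodI mem_Collect_eq order_refl pattern_zeros.simps(1) case_prodD)
    then show ?thesis using Core.prems Core by (cases "z = 0"; cases "z' = 0") (auto simp: atLeastLessThan_eq_iff)
  next
    case (Layer b' a' p q d)
    then have *: "(l + a', l + a' + p + psize d) \<in> pattern_zeros l c'" "(l + a', l + a') \<notin> pattern_zeros l c'"
      using Core.prems pattern_zeros_bounds[of "l + a'" "l + a'" "l + a' + p" d] by auto
    then have "(l + a', l + a' + p + psize d) \<in> pattern_zeros l (Core b a z)" "(l + a', l + a') \<notin> pattern_zeros l (Core b a z)"
      using Core.prems by blast+
    then show ?thesis by auto
  qed
next
  case (Layer b a p q c)
  let ?m = "psize c"
  have pq: "0 < p" "0 < q" "wf_pattern c" using Layer.prems by auto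
  show ?case
  proof (cases c')
    case (Core b' a' z')
    have *: "(l + a, l + a + p + psize c) \<in> pattern_zeros l (Layer b a p q c)" "(l + a, l + a) \<notin> pattern_zeros l (Layer b a p q c)"
      using pq pattern_zeros_bounds[of "l + a" "l + a" "l + a + p" c] by auto
    then have "(l + a, l + a + p + psize c) \<in> pattern_zeros l c'" "(l + a, l + a) \<notin> pattern_zeros l c'"
      using Layer.prems(4) by blast+
    then show ?thesis using Core by auto
  next
    case (Layer b' a' p' q' d)
    let ?n = "psize d"
    have pq': "0 < p'" "0 < q'" "wf_pattern d" using Layer.prems Layer by auto
    have eq: "pattern_zeros l (Layer b a p q c) = pattern_zeros l (Layer b' a' p' q' d)" using Layer.prems(4) Layer by simp
    have mem: "(i, j) \<in> pattern_zeros l (Layer b a p q c) \<longleftrightarrow>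
       i \<in> {l + a..<l + a + p} \<and> j \<in> {l + a + p + ?m..<l + a + p + ?m + q} \<or> (i, j) \<in> pattern_zeros (l + a + p) c" for i j
      by auto
    have mem': "(i, j) \<in> pattern_zeros l (Layer b a p q c) \<longleftrightarrow>
       i \<in> {l + a'..<l + a' + p'} \<and> j \<in> {l + a' + p' + ?n..<l + a' + p' + ?n + q'} \<or> (i, j) \<in> pattern_zeros (l + a' + p') d" for i j
      unfolding eq by auto
    have in_c: "l + a + p \<le> i \<and> j < l + a + p + ?m" if "(i, j) \<in> pattern_zeros (l + a + p) c" for i j
      using pattern_zeros_bounds[OF that] by auto
    have in_d: "l + a' + p' \<le> i \<and> j < l + a' + p' + ?n" if "(i, j) \<in> pattern_zeros (l + a' + p') d" for i j
      using pattern_zeros_bounds[OF that] by auto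
    have a: "a = a'"
    proof (rule antisym)
      have "(l + a', l + a' + p' + ?n) \<in> pattern_zeros l (Layer b a p q c)" unfolding mem' using pq' by auto
      then show "a \<le> a'" unfolding mem using in_c by fastforce
      have "(l + a, l + a + p + ?m) \<in> pattern_zeros l (Layer b a p q c)" unfolding mem using pq by auto
      then show "a' \<le> a" unfolding mem' using in_d by fastforce
    qed
    have "{l + a + p + ?m..<l + a + p + ?m + q} = {j. (l + a, j) \<in> pattern_zeros l (Layer b a p q c)}"
      unfolding mem using in_c pq by fastforce
    moreover have "{l + a' + p' + ?n..<l + a' + p' + ?n + q'} = {j. (l + a', j) \<in> pattern_zeros l (Layer b a p q c)}"
      unfolding mem' using in_d pq' by fastforce
    ultimately have "{l + a + p + ?m..<l + a + p + ?m + q} = {l + a' + p' + ?n..<l + a' + p' + ?n + q'}" by (simp only: a)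
    then have pm: "p + ?m = p' + ?n" and q: "q = q'"
      using pq pq' a by (auto simp: atLeastLessThan_eq_iff)
    define j where "j = l + a + p + ?m"
    have "{l + a..<l + a + p} = {i. (i, j) \<in> pattern_zeros l (Layer b a p q c)}"
      unfolding mem j_def using in_c pq by fastforce
    moreover have "{l + a'..<l + a' + p'} = {i. (i, j) \<in> pattern_zeros l (Layer b a p q c)}"
    proof -
      have "j = l + a' + p' + ?n" using pm a by (simp add: j_def)
      then show ?thesis unfolding mem' using in_d pq' by fastforce
    qed
    ultimately have "{l + a..<l + a + p} = {l + a'..<l + a' + p'}" by (simp only:)
    then have p: "p = p'" using pq pq' by (auto simp: atLeastLessThan_eq_iff)
    have "(i, j) \<in> pattern_zeros (l + a + p) c \<longleftrightarrow> (i, j) \<in> pattern_zeros l (Layer b a p q c) \<and> l + a + p \<le> i" for i j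
      unfolding mem using in_c by auto
    moreover have "(i, j) \<in> pattern_zeros (l + a' + p') d \<longleftrightarrow> (i, j) \<in> pattern_zeros l (Layer b a p q c) \<and> l + a' + p' \<le> i" for i j
      unfolding mem' using in_d by auto
    ultimately have "pattern_zeros (l + a + p) c = pattern_zeros (l + a + p) d" using a p by auto
    then have "c = d" using Layer.IH[of d "l + a + p"] pq pq' pm p by simp
    then show ?thesis using Layer a p q pm Layer.prems(3) by simp
  qed
qed

lemma sorted_desc_split:
  fixes t :: real
  assumes "sorted_wrt (\<ge>) xs"
  shows "xs = filter (\<lambda>x. t < x) xs @ filter (\<lambda>x. x \<le> t) xs"
    and "xs = filter (\<lambda>x. t \<le> x) xs @ filter (\<lambda>x. x < t) xs"
  using assms
proof (induction xs)
  case (Cons x xs)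
  { case 1
    show ?case
    proof (cases "t < x")
      case False
      then have "filter (\<lambda>x. t < x) xs = []" "filter (\<lambda>x. x \<le> t) xs = xs"
        using 1 by (auto simp: filter_empty_conv filter_id_conv)
      then show ?thesis using False by simp
    qed (use Cons 1 in simp)
  next
    case 2
    show ?case
    proof (cases "t \<le> x")
      case False
      then have "filter (\<lambda>x. t \<le> x) xs = []" "filter (\<lambda>x. x < t) xs = xs"
        using 2 by (auto simp: filter_empty_conv filter_id_conv)
      then show ?thesis using False by simp
    qed (use Cons 2 in simp)
  }
qed simp_all

lemma filter_eq_replicate: "filter (\<lambda>x. x = t) xs = replicate (length (filter (\<lambda>x. x = t) xs)) t"
  by (induction xs) auto

lemma sorted_desc_split3:
  fixes t :: real
  assumes "sorted_wrt (\<ge>) xs"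
  shows "xs = filter (\<lambda>x. t < x) xs @ replicate (length (filter (\<lambda>x. x = t) xs)) t @ filter (\<lambda>x. x < t) xs"
proof -
  let ?ys = "filter (\<lambda>x. x \<le> t) xs"
  have "sorted_wrt (\<ge>) ?ys" using assms by (rule sorted_wrt_filter)
  then have "?ys = filter (\<lambda>x. t \<le> x) ?ys @ filter (\<lambda>x. x < t) ?ys" by (rule sorted_desc_split(2))
  moreover have "filter (\<lambda>x. t \<le> x) ?ys = filter (\<lambda>x. x = t) xs"
    by (simp add: filter_filter) (metis (mono_tags, lifting) antisym order_refl)
  moreover have "filter (\<lambda>x. x < t) ?ys = filter (\<lambda>x. x < t) xs"
    by (simp add: filter_filter) (metis (mono_tags, lifting) less_imp_le)
  ultimately have "?ys = replicate (length (filter (\<lambda>x. x = t) xs)) t @ filter (\<lambda>x. x < t) xs"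
    using filter_eq_replicate[of t xs] by simp
  then show ?thesis using sorted_desc_split(1)[OF assms, of t] by simp
qed

text \<open>Split the list at \<open>\<plusminus> t\<close>, where \<open>t\<close> is the largest positive entry whose negative also occurs.\<close>
lemma pattern_exists:
  assumes "sorted_wrt (\<ge>) xs"
  shows "\<exists>c. wf_pattern c \<and> realizes (\<ge>) c xs"
  using assms
proof (induction "length xs" arbitrary: xs rule: less_induct)
  case less
  show ?case
  proof (cases "\<exists>t>0. t \<in> set xs \<and> - t \<in> set xs")
    case False
    define as where "as = filter (\<lambda>x. 0 < x) xs"
    define bs where "bs = filter (\<lambda>x. x < 0) xs"
    define z where "z = length (filter (\<lambda>x. x = 0) xs)"
    have xs: "xs = as @ replicate z 0 @ bs"
      unfolding as_def bs_def z_def by (rule sorted_desc_split3[OF less.prems])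
    have no: "x + y \<noteq> 0" if "x \<in> set as \<union> set bs" "y \<in> set as \<union> set bs" for x y
    proof
      assume "x + y = 0"
      then have *: "y = - x" by simp
      have "x \<in> set xs" "y \<in> set xs" "x \<noteq> 0" using that by (auto simp: as_def bs_def)
      then have "0 < x \<and> x \<in> set xs \<and> - x \<in> set xs \<or> 0 < y \<and> y \<in> set xs \<and> - y \<in> set xs"
        using * by auto
      then show False using False by blast
    qed
    have s: "sorted_wrt (\<ge>) as" "sorted_wrt (\<ge>) bs"
      unfolding as_def bs_def using less.prems by (simp_all add: sorted_wrt_filter)
    show ?thesis
    proof (cases "z = 0")
      case True
      have "sorted_wrt (\<ge>) (as @ bs)" using less.prems xs True by simp
      then have "realizes (\<ge>) (Core (length (as @ bs)) 0 0) xs"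
        unfolding realizes.simps using xs True no
        by - (rule exI[where x = "[]"], rule exI[where x = "as @ bs"], simp)
      then show ?thesis by (intro exI[where x = "Core (length (as @ bs)) 0 0"]) simp
    next
      case False
      have "realizes (\<ge>) (Core (length bs) (length as) z) xs"
        unfolding realizes.simps using xs s no
        by - (rule exI[where x = as], rule exI[where x = bs], simp add: as_def bs_def)
      then show ?thesis using False by (intro exI[where x = "Core (length bs) (length as) z"]) simp
    qed
  next
    case True
    define M where "M = {t \<in> set xs. 0 < t \<and> - t \<in> set xs}"
    have M: "finite M" "M \<noteq> {}" using True by (auto simp: M_def)
    define t where "t = Max M"
    have tM: "t \<in> M" using M by (simp add: t_def)
    then have t: "0 < t" "t \<in> set xs" "- t \<in> set xs" by (auto simp: M_def)
    have big: "\<not> (t < x \<and> - x \<in> set xs)" if "x \<in> set xs" for x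
    proof
      assume "t < x \<and> - x \<in> set xs"
      then have "x \<in> M" using that t by (auto simp: M_def)
      then have "x \<le> t" using M by (simp add: t_def)
      with \<open>t < x \<and> - x \<in> set xs\<close> show False by simp
    qed
    define as where "as = filter (\<lambda>x. t < x) xs"
    define p where "p = length (filter (\<lambda>x. x = t) xs)"
    define ws where "ws = filter (\<lambda>x. x < t) xs"
    define ys where "ys = filter (\<lambda>x. - t < x) ws"
    define q where "q = length (filter (\<lambda>x. x = - t) ws)"
    define bs where "bs = filter (\<lambda>x. x < - t) ws"
    have s: "sorted_wrt (\<ge>) as" "sorted_wrt (\<ge>) ws" "sorted_wrt (\<ge>) ys" "sorted_wrt (\<ge>) bs"
      unfolding as_def ws_def ys_def bs_def using less.prems by (simp_all add: sorted_wrt_filter)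
    have "xs = as @ replicate p t @ ws"
      unfolding as_def p_def ws_def by (rule sorted_desc_split3[OF less.prems])
    moreover have "ws = ys @ replicate q (- t) @ bs"
      unfolding ys_def q_def bs_def by (rule sorted_desc_split3[OF s(2)])
    ultimately have xs: "xs = as @ replicate p t @ ys @ replicate q (- t) @ bs" by simp
    have "0 < p" unfolding p_def using t by (auto simp: filter_empty_conv)
    have "- t \<in> set ws" using t by (auto simp: ws_def)
    then have "0 < q" unfolding q_def by (auto simp: filter_empty_conv)
    have "length ys < length xs" using xs \<open>0 < p\<close> by simp
    then obtain c where c: "wf_pattern c" "realizes (\<ge>) c ys"
      using less.hyps[of ys] s by blast
    have no: "x + y \<noteq> 0" if "x \<in> set as" "y \<in> set bs" for x y
    proof
      assume "x + y = 0"
      then have "y = - x" by simp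
      then show False using that big[of x] by (auto simp: as_def bs_def ws_def)
    qed
    have "realizes (\<ge>) (Layer (length bs) (length as) p q c) xs"
      unfolding realizes.simps using xs s c t no
      by - (rule exI[where x = as], rule exI[where x = t], rule exI[where x = ys], rule exI[where x = bs],
        auto simp: as_def bs_def ys_def ws_def)
    then show ?thesis using c \<open>0 < p\<close> \<open>0 < q\<close>
      by (intro exI[where x = "Layer (length bs) (length as) p q c"]) simp
  qed
qed

section \<open>Realizable patterns are feasible\<close>

lemma sum_list_lower:
  fixes c :: real
  assumes "\<And>x. x \<in> set xs \<Longrightarrow> c < x"
  shows "length xs * c \<le> sum_list xs" "xs \<noteq> [] \<Longrightarrow> length xs * c < sum_list xs"
  using assms
proof (induction xs)
  case (Cons x xs)
  { case 1
    then show ?case using Cons.IH(1) by (force simp: algebra_simps)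
  next
    case 2
    then have "length xs * c \<le> sum_list xs" using Cons.IH(1) by auto
    then show ?case using 2 by (force simp: algebra_simps)
  }
qed auto

text \<open>Summation by parts, one layer at a time. Value every unit of height at \<open>T\<close>. Then \<open>b\<close> of the \<open>s\<close>
units outweigh the \<open>b\<close> negative entries, which exceed \<open>- T\<close>, and the others are worth at least as much as
at the smaller value \<open>t\<close> that is used for the inner pattern.\<close>
lemma nonneg_sum:
  fixes T :: real
  assumes "realizes R c xs" "wf_pattern c" "nonneg s c" "\<forall>x\<in>set xs. \<bar>x\<bar> < T" "0 < T"
  shows "0 \<le> sum_list xs + real_of_int s * T \<and> (sum_list xs + real_of_int s * T = 0 \<longrightarrow> s = 0 \<and> balanced c)"
  using assms
proof (induction c arbitrary: xs s T)
  case (Core b a z)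
  then obtain as bs where xs: "xs = as @ replicate z 0 @ bs" "length as = a" "length bs = b"
    and sg: "0 < z \<longrightarrow> (\<forall>x\<in>set as. 0 < x) \<and> (\<forall>x\<in>set bs. x < 0)" by auto
  have b: "real b \<le> s" "0 \<le> s" using Core.prems by auto
  have "a = 0 \<or> (\<forall>x\<in>set as. 0 < x)" using sg Core.prems(2) by auto
  then have A: "0 \<le> sum_list as" "a \<noteq> 0 \<Longrightarrow> 0 < sum_list as"
    using sum_list_lower[of as 0] xs by auto
  have "- T < x" if "x \<in> set bs" for x using Core.prems(4) that xs by force
  then have B: "- b * T \<le> sum_list bs" "b \<noteq> 0 \<Longrightarrow> - b * T < sum_list bs"
    using sum_list_lower[of bs "- T"] xs by auto
  have S: "sum_list xs = sum_list as + sum_list bs" using xs by (simp add: sum_list_replicate)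
  have "0 \<le> (s - b) * T" using b Core.prems by simp
  then have 1: "0 \<le> - b * T + s * T" by (simp add: algebra_simps)
  have "s = 0" if "b = 0" "- b * T + s * T = 0" using that Core.prems by simp
  have 0: "sum_list xs + s * T = sum_list as + (sum_list bs + b * T) + (- b * T + s * T)"
    unfolding S by simp
  show ?case
  proof (intro conjI impI)
    show "0 \<le> sum_list xs + s * T" using 0 1 A(1) B(1) by linarith
    assume z: "sum_list xs + s * T = 0"
    have a: "a = 0" using A(2) B(1) 0 1 z by linarith
    moreover have b: "b = 0" using A(1) B(2) 0 1 z by linarith
    ultimately show "balanced (Core b a z)" by simp
    show "s = 0" using \<open>b = 0 \<Longrightarrow> - b * T + s * T = 0 \<Longrightarrow> s = 0\<close> b A(1) B(1) 0 1 z by linarith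
  qed
next
  case (Layer b a p q c)
  then obtain as t ys bs where xs: "xs = as @ replicate p t @ ys @ replicate q (- t) @ bs"
    "length as = a" "length bs = b" and t: "0 < t" "\<forall>x\<in>set as. t < x" "\<forall>y\<in>set ys. \<bar>y\<bar> < t" and ys: "realizes R c ys"
    by auto
  define s' where "s' = s - int b + int a + int p - int q"
  have IH: "0 \<le> sum_list ys + s' * t" "sum_list ys + s' * t = 0 \<Longrightarrow> s' = 0 \<and> balanced c"
    using Layer.IH[OF ys, of s' t] Layer.prems t by (auto simp: s'_def)
  have "t < T" using Layer.prems xs t by auto
  have A: "a * t \<le> sum_list as" "a \<noteq> 0 \<Longrightarrow> a * t < sum_list as"
    using sum_list_lower[of as t] xs t by auto
  have "- T < x" if "x \<in> set bs" for x using Layer.prems(4) that xs by force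
  then have B: "- b * T \<le> sum_list bs" "b \<noteq> 0 \<Longrightarrow> - b * T < sum_list bs"
    using sum_list_lower[of bs "- T"] xs by auto
  have S: "sum_list xs = sum_list as + p * t + sum_list ys - q * t + sum_list bs"
    using xs by (simp add: sum_list_replicate)
  have b: "real b \<le> s" using Layer.prems by auto
  \<comment> \<open>the gain from lowering the bound on the absolute values for the remaining height\<close>
  define d where "d = (s - real b) * (T - t)"
  have d: "0 \<le> d" "d = 0 \<Longrightarrow> s = real b" using b \<open>t < T\<close> by (simp_all add: d_def)
  have 0: "sum_list xs + s * T = (sum_list as - a * t) + (sum_list bs + b * T) + (sum_list ys + s' * t) + d"
    unfolding S d_def s'_def by (simp add: algebra_simps)
  have "s = 0 \<and> balanced (Layer b a p q c)"
    if "a = 0" "b = 0" "sum_list ys + s' * t = 0" "d = 0"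
  proof -
    have "s = 0" using d(2) that by simp
    moreover have "s' = 0" "balanced c" using IH(2) that by auto
    ultimately show ?thesis using that by (simp add: s'_def)
  qed
  moreover have "a = 0" if "sum_list xs + s * T = 0"
    using A(2) B(1) IH(1) d(1) 0 that by linarith
  moreover have "b = 0" if "sum_list xs + s * T = 0"
    using A(1) B(2) IH(1) d(1) 0 that by linarith
  moreover have "sum_list ys + s' * t = 0 \<and> d = 0" if "sum_list xs + s * T = 0"
    using A(1) B(1) IH(1) d(1) 0 that by linarith
  moreover have "0 \<le> sum_list xs + s * T"
    using A(1) B(1) IH(1) d(1) 0 by linarith
  ultimately show ?case by blast
qed

text \<open>Turns statements on negative heights into statements on positive ones.\<close>
lemma realizes_dual:
  assumes "realizes (\<ge>) c xs" "wf_pattern c"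
  shows "realizes (\<ge>) (dual c) (map uminus (rev xs))"
  using assms
proof (induction c arbitrary: xs)
  case (Core b a z)
  then obtain as bs where xs: "xs = as @ replicate z 0 @ bs" "length as = a" "length bs = b"
    "sorted_wrt (\<ge>) as" "sorted_wrt (\<ge>) bs"
    and no: "\<forall>x\<in>set as \<union> set bs. \<forall>y\<in>set as \<union> set bs. x + y \<noteq> 0"
    and sg: "0 < z \<longrightarrow> (\<forall>x\<in>set as. 0 < x) \<and> (\<forall>x\<in>set bs. x < 0)" by auto
  define as' where "as' = map uminus (rev as)"
  define bs' where "bs' = map uminus (rev bs)"
  have s: "sorted_wrt (\<ge>) as'" "sorted_wrt (\<ge>) bs'"
    using xs by (simp_all add: as'_def bs'_def sorted_wrt_map sorted_wrt_rev)
  have e: "map uminus (rev xs) = bs' @ replicate z 0 @ as'"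
    using xs by (simp add: as'_def bs'_def)
  have no': "x + y \<noteq> 0" if "x \<in> set as' \<union> set bs'" "y \<in> set as' \<union> set bs'" for x y
  proof -
    have "- x \<in> set as \<union> set bs" "- y \<in> set as \<union> set bs" using that by (auto simp: as'_def bs'_def)
    then have "- x + - y \<noteq> 0" using no by blast
    then show ?thesis by linarith
  qed
  show ?case
  proof (cases "z = 0")
    case True
    then have "as' = []" using Core.prems xs by (simp add: as'_def)
    then show ?thesis unfolding dual.simps using True e s no' Core.prems xs
      by (auto simp: bs'_def)
  next
    case False
    then have "realizes (\<ge>) (Core a b z) (map uminus (rev xs))"
      unfolding realizes.simps using e s no' sg xs
      by - (rule exI[where x = bs'], rule exI[where x = as'], auto simp: as'_def bs'_def)
    then show ?thesis using False by simp
  qed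
next
  case (Layer b a p q c)
  then obtain as t ys bs where xs: "xs = as @ replicate p t @ ys @ replicate q (- t) @ bs"
    "length as = a" "length bs = b" "sorted_wrt (\<ge>) as" "sorted_wrt (\<ge>) bs"
    and t: "0 < t" "\<forall>x\<in>set as. t < x" "\<forall>x\<in>set bs. x < - t" "\<forall>y\<in>set ys. \<bar>y\<bar> < t"
    and no: "\<forall>x\<in>set as. \<forall>y\<in>set bs. x + y \<noteq> 0" and ys: "realizes (\<ge>) c ys"
    by auto
  define as' where "as' = map uminus (rev as)"
  define bs' where "bs' = map uminus (rev bs)"
  have s: "sorted_wrt (\<ge>) as'" "sorted_wrt (\<ge>) bs'"
    using xs by (simp_all add: as'_def bs'_def sorted_wrt_map sorted_wrt_rev)
  have e: "map uminus (rev xs) = bs' @ replicate q t @ map uminus (rev ys) @ replicate p (- t) @ as'"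
    using xs by (simp add: as'_def bs'_def)
  have no': "x + y \<noteq> 0" if "x \<in> set bs'" "y \<in> set as'" for x y
  proof -
    have "- y \<in> set as" "- x \<in> set bs" using that by (auto simp: as'_def bs'_def)
    then have "- y + - x \<noteq> 0" using no by blast
    then show ?thesis by linarith
  qed
  have "realizes (\<ge>) (dual c) (map uminus (rev ys))"
    using Layer.IH[OF ys] Layer.prems by simp
  then show ?case unfolding dual.simps realizes.simps using e s t no' xs
    by - (rule exI[where x = bs'], rule exI[where x = t], rule exI[where x = "map uminus (rev ys)"], rule exI[where x = as'],
      auto simp: as'_def bs'_def)
qed

lemma balanced_sum: "balanced c \<Longrightarrow> compat c xs \<Longrightarrow> sum_list xs = 0"
  by (induction c arbitrary: xs) (auto simp: sum_list_replicate)

text \<open>All layers cancel, and what is left is a single nonzero entry or a sum of two entries that are not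
opposite.\<close>
lemma exceptional_sum:
  assumes "exceptional c" "realizes R c xs" "wf_pattern c"
  shows "sum_list xs \<noteq> 0"
  using assms
proof (induction c arbitrary: xs)
  case (Core b a z)
  then obtain as bs where xs: "xs = as @ replicate z 0 @ bs" "length as = a" "length bs = b"
    and no: "\<forall>x\<in>set as \<union> set bs. \<forall>y\<in>set as \<union> set bs. x + y \<noteq> 0" by auto
  have S: "sum_list xs = sum_list as + sum_list bs" using xs by (simp add: sum_list_replicate)
  have one: "\<exists>x. ws = [x]" if "length ws = 1" for ws :: "real list" using that by (cases ws) auto
  consider "z \<noteq> 0" "a = 1" "b = 1" | "a = 0" "b = 1" | "a = 0" "b = 2"
    using Core.prems by (auto split: if_splits)
  then show ?case
  proof cases
    case 1
    then obtain x y where "as = [x]" "bs = [y]" using one xs by metis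
    then show ?thesis using S no by auto
  next
    case 2
    then obtain y where "bs = [y]" using one xs by metis
    then have "y + y \<noteq> 0" using no by auto
    then show ?thesis using S xs 2 \<open>bs = [y]\<close> by auto
  next
    case 3
    then obtain x y where "bs = [x, y]" using xs(3) by (cases bs; cases "tl bs") auto
    then show ?thesis using S no xs 3 by auto
  qed
next
  case (Layer b a p q c)
  then obtain as t ys bs where xs: "xs = as @ replicate p t @ ys @ replicate q (- t) @ bs"
    "length as = a" "length bs = b" and no: "\<forall>x\<in>set as. \<forall>y\<in>set bs. x + y \<noteq> 0" and ys: "realizes R c ys"
    by auto
  have "p = q" using Layer.prems by simp
  then have S: "sum_list xs = sum_list as + sum_list ys + sum_list bs"
    using xs by (simp add: sum_list_replicate)
  consider "a = 1" "b = 1" "balanced c" | "a = 0" "b = 0" "exceptional c"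
    using Layer.prems by auto
  then show ?case
  proof cases
    case 1
    then obtain x y where "as = [x]" "bs = [y]" using xs by (cases as; cases bs) auto
    then show ?thesis using S no balanced_sum[OF 1(3) realizes_imp_compat[OF ys]] by auto
  next
    case 2
    then show ?thesis using S xs Layer.IH[OF 2(3) ys] Layer.prems by simp
  qed
qed

lemma feasible_necessary:
  assumes c: "realizes (\<ge>) c xs" "wf_pattern c" and sum: "sum_list xs = 0"
  shows "feasible c"
proof -
  define T where "T = 1 + (\<Sum>x\<leftarrow>xs. \<bar>x\<bar>)"
  have "\<bar>x\<bar> \<le> (\<Sum>x\<leftarrow>xs. \<bar>x\<bar>)" if "x \<in> set xs" for x
    using that by (intro member_le_sum_list) auto
  then have T: "\<forall>x\<in>set xs. \<bar>x\<bar> < T" by (force simp: T_def)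
  have "0 \<le> (\<Sum>x\<leftarrow>xs. \<bar>x\<bar>)" by (rule sum_list_nonneg) auto
  then have "0 < T" by (simp add: T_def)
  have "balanced c" if "nonneg 0 c"
    using nonneg_sum[OF c that T \<open>0 < T\<close>] sum by simp
  moreover have "balanced c" if "nonneg 0 (dual c)"
  proof -
    have "sum_list (map uminus ws) = - sum_list ws" for ws :: "real list"
      by (induction ws) auto
    then have "sum_list (map uminus (rev xs)) = 0"
      using sum by (simp only: sum_list_rev)
    then show ?thesis
      using nonneg_sum[OF realizes_dual[OF c] wf_dual[OF c(2)] that, of T] T \<open>0 < T\<close> by auto
  qed
  moreover have "\<not> exceptional c" using exceptional_sum[OF _ c] sum by blast
  ultimately show ?thesis by (auto simp: feasible_def)
qed

section \<open>Coordinates that are forced to agree\<close>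

text \<open>Compares \<open>(x\<^sub>i, v\<^sub>i)\<close> with \<open>(x\<^sub>j, v\<^sub>j)\<close>. If a list of such pairs is sorted by this relation, then \<open>x + \<epsilon> v\<close>
is still decreasing for small \<open>\<epsilon>\<close>.\<close>
definition tie_order :: "real \<times> real \<Rightarrow> real \<times> real \<Rightarrow> bool" where
  "tie_order u v \<longleftrightarrow> fst u > fst v \<or> u = v"

lemma sorted_tie_order_zip:
  assumes "sorted_wrt (>) xs"
  shows "sorted_wrt tie_order (zip xs vs)"
  using assms
proof (induction xs arbitrary: vs)
  case (Cons x xs)
  have IH: "sorted_wrt tie_order (zip xs ws)" for ws using Cons by simp
  have srt: "sorted_wrt (>) (x # xs)" using Cons.prems .
  show ?case
  proof (cases vs)
    case (Cons v ws)
    have "fst u < x" if "u \<in> set (zip xs ws)" for u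
      using that srt set_zip_leftD[of "fst u" "snd u" xs ws] by auto
    then have "tie_order (x, v) u" if "u \<in> set (zip xs ws)" for u
      using that by (simp add: tie_order_def)
    then show ?thesis using \<open>vs = v # ws\<close> IH[of ws] by simp
  qed simp
qed simp

lemma sorted_tie_order_replicate: "sorted_wrt tie_order (replicate n u)"
  by (induction n) (auto simp: tie_order_def[of u u])

lemma realizes_ties:
  assumes "realizes (>) c xs" "compat c vs" "wf_pattern c"
  shows "sorted_wrt tie_order (zip xs vs)"
  using assms
proof (induction c arbitrary: xs vs)
  case (Core b a z)
  then obtain as bs where xs: "xs = as @ replicate z 0 @ bs" "length as = a" "length bs = b"
    "sorted_wrt (>) as" "sorted_wrt (>) bs"
    and sg: "0 < z \<longrightarrow> (\<forall>x\<in>set as. 0 < x) \<and> (\<forall>x\<in>set bs. x < 0)" by auto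
  from Core.prems obtain as' bs' where vs: "vs = as' @ replicate z 0 @ bs'" "length as' = a" "length bs' = b"
    by auto
  have e: "zip xs vs = zip as as' @ replicate z (0, 0) @ zip bs bs'"
    using xs vs by (simp add: zip_replicate)
  have lt: "tie_order u v" if "fst u > fst v" for u v using that by (simp add: tie_order_def)
  have s: "sorted_wrt tie_order (zip as as')" "sorted_wrt tie_order (zip bs bs')"
    using xs vs by (simp_all add: sorted_tie_order_zip)
  have mem: "fst u \<in> set ws" if "u \<in> set (zip ws ws')" for u and ws ws' :: "real list"
    using that set_zip_leftD[of "fst u" "snd u" ws ws'] by simp
  show ?case
  proof (cases "z = 0")
    case True
    then have "as = []" using Core.prems xs by simp
    then show ?thesis using e s True by simp
  next
    case False
    have "tie_order u v" if "u \<in> set (zip as as')" "v \<in> set (replicate z (0, 0)) \<union> set (zip bs bs')" for u v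
      using mem[OF that(1)] mem[of v bs bs'] that(2) sg False by (intro lt) (auto, force)
    moreover have "tie_order u v" if "u \<in> set (replicate z (0, 0))" "v \<in> set (zip bs bs')" for u v
      using mem[OF that(2)] that(1) sg False by (intro lt) auto
    ultimately show ?thesis unfolding e sorted_wrt_append using s by (auto simp: sorted_tie_order_replicate)
  qed
next
  case (Layer b a p q c)
  then obtain as t ys bs where xs: "xs = as @ replicate p t @ ys @ replicate q (- t) @ bs"
    "length as = a" "length bs = b" "sorted_wrt (>) as" "sorted_wrt (>) bs"
    and t: "0 < t" "\<forall>x\<in>set as. t < x" "\<forall>x\<in>set bs. x < - t" "\<forall>y\<in>set ys. \<bar>y\<bar> < t" and ys: "realizes (>) c ys"
    by auto
  from Layer.prems obtain as' t' ys' bs' where vs: "vs = as' @ replicate p t' @ ys' @ replicate q (- t') @ bs'"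
    "length as' = a" "length bs' = b" and ys': "compat c ys'" by auto
  have "length ys = length ys'" using compat_length[OF ys'] compat_length[OF realizes_imp_compat[OF ys]] by simp
  then have e: "zip xs vs = zip as as' @ replicate p (t, t') @ zip ys ys' @ replicate q (- t, - t') @ zip bs bs'"
    using xs vs by (simp add: zip_replicate)
  have lt: "tie_order u v" if "fst u > fst v" for u v using that by (simp add: tie_order_def)
  have s: "sorted_wrt tie_order (zip as as')" "sorted_wrt tie_order (zip bs bs')"
    using xs vs by (simp_all add: sorted_tie_order_zip)
  have IH: "sorted_wrt tie_order (zip ys ys')" using Layer.IH ys ys' Layer.prems by simp
  have mem: "fst u \<in> set ws" if "u \<in> set (zip ws ws')" for u and ws ws' :: "real list"
    using that set_zip_leftD[of "fst u" "snd u" ws ws'] by simp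
  have A: "t < fst u" if "u \<in> set (zip as as')" for u using mem[OF that] t by blast
  have B: "fst u < - t" if "u \<in> set (zip bs bs')" for u using mem[OF that] t by blast
  have C: "- t < fst u" "fst u < t" if "u \<in> set (zip ys ys')" for u using mem[OF that] t by fastforce+
  have 1: "tie_order u v" if "u \<in> set (zip as as')"
    "v \<in> set (replicate p (t, t') @ zip ys ys' @ replicate q (- t, - t') @ zip bs bs')" for u v
    using A[OF that(1)] that(2) B[of v] C[of v] t(1) by (intro lt) (fastforce split: if_splits)
  have 2: "tie_order u v" if "u \<in> set (replicate p (t, t'))"
    "v \<in> set (zip ys ys' @ replicate q (- t, - t') @ zip bs bs')" for u v
    using that B[of v] C[of v] t(1) by (intro lt) (fastforce split: if_splits)
  have 3: "tie_order u v" if "u \<in> set (zip ys ys')" "v \<in> set (replicate q (- t, - t') @ zip bs bs')" for u v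
    using that B[of v] C[of u] t(1) by (intro lt) (fastforce split: if_splits)
  have 4: "tie_order u v" if "u \<in> set (replicate q (- t, - t'))" "v \<in> set (zip bs bs')" for u v
    using that B[of v] by (intro lt) auto
  show ?case unfolding e
    by (intro sorted_wrt_append[THEN iffD2] conjI ballI sorted_tie_order_replicate s IH; (elim 1 2 3 4)?)
qed

section \<open>Feasible patterns are realizable\<close>

text \<open>A point from a word: every letter \<open>(p, q)\<close> is an absolute value that occurs \<open>p\<close> times with positive
and \<open>q\<close> times with negative sign, and \<open>f\<close> assigns the absolute values, outermost first.\<close>
fun build :: "(nat \<times> nat) list \<Rightarrow> (nat \<Rightarrow> real) \<Rightarrow> nat \<Rightarrow> real list" where
  "build [] f z = replicate z 0"
| "build ((p, q) # ls) f z = replicate p (f 0) @ build ls (\<lambda>i. f (Suc i)) z @ replicate q (- f 0)"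

fun central_zeros :: "pattern \<Rightarrow> nat" where
  "central_zeros (Core b a z) = z"
| "central_zeros (Layer b a p q c) = central_zeros c"

definition units :: "(nat \<times> nat) list \<Rightarrow> bool" where
  "units us \<longleftrightarrow> set us \<subseteq> {(1, 0), (0, 1)}"

lemma length_units: "units us \<Longrightarrow> length us = count_list us (1, 0) + count_list us (0, 1)"
  by (induction us) (auto simp: units_def)

text \<open>The words obtained from a pattern by choosing an order of the unmatched entries, and their signs in
a core without zeros.\<close>
fun expands :: "pattern \<Rightarrow> (nat \<times> nat) list \<Rightarrow> bool" where
  "expands (Core b a z) ls \<longleftrightarrow> units ls \<and>
     (if z = 0 then length ls = b else count_list ls (1, 0) = a \<and> count_list ls (0, 1) = b)"
| "expands (Layer b a p q c) ls \<longleftrightarrow> (\<exists>us ls'. ls = us @ (p, q) # ls' \<and> units us \<and>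
     count_list us (1, 0) = a \<and> count_list us (0, 1) = b \<and> expands c ls')"

text \<open>Values are assigned on all of \<open>nat\<close>, so that shifting needs no length bookkeeping.\<close>
definition decr :: "(nat \<Rightarrow> real) \<Rightarrow> bool" where
  "decr f \<longleftrightarrow> (\<forall>i. 0 < f i \<and> f (Suc i) < f i)"

lemma decr_shift: "decr f \<Longrightarrow> decr (\<lambda>i. f (i + k))"
  by (simp add: decr_def)

lemma decr_le: "decr f \<Longrightarrow> f k \<le> f 0"
  by (induction k) (auto simp: decr_def intro: order_trans less_imp_le)

text \<open>A run of unmatched entries wraps the rest of the list: the positive ones come in front in the order of
the word, the negative ones behind in the opposite order.\<close>
lemma build_units:
  assumes "units us" "decr f"
  shows "\<exists>as bs. (\<forall>ls z. build (us @ ls) f z = as @ build ls (\<lambda>i. f (i + length us)) z @ bs) \<and>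
    length as = count_list us (1, 0) \<and> length bs = count_list us (0, 1) \<and>
    sorted_wrt (>) as \<and> sorted_wrt (>) bs \<and>
    (\<forall>x\<in>set as. f (length us) < x \<and> x \<le> f 0) \<and> (\<forall>y\<in>set bs. - f 0 \<le> y \<and> y < - f (length us)) \<and>
    (\<forall>x\<in>set as. \<forall>y\<in>set bs. x + y \<noteq> 0)"
  using assms
proof (induction us arbitrary: f)
  case Nil
  show ?case by (rule exI[of _ "[]"], rule exI[of _ "[]"]) simp
next
  case (Cons u us)
  define g where "g = (\<lambda>i. f (Suc i))"
  have g: "decr g" "g 0 < f 0" "0 < f 0" using Cons.prems by (auto simp: g_def decr_def)
  obtain as bs where IH: "\<And>ls z. build (us @ ls) g z = as @ build ls (\<lambda>i. g (i + length us)) z @ bs"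
    "length as = count_list us (1, 0)" "length bs = count_list us (0, 1)"
    "sorted_wrt (>) as" "sorted_wrt (>) bs"
    "\<forall>x\<in>set as. g (length us) < x \<and> x \<le> g 0" "\<forall>y\<in>set bs. - g 0 \<le> y \<and> y < - g (length us)"
    "\<forall>x\<in>set as. \<forall>y\<in>set bs. x + y \<noteq> 0"
    using Cons.IH[of g] Cons.prems g by (auto simp: units_def)
  have gl: "g (length us) < f 0" using decr_le[OF g(1)] g(2) by (rule le_less_trans)
  from Cons.prems(1) consider "u = (1, 0)" | "u = (0, 1)" by (auto simp: units_def)
  then show ?case
  proof cases
    case 1
    have "x \<noteq> - f 0" if "x \<in> set bs" for x using IH(7) that g(2) by force
    then have "f 0 + y \<noteq> 0" if "y \<in> set bs" for y using that by force
    moreover have "x < f 0" if "x \<in> set as" for x using IH(6) that g(2) by force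
    moreover have "build (u # us @ ls) f z = (f 0 # as) @ build ls (\<lambda>i. f (i + length (u # us))) z @ bs" for ls z
      using IH(1)[of ls z] 1 by (simp add: g_def)
    moreover have "- f 0 \<le> y" if "y \<in> set bs" for y using IH(7) that g(2) by force
    ultimately show ?thesis
      using IH(2-8) gl 1 by (intro exI[of _ "f 0 # as"] exI[of _ bs]) (auto simp: g_def intro: less_imp_le)
  next
    case 2
    have "x \<noteq> f 0" if "x \<in> set as" for x using IH(6) that g(2) by force
    then have "x + - f 0 \<noteq> 0" if "x \<in> set as" for x using that by force
    moreover have "- f 0 < y" if "y \<in> set bs" for y using IH(7) that g(2) by force
    moreover have "build (u # us @ ls) f z = as @ build ls (\<lambda>i. f (i + length (u # us))) z @ (bs @ [- f 0])" for ls z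
      using IH(1)[of ls z] 2 by (simp add: g_def)
    moreover have "x \<le> f 0" if "x \<in> set as" for x using IH(6) that g(2) by force
    ultimately show ?thesis
      using IH(2-8) gl 2
      by (intro exI[of _ as] exI[of _ "bs @ [- f 0]"]) (auto simp: g_def sorted_wrt_append intro: less_imp_le)
  qed
qed

lemma build_realizes:
  assumes "expands c ls" "wf_pattern c" "decr f"
  shows "realizes (>) c (build ls f (central_zeros c)) \<and> (\<forall>x\<in>set (build ls f (central_zeros c)). \<bar>x\<bar> \<le> f 0)"
  using assms
proof (induction c arbitrary: ls f)
  case (Core b a z)
  obtain as bs where ab: "\<And>ls' z. build (ls @ ls') f z = as @ build ls' (\<lambda>i. f (i + length ls)) z @ bs"
    "length as = count_list ls (1, 0)" "length bs = count_list ls (0, 1)"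
    "sorted_wrt (>) as" "sorted_wrt (>) bs"
    "\<forall>x\<in>set as. f (length ls) < x \<and> x \<le> f 0" "\<forall>y\<in>set bs. - f 0 \<le> y \<and> y < - f (length ls)"
    "\<forall>x\<in>set as. \<forall>y\<in>set bs. x + y \<noteq> 0"
    using build_units[of ls f] Core.prems by auto
  have bld: "build ls f z = as @ replicate z 0 @ bs" using ab(1)[of "[]" z] by simp
  have pos: "0 < f i" for i using Core.prems by (simp add: decr_def)
  have sg: "0 < x" if "x \<in> set as" for x using that ab(6) pos by (meson less_trans)
  have sg': "y < 0" if "y \<in> set bs" for y using that ab(7) pos[of "length ls"] by force
  have no: "x + y \<noteq> 0" if "x \<in> set as \<union> set bs" "y \<in> set as \<union> set bs" for x y
    using that ab(8) sg[of x] sg[of y] sg'[of x] sg'[of y] by (fastforce simp: add.commute)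
  have bd: "\<bar>x\<bar> \<le> f 0" if "x \<in> set as \<union> set (replicate z 0) \<union> set bs" for x
    using that ab(6,7) sg[of x] sg'[of x] pos[of 0] by (force split: if_splits)
  have "realizes (>) (Core b a z) (build ls f z)"
  proof (cases "z = 0")
    case True
    have "length ls = length as + length bs"
      using length_units[of ls] Core.prems(1) ab(2,3) by auto
    moreover have "sorted_wrt (>) (as @ bs)"
      using ab(4,5) sg sg' by (force simp: sorted_wrt_append)
    ultimately show ?thesis unfolding realizes.simps bld using Core.prems True no
      by - (rule exI[of _ "[]"], rule exI[of _ "as @ bs"], simp)
  next
    case False
    then show ?thesis unfolding realizes.simps bld using ab Core.prems sg sg' no
      by - (rule exI[of _ as], rule exI[of _ bs], auto)
  qed
  then show ?case using bd bld by auto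
next
  case (Layer b a p q c)
  then obtain us ls' where ls: "ls = us @ (p, q) # ls'" and us: "units us"
     "count_list us (1, 0) = a" "count_list us (0, 1) = b" "expands c ls'" by auto
  let ?z = "central_zeros c"
  obtain as bs where ab: "\<And>ls' z. build (us @ ls') f z = as @ build ls' (\<lambda>i. f (i + length us)) z @ bs"
    "length as = count_list us (1, 0)" "length bs = count_list us (0, 1)"
    "sorted_wrt (>) as" "sorted_wrt (>) bs"
    "\<forall>x\<in>set as. f (length us) < x \<and> x \<le> f 0" "\<forall>y\<in>set bs. - f 0 \<le> y \<and> y < - f (length us)"
    "\<forall>x\<in>set as. \<forall>y\<in>set bs. x + y \<noteq> 0"
    using build_units[of us f] us Layer.prems by auto
  define t where "t = f (length us)"
  define g where "g = (\<lambda>i. f (Suc i + length us))"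
  define ys where "ys = build ls' g ?z"
  have g: "decr g" using decr_shift[OF Layer.prems(3), of "Suc (length us)"] by (simp add: g_def)
  have pos: "0 < t" "g 0 < t" "t \<le> f 0" using Layer.prems(3) decr_le by (auto simp: decr_def t_def g_def)
  have ys: "realizes (>) c ys" "\<forall>x\<in>set ys. \<bar>x\<bar> \<le> g 0"
    using Layer.IH[OF us(4) _ g] Layer.prems by (auto simp: ys_def)
  have bld: "build ls f ?z = as @ replicate p t @ ys @ replicate q (- t) @ bs"
    using ab(1)[of "(p, q) # ls'" ?z] by (simp add: ls t_def ys_def g_def)
  have in_ys: "\<bar>y\<bar> < t" if "y \<in> set ys" for y using that ys(2) pos by force
  have "realizes (>) (Layer b a p q c) (build ls f ?z)"
    unfolding realizes.simps bld using ab us ys pos in_ys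
    by - (rule exI[of _ as], rule exI[of _ t], rule exI[of _ ys], rule exI[of _ bs], auto simp: t_def)
  moreover have "\<bar>x\<bar> \<le> f 0" if "x \<in> set (build ls f ?z)" for x
  proof -
    from that consider "x \<in> set as" | "\<bar>x\<bar> = t" | "x \<in> set ys" | "x \<in> set bs"
      using pos by (auto simp: bld split: if_splits)
    then show ?thesis
    proof cases
      case 1 then show ?thesis using ab(6) pos by (fastforce simp: t_def)
    next
      case 3 then show ?thesis using in_ys pos by fastforce
    next
      case 4 then show ?thesis using ab(7) pos by (fastforce simp: t_def)
    qed (use pos in simp)
  qed
  ultimately show ?case by simp
qed

fun height :: "(nat \<times> nat) list \<Rightarrow> int" where
  "height [] = 0"
| "height ((p, q) # ls) = int p - int q + height ls"

lemma height_append [simp]: "height (ls @ ls') = height ls + height ls'"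
  by (induction ls rule: height.induct) auto

lemma height_replicate [simp]: "height (replicate n (p, q)) = int n * (int p - int q)"
  by (induction n) (auto simp: algebra_simps)

fun wsum :: "(nat \<times> nat) list \<Rightarrow> (nat \<Rightarrow> real) \<Rightarrow> real" where
  "wsum [] f = 0"
| "wsum ((p, q) # ls) f = (real p - real q) * f 0 + wsum ls (\<lambda>i. f (Suc i))"

lemma sum_build: "sum_list (build ls f z) = wsum ls f"
  by (induction ls f rule: wsum.induct) (auto simp: sum_list_replicate algebra_simps)

text \<open>Raising the first \<open>k\<close> absolute values by \<open>r\<close> changes the sum by \<open>r\<close> times a height.\<close>
lemma wsum_raise:
  "wsum ls (\<lambda>i. f i + (if i < k then r else 0)) = wsum ls f + r * real_of_int (height (take k ls))"
proof (induction ls arbitrary: f k)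
  case (Cons u ls)
  obtain p q where u: "u = (p, q)" by (cases u)
  show ?case
  proof (cases k)
    case (Suc m)
    then show ?thesis using Cons.IH[of "\<lambda>i. f (Suc i)" m] by (simp add: u algebra_simps)
  qed simp
qed simp

definition crosses :: "(nat \<times> nat) list \<Rightarrow> bool" where
  "crosses ls \<longleftrightarrow> (\<exists>k. 0 < height (take k ls)) \<and> (\<exists>k. height (take k ls) < 0)"

text \<open>Start with any decreasing values; a height of the right sign allows the sum to be corrected to zero by
raising an initial segment of the values.\<close>
lemma crosses_sum_zero:
  assumes "crosses ls"
  shows "\<exists>f. decr f \<and> wsum ls f = 0"
proof -
  define f :: "nat \<Rightarrow> real" where "f = (\<lambda>i. 1 / (real i + 1))"
  obtain k where k: "height (take k ls) \<noteq> 0" "wsum ls f * real_of_int (height (take k ls)) \<le> 0"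
  proof (cases "0 \<le> wsum ls f")
    case True
    obtain k where "height (take k ls) < 0" using assms by (auto simp: crosses_def)
    then show ?thesis using True by (intro that[of k]) (auto simp: mult_nonneg_nonpos)
  next
    case False
    obtain k where "0 < height (take k ls)" using assms by (auto simp: crosses_def)
    then show ?thesis using False by (intro that[of k]) (auto simp: mult_nonpos_nonneg)
  qed
  define r where "r = - wsum ls f / real_of_int (height (take k ls))"
  have "0 \<le> r" using k by (auto simp: r_def divide_le_0_iff mult_le_0_iff)
  have f: "0 < f i" "f (Suc i) < f i" for i by (auto simp: f_def divide_simps)
  have "0 < f i + (if i < k then r else 0)"
      "f (Suc i) + (if Suc i < k then r else 0) < f i + (if i < k then r else 0)" for i
    using \<open>0 \<le> r\<close> f(1)[of i] f(2)[of i] by auto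
  then have "decr (\<lambda>i. f i + (if i < k then r else 0))" by (simp add: decr_def)
  moreover have "wsum ls (\<lambda>i. f i + (if i < k then r else 0)) = 0"
    unfolding wsum_raise using k by (simp add: r_def)
  ultimately show ?thesis by blast
qed

lemma count_list_replicate: "count_list (replicate n x) y = (if x = y then n else 0)"
  by (induction n) auto

lemma units_simps [simp]: "units []" "units (u # us) \<longleftrightarrow> (u = (1, 0) \<or> u = (0, 1)) \<and> units us"
  "units (us @ vs) \<longleftrightarrow> units us \<and> units vs" "units (replicate n u) \<longleftrightarrow> n = 0 \<or> u = (1, 0) \<or> u = (0, 1)"
  by (auto simp: units_def)

lemma expands_exists: "wf_pattern c \<Longrightarrow> \<exists>ls. expands c ls"
proof (induction c)
  case (Core b a z)
  then show ?case
    by (intro exI[of _ "replicate a (1, 0) @ replicate b (0, 1)"]) (auto simp: count_list_replicate)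
next
  case (Layer b a p q c)
  then obtain ls where "expands c ls" by auto
  then show ?case unfolding expands.simps
    by (intro exI[of _ "(replicate a (1, 0) @ replicate b (0, 1)) @ (p, q) # ls"]
        exI[of _ "replicate a (1, 0) @ replicate b (0, 1)"] exI[of _ ls])
      (auto simp: count_list_replicate)
qed

lemma expands_Layer:
  "units us \<Longrightarrow> expands c ls \<Longrightarrow> expands (Layer (count_list us (0, 1)) (count_list us (1, 0)) p q c) (us @ (p, q) # ls)"
  unfolding expands.simps by blast

text \<open>Taking the steps down first in every segment reaches the minimal heights.\<close>
lemma not_nonneg_expansion:
  "wf_pattern c \<Longrightarrow> \<not> nonneg s c \<Longrightarrow> \<exists>ls k. expands c ls \<and> s + height (take k ls) < 0"
proof (induction c arbitrary: s)
  case (Core b a z)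
  then show ?case
    by (intro exI[of _ "replicate b (0, 1) @ replicate a (1, 0)"] exI[of _ b]) (auto simp: count_list_replicate)
next
  case (Layer b a p q c)
  let ?us = "replicate b (0::nat, 1::nat) @ replicate a (1, 0)"
  have us: "units ?us" "count_list ?us (0, 1) = b" "count_list ?us (1, 0) = a"
    by (auto simp: count_list_replicate)
  show ?case
  proof (cases "int b \<le> s")
    case False
    obtain ls where "expands c ls" using expands_exists Layer.prems by auto
    then have "expands (Layer b a p q c) (?us @ (p, q) # ls)" using expands_Layer[of ?us c ls p q] us by simp
    then show ?thesis using False by (intro exI[of _ "?us @ (p, q) # ls"] exI[of _ b]) auto
  next
    case True
    then obtain ls k where ls: "expands c ls" "s - int b + int a + int p - int q + height (take k ls) < 0"
      using Layer.IH[of "s - int b + int a + int p - int q"] Layer.prems by auto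
    then have "expands (Layer b a p q c) (?us @ (p, q) # ls)" using expands_Layer[of ?us c ls p q] us by simp
    then show ?thesis using ls(2)
      by (intro exI[of _ "?us @ (p, q) # ls"] exI[of _ "Suc (length ?us + k)"]) auto
  qed
qed

lemma height_swap: "height (map prod.swap ls) = - height ls"
  by (induction ls rule: height.induct) auto

lemma count_list_swap: "count_list (map prod.swap us) u = count_list us (prod.swap u)"
  by (induction us) (auto simp: prod.swap_def prod_eq_iff)

lemma units_swap: "units us \<Longrightarrow> units (map prod.swap us)"
  by (auto simp: units_def)

lemma expands_swap: "wf_pattern c \<Longrightarrow> expands c ls \<Longrightarrow> expands (dual c) (map prod.swap ls)"
proof (induction c arbitrary: ls)
  case (Core b a z)
  then show ?case by (auto simp: units_swap count_list_swap)
next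
  case (Layer b a p q c)
  then obtain us ls' where "ls = us @ (p, q) # ls'" "units us" "count_list us (1, 0) = a"
    "count_list us (0, 1) = b" "expands c ls'" by auto
  then show ?case
    using expands_Layer[of "map prod.swap us" "dual c" "map prod.swap ls'" q p] Layer
    by (simp add: units_swap count_list_swap)
qed

lemma not_nonpos_expansion:
  assumes "wf_pattern c" "\<not> nonneg (- s) (dual c)"
  shows "\<exists>ls k. expands c ls \<and> 0 < s + height (take k ls)"
proof -
  obtain ls k where "expands (dual c) ls" "- s + height (take k ls) < 0"
    using not_nonneg_expansion[of "dual c" "- s"] assms by auto
  then show ?thesis
    using expands_swap[of "dual c" ls] assms(1)
    by (intro exI[of _ "map prod.swap ls"] exI[of _ k]) (auto simp: take_map height_swap)
qed

lemma crossesI: "0 < height (take k ls) \<Longrightarrow> height (take k' ls) < 0 \<Longrightarrow> crosses ls"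
  by (auto simp: crosses_def)

lemma crosses_appendI:
  assumes "crosses us"
  shows "crosses (us @ vs)"
proof -
  obtain k k' where k: "0 < height (take k us)" "height (take k' us) < 0"
    using assms by (auto simp: crosses_def)
  have "take (min m (length us)) (us @ vs) = take m us" for m
    by (cases "m \<le> length us") auto
  with k show ?thesis
    by (intro crossesI[of "min k (length us)" _ "min k' (length us)"]) simp_all
qed

text \<open>One step up followed by at least two steps down crosses zero, and so does the reverse.\<close>
lemma unit_word_crosses:
  assumes "1 \<le> a" "1 \<le> b" "\<not> (a = 1 \<and> b = 1)"
  shows "\<exists>us. units us \<and> count_list us (1, 0) = a \<and> count_list us (0, 1) = b \<and> crosses us"
proof (cases "2 \<le> b")
  case True
  let ?us = "(1::nat, 0::nat) # replicate b (0, 1) @ replicate (a - 1) (1, 0)"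
  have "crosses ?us" by (rule crossesI[of 1 _ "Suc b"]) (use True in auto)
  then show ?thesis using assms by (intro exI[of _ ?us]) (auto simp: count_list_replicate)
next
  case False
  let ?us = "(0::nat, 1::nat) # replicate a (1, 0)"
  have "crosses ?us" by (rule crossesI[of "Suc a" _ 1]) (use False assms in auto)
  then show ?thesis using assms False by (intro exI[of _ ?us]) (auto simp: count_list_replicate)
qed

text \<open>Follow the pattern while the height is zero. The first nonempty segment or unequal layer
decides: a segment with both signs and more than two entries crosses zero by itself; if only one sign
occurs, the opposite height is supplied by the rest of the pattern, which violates its one-sided
condition from the current height. A segment with one entry of each sign can be ordered
so that it supplies whichever sign the rest lacks, unless the rest is balanced.\<close>
lemma crossing_expansion:
  "wf_pattern c \<Longrightarrow> \<not> nonneg 0 c \<Longrightarrow> \<not> nonneg 0 (dual c) \<Longrightarrow> \<not> exceptional c \<Longrightarrow> \<exists>ls. expands c ls \<and> crosses ls"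
proof (induction c)
  case (Core b a z)
  show ?case
  proof (cases "z = 0")
    case True
    then have "2 < b" using Core.prems by (auto split: if_splits)
    have "\<exists>us. units us \<and> count_list us (1, 0) = 1 \<and> count_list us (0, 1) = b - 1 \<and> crosses us"
      by (rule unit_word_crosses) (use \<open>2 < b\<close> in auto)
    then obtain us where "units us" "count_list us (1, 0) = 1" "count_list us (0, 1) = b - 1" "crosses us"
      by blast
    then show ?thesis using True \<open>2 < b\<close> length_units[of us] by (intro exI[of _ us]) auto
  next
    case False
    have "\<exists>us. units us \<and> count_list us (1, 0) = a \<and> count_list us (0, 1) = b \<and> crosses us"
      by (rule unit_word_crosses) (use False Core.prems in auto)
    then obtain us where "units us" "count_list us (1, 0) = a" "count_list us (0, 1) = b" "crosses us"
      by blast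
    then show ?thesis using False by auto
  qed
next
  case (Layer b a p q c)
  have wf: "wf_pattern c" using Layer.prems by simp
  have eq: "?case" if "units us" "count_list us (1, 0) = a" "count_list us (0, 1) = b" "expands c ls"
    "crosses (us @ (p, q) # ls)" for us ls
    using that expands_Layer[of us c ls p q] by blast
  consider "a = 0" "b = 0" | "1 \<le> a" "b = 0" | "a = 0" "1 \<le> b" | "a = 1" "b = 1" | "1 \<le> a" "1 \<le> b" "\<not> (a = 1 \<and> b = 1)"
    by linarith
  then show ?case
  proof cases
    case 1
    consider "p = q" | "p < q" | "q < p" by linarith
    then show ?thesis
    proof cases
      case 1
      then have "\<not> nonneg 0 c" "\<not> nonneg 0 (dual c)" "\<not> exceptional c"
        using Layer.prems \<open>a = 0\<close> \<open>b = 0\<close> by auto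
      then obtain ls where ls: "expands c ls" "crosses ls" using Layer.IH wf by blast
      obtain k k' where "0 < height (take k ls)" "height (take k' ls) < 0" using ls by (auto simp: crosses_def)
      then have "crosses ([] @ (p, q) # ls)" using 1
        by (intro crossesI[of "Suc k" _ "Suc k'"]) auto
      then show ?thesis using \<open>a = 0\<close> \<open>b = 0\<close> ls by (intro eq[of "[]" ls]) auto
    next
      case 2
      then have "\<not> nonneg (- (int p - int q)) (dual c)" using Layer.prems \<open>a = 0\<close> \<open>b = 0\<close> by auto
      then obtain ls k where ls: "expands c ls" "0 < int p - int q + height (take k ls)"
        using not_nonpos_expansion[OF wf] by blast
      have "crosses ([] @ (p, q) # ls)" using 2 ls
        by (intro crossesI[of "Suc k" _ 1]) auto
      then show ?thesis using \<open>a = 0\<close> \<open>b = 0\<close> ls by (intro eq[of "[]" ls]) auto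
    next
      case 3
      then have "\<not> nonneg (int p - int q) c" using Layer.prems \<open>a = 0\<close> \<open>b = 0\<close> by auto
      then obtain ls k where ls: "expands c ls" "int p - int q + height (take k ls) < 0"
        using not_nonneg_expansion[OF wf] by blast
      have "crosses ([] @ (p, q) # ls)" using 3 ls
        by (intro crossesI[of 1 _ "Suc k"]) auto
      then show ?thesis using \<open>a = 0\<close> \<open>b = 0\<close> ls by (intro eq[of "[]" ls]) auto
    qed
  next
    case 2
    then have "\<not> nonneg (int a + int p - int q) c" using Layer.prems by auto
    then obtain ls k where ls: "expands c ls" "int a + int p - int q + height (take k ls) < 0"
      using not_nonneg_expansion[OF wf] by blast
    have "crosses (replicate a (1, 0) @ (p, q) # ls)" using 2 ls
      by (intro crossesI[of a _ "Suc (a + k)"]) auto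
    then show ?thesis using 2 ls by (intro eq[of "replicate a (1, 0)" ls]) (auto simp: count_list_replicate)
  next
    case 3
    then have "\<not> nonneg (- (- int b + int p - int q)) (dual c)" using Layer.prems by (auto simp: algebra_simps)
    then obtain ls k where ls: "expands c ls" "0 < - int b + int p - int q + height (take k ls)"
      using not_nonpos_expansion[OF wf] by blast
    have "crosses (replicate b (0, 1) @ (p, q) # ls)" using 3 ls
      by (intro crossesI[of "Suc (b + k)" _ b]) auto
    then show ?thesis using 3 ls by (intro eq[of "replicate b (0, 1)" ls]) (auto simp: count_list_replicate)
  next
    case 4
    have up: "?thesis" if "expands c ls" "0 < int p - int q + height (take k ls)" for ls k
      using that 4 by (intro eq[of "[(0, 1), (1, 0)]" ls] crossesI[of "Suc (Suc (Suc k))" _ 1]) auto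
    have down: "?thesis" if "expands c ls" "int p - int q + height (take k ls) < 0" for ls k
      using that 4 by (intro eq[of "[(1, 0), (0, 1)]" ls] crossesI[of 1 _ "Suc (Suc (Suc k))"]) auto
    obtain ls where ls: "expands c ls" using expands_exists[OF wf] by blast
    consider "p = q" | "p < q" | "q < p" by linarith
    then show ?thesis
    proof cases
      case 1
      then have "\<not> balanced c" using Layer.prems 4 by auto
      then consider "\<not> nonneg 0 c" | "\<not> nonneg (- 0) (dual c)" using nonneg_both[OF wf, of 0] by auto
      then show ?thesis
      proof cases
        case A: 1
        then obtain ls k where "expands c ls" "0 + height (take k ls) < 0"
          using not_nonneg_expansion[OF wf] by blast
        then show ?thesis using down 1 by simp
      next
        case 2
        then obtain ls k where "expands c ls" "0 < 0 + height (take k ls)"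
          using not_nonpos_expansion[OF wf] by blast
        then show ?thesis using up 1 by simp
      qed
    next
      case 2
      then show ?thesis using down[OF ls, of 0] by simp
    next
      case 3
      then show ?thesis using up[OF ls, of 0] by simp
    qed
  next
    case 5
    then obtain us where us: "units us" "count_list us (1, 0) = a" "count_list us (0, 1) = b" "crosses us"
      using unit_word_crosses[of a b] by blast
    obtain ls where "expands c ls" using expands_exists[OF wf] by blast
    then show ?thesis using us by (intro eq[of us ls] crosses_appendI)
  qed
qed

lemma feasible_sufficient:
  assumes "wf_pattern c" "feasible c"
  shows "\<exists>xs. realizes (>) c xs \<and> sum_list xs = 0"
proof (cases "balanced c")
  case True
  obtain ls where ls: "expands c ls" using expands_exists[OF assms(1)] by blast
  define f :: "nat \<Rightarrow> real" where "f = (\<lambda>i. 1 / (real i + 1))"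
  have "decr f" by (auto simp: decr_def f_def divide_simps)
  then have "realizes (>) c (build ls f (central_zeros c))"
    using build_realizes[OF ls assms(1)] by blast
  then show ?thesis using balanced_sum[OF True realizes_imp_compat] by blast
next
  case False
  then obtain ls where ls: "expands c ls" "crosses ls"
    using crossing_expansion[OF assms(1)] assms(2) by (auto simp: feasible_def)
  obtain f where f: "decr f" "wsum ls f = 0" using crosses_sum_zero[OF ls(2)] by blast
  then have "realizes (>) c (build ls f (central_zeros c))"
    using build_realizes[OF ls(1) assms(1)] by blast
  then show ?thesis using f sum_build by metis
qed

section \<open>Flats and patterns\<close>

abbreviation coord :: "rvec \<Rightarrow> nat \<Rightarrow> real" where "coord \<equiv> Poly_Mapping.lookup"

definition coords :: "nat \<Rightarrow> rvec \<Rightarrow> real list" where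
  "coords n v = map (\<lambda>i. coord v (Suc i)) [0..<n]"

definition vec :: "real list \<Rightarrow> rvec" where
  "vec xs = Abs_poly_mapping (\<lambda>i. if 1 \<le> i \<and> i \<le> length xs then xs ! (i - 1) else 0)"

lemma coord_vec: "coord (vec xs) i = (if 1 \<le> i \<and> i \<le> length xs then xs ! (i - 1) else 0)"
proof -
  have "finite {i. (if 1 \<le> i \<and> i \<le> length xs then xs ! (i - 1) else 0) \<noteq> 0}"
    by (rule finite_subset[of _ "{1..length xs}"]) auto
  then show ?thesis by (simp add: vec_def)
qed

lemma coord_scaleR: "coord (r *\<^sub>R v) i = r * coord v i"
proof -
  have "finite {i. r * coord v i \<noteq> 0}"
    by (rule finite_subset[OF _ finite_lookup[of v]]) auto
  then show ?thesis by (simp add: scaleR_poly_mapping_def)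
qed

lemma mem_h_iff: "v \<in> h n \<longleftrightarrow> (\<forall>i. i \<notin> {1..n} \<longrightarrow> coord v i = 0)"
  by (auto simp: h_def in_keys_iff subset_iff)

lemma length_coords [simp]: "length (coords n v) = n"
  by (simp add: coords_def)

lemma nth_coords [simp]: "i < n \<Longrightarrow> coords n v ! i = coord v (Suc i)"
  by (simp add: coords_def)

lemma coords_vec: "coords (length xs) (vec xs) = xs"
  by (rule nth_equalityI) (auto simp: coord_vec)

lemma vec_in_h: "length xs = n \<Longrightarrow> vec xs \<in> h n"
  by (auto simp: mem_h_iff coord_vec)

lemma sum_coords: "(\<Sum>i = 1..n. coord v i) = sum_list (coords n v)"
  by (simp add: coords_def sum_list_sum_nth atLeast0LessThan flip: sum.atLeast1_atMost_eq)

lemma mem_W_s_iff: "v \<in> W_s n \<longleftrightarrow> v \<in> h n \<and> sorted_wrt (\<ge>) (coords n v) \<and> sum_list (coords n v) = 0"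
proof -
  have "sorted_wrt (\<ge>) (coords n v) \<longleftrightarrow> (\<forall>i j. i < j \<and> j < n \<longrightarrow> coord v (Suc j) \<le> coord v (Suc i))"
    by (auto simp: sorted_wrt_iff_nth_less)
  also have "\<dots> \<longleftrightarrow> (\<forall>i j. 1 \<le> i \<and> i \<le> j \<and> j \<le> n \<longrightarrow> coord v j \<le> coord v i)"
  proof (intro iffI allI impI)
    fix i j assume *: "\<forall>i j. i < j \<and> j < n \<longrightarrow> coord v (Suc j) \<le> coord v (Suc i)" "1 \<le> i \<and> i \<le> j \<and> j \<le> n"
    then show "coord v j \<le> coord v i"
      by (cases i; cases j; cases "i = j") auto
  qed auto
  finally show ?thesis by (auto simp: W_s_def W_def h_s_def simp flip: sum_coords)
qed

lemma mem_W_s_iff': "v \<in> W_s n \<longleftrightarrow> v \<in> h n \<and>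
   (\<forall>i j. i < j \<and> j < n \<longrightarrow> coord v (Suc j) \<le> coord v (Suc i)) \<and> (\<Sum>i = 1..n. coord v i) = 0"
  unfolding mem_W_s_iff sum_coords by (auto simp: sorted_wrt_iff_nth_less)

text \<open>Intersections of \<open>W_s\<close> with kernels are convex cones, which is what makes generic points available.\<close>
lemma W_s_cone:
  assumes "u \<in> W_s n" "v \<in> W_s n" "0 \<le> r"
  shows "u + r *\<^sub>R v \<in> W_s n"
  using assms unfolding mem_W_s_iff'
  by (auto simp: mem_h_iff lookup_add coord_scaleR sum.distrib sum_distrib_left[symmetric]
      intro!: add_mono mult_left_mono)

definition vector_zeros :: "nat \<Rightarrow> rvec \<Rightarrow> (nat \<times> nat) set" where
  "vector_zeros n v = {(i, j). i \<le> j \<and> j < n \<and> coord v (Suc i) + coord v (Suc j) = 0}"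

definition index_pairs :: "nat \<Rightarrow> (nat \<times> nat) set" where
  "index_pairs n = {(i, j). i \<le> j \<and> j < n}"

lemma finite_index_pairs: "finite (index_pairs n)"
  by (rule finite_subset[of _ "{..<n} \<times> {..<n}"]) (auto simp: index_pairs_def)

lemma vector_zeros_eq: "vector_zeros n v = list_zeros (coords n v)"
  by (auto simp: vector_zeros_def list_zeros_def)

text \<open>A weight \<open>x\<^sub>i\<close> has the kernel of \<open>x\<^sub>i + x\<^sub>i\<close>, so that weights become pairs \<open>i \<le> j\<close>. Indices are shifted to
start at \<open>0\<close>, as in lists.\<close>
lemma flats_by_pairs: "flats n = {{v \<in> W_s n. S \<subseteq> vector_zeros n v} | S. S \<subseteq> index_pairs n}"
proof -
  define wt :: "nat \<times> nat \<Rightarrow> rvec \<Rightarrow> real" where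
    "wt = (\<lambda>(i, j). if i = j then (\<lambda>v. coord v (Suc i)) else (\<lambda>v. coord v (Suc i) + coord v (Suc j)))"
  have weights: "weights n = wt ` index_pairs n"
  proof (intro set_eqI iffI)
    fix w assume "w \<in> weights n"
    then consider i where "1 \<le> i" "i \<le> n" "w = (\<lambda>v. coord v i)"
      | i j where "1 \<le> i" "i < j" "j \<le> n" "w = (\<lambda>v. coord v i + coord v j)"
      by (auto simp: weights_def)
    then show "w \<in> wt ` index_pairs n"
    proof cases
      case 1
      then have "w = wt (i - 1, i - 1)" "(i - 1, i - 1) \<in> index_pairs n"
        by (auto simp: wt_def index_pairs_def)
      then show ?thesis by blast
    next
      case 2
      then have "w = wt (i - 1, j - 1)" "(i - 1, j - 1) \<in> index_pairs n"
        by (auto simp: wt_def index_pairs_def)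
      then show ?thesis by blast
    qed
  next
    fix w assume "w \<in> wt ` index_pairs n"
    then obtain i j where ij: "i \<le> j" "j < n" "w = wt (i, j)" by (auto simp: index_pairs_def)
    show "w \<in> weights n"
    proof (cases "i = j")
      case True
      then have "w = (\<lambda>v. coord v (Suc i))" "1 \<le> Suc i" "Suc i \<le> n" using ij by (auto simp: wt_def)
      then show ?thesis unfolding weights_def by blast
    next
      case False
      then have "w = (\<lambda>v. coord v (Suc i) + coord v (Suc j))" "1 \<le> Suc i" "Suc i < Suc j" "Suc j \<le> n"
        using ij by (auto simp: wt_def)
      then show ?thesis unfolding weights_def by blast
    qed
  qed
  have ker: "v \<in> weight_kernel n (wt p) \<longleftrightarrow> p \<in> vector_zeros n v" if "p \<in> index_pairs n" "v \<in> W_s n" for p v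
    using that by (auto simp: weight_kernel_def vector_zeros_def index_pairs_def wt_def W_s_def split: if_splits)
  have inter: "W_s n \<inter> (\<Inter>w\<in>wt ` S. weight_kernel n w) = {v \<in> W_s n. S \<subseteq> vector_zeros n v}" if "S \<subseteq> index_pairs n" for S
    using ker that by blast
  show ?thesis
  proof (intro set_eqI iffI)
    fix A assume "A \<in> flats n"
    then obtain I where I: "I \<subseteq> wt ` index_pairs n" "A = W_s n \<inter> (\<Inter>w\<in>I. weight_kernel n w)"
      unfolding flats_def weights by blast
    from I(1) obtain S where S: "S \<subseteq> index_pairs n" "I = wt ` S" by (rule subset_imageE)
    then have "A = {v \<in> W_s n. S \<subseteq> vector_zeros n v}" using I(2) inter[OF S(1)] by simp
    then show "A \<in> {{v \<in> W_s n. S \<subseteq> vector_zeros n v} | S. S \<subseteq> index_pairs n}"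
      using S(1) by blast
  next
    fix A assume "A \<in> {{v \<in> W_s n. S \<subseteq> vector_zeros n v} | S. S \<subseteq> index_pairs n}"
    then obtain S where S: "S \<subseteq> index_pairs n" "A = {v \<in> W_s n. S \<subseteq> vector_zeros n v}" by blast
    then have "A = W_s n \<inter> (\<Inter>w\<in>wt ` S. weight_kernel n w)" "wt ` S \<subseteq> weights n"
      using inter[of S] weights by auto
    then show "A \<in> flats n" unfolding flats_def by blast
  qed
qed

text \<open>A point with the least number of vanishing sums works: if a sum vanishes at \<open>x\<close> but not at \<open>v\<close>, then
\<open>x + e v\<close> has fewer vanishing sums for all but finitely many \<open>e > 0\<close>.\<close>
lemma generic_point:
  assumes A: "A = {v \<in> W_s n. S \<subseteq> vector_zeros n v}" and S: "S \<subseteq> index_pairs n"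
  obtains x where "x \<in> A" "\<And>v. v \<in> A \<Longrightarrow> vector_zeros n x \<subseteq> vector_zeros n v"
proof -
  have fin: "finite (vector_zeros n v)" for v
    by (rule finite_subset[OF _ finite_index_pairs[of n]]) (auto simp: vector_zeros_def index_pairs_def)
  have "0 \<in> A" using S by (auto simp: A mem_W_s_iff' mem_h_iff vector_zeros_def index_pairs_def)
  then obtain x where x: "x \<in> A" "\<And>v. v \<in> A \<Longrightarrow> card (vector_zeros n x) \<le> card (vector_zeros n v)"
    using ex_has_least_nat[of "\<lambda>v. v \<in> A" 0 "\<lambda>v. card (vector_zeros n v)"] by blast
  moreover have "vector_zeros n x \<subseteq> vector_zeros n v" if v: "v \<in> A" for v
  proof (rule ccontr)
    assume "\<not> vector_zeros n x \<subseteq> vector_zeros n v"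
    then obtain i j where ij: "(i, j) \<in> vector_zeros n x" "(i, j) \<notin> vector_zeros n v" by auto
    let ?w = "\<lambda>p u. coord u (Suc (fst p)) + coord u (Suc (snd p))"
    \<comment> \<open>the multiples of \<open>v\<close> that annihilate a sum which does not vanish at \<open>x\<close>\<close>
    define bad where "bad = (\<lambda>p. - ?w p x / ?w p v) ` index_pairs n"
    have "finite bad" by (simp add: bad_def finite_index_pairs)
    then have "infinite ({0::real<..} - bad)" by (simp add: infinite_Ioi)
    then obtain e where e: "0 < e" "e \<notin> bad"
      using infinite_imp_nonempty by (metis Diff_iff all_not_in_conv greaterThan_iff)
    define y where "y = x + e *\<^sub>R v"
    have yw: "?w p y = ?w p x + e * ?w p v" for p
      by (cases p) (simp add: y_def lookup_add coord_scaleR algebra_simps)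
    have "vector_zeros n y \<subseteq> vector_zeros n x - {(i, j)}"
    proof
      fix p assume p: "p \<in> vector_zeros n y"
      then have pp: "p \<in> index_pairs n" "?w p y = 0" by (auto simp: vector_zeros_def index_pairs_def)
      have "?w p x = 0"
      proof (rule ccontr)
        assume "?w p x \<noteq> 0"
        have 0: "?w p x + e * ?w p v = 0" using pp(2) yw[of p] by simp
        then have "?w p v \<noteq> 0" using \<open>?w p x \<noteq> 0\<close> by (metis add.right_neutral mult_zero_right)
        moreover have "e * ?w p v = - ?w p x" using 0 by linarith
        ultimately have "e = - ?w p x / ?w p v" by (simp add: nonzero_eq_divide_eq)
        then show False using e(2) pp(1) by (auto simp: bad_def)
      qed
      moreover have "p \<noteq> (i, j)"
      proof
        assume "p = (i, j)"
        then have "?w p v = 0" using pp(2) yw[of p] \<open>?w p x = 0\<close> e(1) by simp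
        then show False using ij \<open>p = (i, j)\<close> by (auto simp: vector_zeros_def)
      qed
      ultimately show "p \<in> vector_zeros n x - {(i, j)}" using pp by (auto simp: vector_zeros_def index_pairs_def)
    qed
    then have "card (vector_zeros n y) < card (vector_zeros n x)"
      using ij fin by (intro psubset_card_mono) auto
    moreover have "y \<in> A"
    proof -
      have "y \<in> W_s n" unfolding y_def using x(1) v e A by (intro W_s_cone) auto
      moreover have "p \<in> vector_zeros n y" if "p \<in> S" for p
      proof -
        have "p \<in> vector_zeros n x" "p \<in> vector_zeros n v" using that x(1) v A by auto
        then show ?thesis using yw[of p] by (auto simp: vector_zeros_def)
      qed
      ultimately show ?thesis by (auto simp: A)
    qed
    ultimately show False using x(2)[of y] by simp
  qed
  ultimately show ?thesis using that by blast
qed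

definition flat_of :: "pattern \<Rightarrow> rvec set" where
  "flat_of c = {v \<in> W_s (psize c). pattern_zeros 0 c \<subseteq> vector_zeros (psize c) v}"

definition pattern_space :: "pattern \<Rightarrow> rvec set" where
  "pattern_space c = {v \<in> h (psize c). \<forall>(i, j)\<in>pattern_zeros 0 c. coord v (Suc i) + coord v (Suc j) = 0}"

lemma pattern_zeros_subset: "pattern_zeros 0 c \<subseteq> index_pairs (psize c)"
  using pattern_zeros_bounds[of _ _ 0 c] by (auto simp: index_pairs_def)

lemma mem_pattern_space_iff:
  assumes "wf_pattern c"
  shows "v \<in> pattern_space c \<longleftrightarrow> v \<in> h (psize c) \<and> compat c (coords (psize c) v)"
  using pattern_zeros_bounds[of _ _ 0 c] by (fastforce simp: pattern_space_def compat_iff[OF assms])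

lemma flat_of_eq: "flat_of c = W_s (psize c) \<inter> pattern_space c"
  using pattern_zeros_bounds[of _ _ 0 c] by (auto simp: flat_of_def pattern_space_def vector_zeros_def mem_W_s_iff)

lemma sorted_of_realizes:
  assumes "realizes (>) c xs" "wf_pattern c"
  shows "sorted_wrt (\<ge>) xs"
proof -
  have "sorted_wrt tie_order (zip xs xs)"
    using assms by (intro realizes_ties realizes_imp_compat)
  then show ?thesis by (force simp: sorted_wrt_iff_nth_less tie_order_def)
qed

lemma flat_point:
  assumes "wf_pattern c" "feasible c"
  obtains xs where "realizes (>) c xs" "length xs = psize c" "vec xs \<in> flat_of c" "vector_zeros (psize c) (vec xs) = pattern_zeros 0 c"
proof -
  obtain xs where xs: "realizes (>) c xs" "sum_list xs = 0"
    using feasible_sufficient[OF assms] by blast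
  have len: "length xs = psize c" using compat_length[OF realizes_imp_compat[OF xs(1)]] .
  have z: "vector_zeros (psize c) (vec xs) = pattern_zeros 0 c"
    using list_zeros_realizes[OF xs(1) assms(1)] coords_vec[of xs] by (simp add: vector_zeros_eq len)
  have "vec xs \<in> flat_of c"
    using xs z sorted_of_realizes[OF xs(1) assms(1)] coords_vec[of xs] vec_in_h[of xs]
    by (simp add: flat_of_def mem_W_s_iff len)
  then show ?thesis using that xs(1) len z by blast
qed

text \<open>A flat equals the flat of the pattern of a generic point, because both are cut out by the same
vanishing sums.\<close>
lemma flats_eq: "flats n = flat_of ` {c. wf_pattern c \<and> feasible c \<and> psize c = n}"
proof (intro set_eqI iffI)
  fix A assume "A \<in> flats n"
  then obtain S where S: "S \<subseteq> index_pairs n" "A = {v \<in> W_s n. S \<subseteq> vector_zeros n v}"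
    by (auto simp: flats_by_pairs)
  obtain x where x: "x \<in> A" "\<And>v. v \<in> A \<Longrightarrow> vector_zeros n x \<subseteq> vector_zeros n v"
    using generic_point[OF S(2,1)] by blast
  then have W: "sorted_wrt (\<ge>) (coords n x)" "sum_list (coords n x) = 0"
    using S by (auto simp: mem_W_s_iff)
  obtain c where c: "wf_pattern c" "realizes (\<ge>) c (coords n x)"
    using pattern_exists[OF W(1)] by blast
  have "psize c = n" using compat_length[OF realizes_imp_compat[OF c(2)]] by simp
  moreover have "feasible c" using feasible_necessary[OF c(2,1) W(2)] .
  moreover have "vector_zeros n x = pattern_zeros 0 c"
    using list_zeros_realizes[OF c(2,1)] by (simp add: vector_zeros_eq)
  then have "A = flat_of c"
    using x S \<open>psize c = n\<close> unfolding flat_of_def by blast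
  ultimately show "A \<in> flat_of ` {c. wf_pattern c \<and> feasible c \<and> psize c = n}" using c by blast
next
  fix A assume "A \<in> flat_of ` {c. wf_pattern c \<and> feasible c \<and> psize c = n}"
  then obtain c where "psize c = n" "A = flat_of c" by blast
  then show "A \<in> flats n" using pattern_zeros_subset[of c] by (auto simp: flats_by_pairs flat_of_def)
qed

text \<open>A realization of the pattern shows which sums vanish on the whole flat, and those determine the pattern.\<close>
lemma inj_flat_of: "inj_on flat_of {c. wf_pattern c \<and> feasible c \<and> psize c = n}"
proof (rule inj_onI)
  fix c d
  assume c: "c \<in> {c. wf_pattern c \<and> feasible c \<and> psize c = n}" and d: "d \<in> {c. wf_pattern c \<and> feasible c \<and> psize c = n}"
    and eq: "flat_of c = flat_of d"
  have sub: "pattern_zeros 0 d \<subseteq> pattern_zeros 0 c" if "wf_pattern c" "feasible c" "psize c = n" "psize d = n" "flat_of c = flat_of d" for c d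
  proof -
    note hyps = that
    obtain xs where "vec xs \<in> flat_of c" "vector_zeros (psize c) (vec xs) = pattern_zeros 0 c"
      using flat_point[OF hyps(1,2)] by blast
    then show ?thesis using hyps by (auto simp: flat_of_def)
  qed
  have "pattern_zeros 0 c = pattern_zeros 0 d" using sub[of c d] sub[of d c] c d eq by auto
  then show "c = d" using pattern_zeros_injective[of c d 0] c d by auto
qed

section \<open>Dimensions of flats\<close>

lemma subspace_pattern_space: "subspace (pattern_space c)"
  unfolding subspace_def
proof (intro conjI ballI allI)
  have zero: "coord v (Suc i) + coord v (Suc j) = 0" if "v \<in> pattern_space c" "(i, j) \<in> pattern_zeros 0 c" for v i j
    using that by (auto simp: pattern_space_def)
  have h: "coord v i = 0" if "v \<in> pattern_space c" "i \<notin> {1..psize c}" for v i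
    using that by (simp add: pattern_space_def mem_h_iff)
  show "0 \<in> pattern_space c" by (auto simp: pattern_space_def mem_h_iff)
  fix x assume x: "x \<in> pattern_space c"
  show "x + y \<in> pattern_space c" if y: "y \<in> pattern_space c" for y
  proof -
    have "coord (x + y) (Suc i) + coord (x + y) (Suc j) = 0" if "(i, j) \<in> pattern_zeros 0 c" for i j
      using zero[OF x that] zero[OF y that] by (simp add: lookup_add)
    then show ?thesis using h[OF x] h[OF y] by (auto simp: pattern_space_def mem_h_iff lookup_add)
  qed
  show "r *\<^sub>R x \<in> pattern_space c" for r
  proof -
    have "coord (r *\<^sub>R x) (Suc i) + coord (r *\<^sub>R x) (Suc j) = 0" if "(i, j) \<in> pattern_zeros 0 c" for i j
      using zero[OF x that] by (simp add: coord_scaleR flip: distrib_left)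
    then show ?thesis using h[OF x] by (auto simp: pattern_space_def mem_h_iff coord_scaleR)
  qed
qed

definition total :: "nat \<Rightarrow> rvec \<Rightarrow> real" where
  "total n v = (\<Sum>i = 1..n. coord v i)"

lemma total_add: "total n (u + v) = total n u + total n v"
  by (simp add: total_def lookup_add sum.distrib)

lemma total_scaleR: "total n (r *\<^sub>R v) = r * total n v"
  by (simp add: total_def coord_scaleR sum_distrib_left)

lemma total_sum: "finite J \<Longrightarrow> total n (\<Sum>j\<in>J. g j) = (\<Sum>j\<in>J. total n (g j))"
  by (induction rule: finite_induct) (auto simp: total_add, simp add: total_def)

lemma subspace_total: "subspace (pattern_space c \<inter> {v. total n v = 0})"
proof -
  have "subspace {v. total n v = 0}"
    by (auto simp: subspace_def total_add total_scaleR) (simp add: total_def)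
  then show ?thesis using subspace_pattern_space by (intro subspace_inter)
qed

text \<open>The flat contains a point with no coincidences besides the forced ones. Any vector of the linear hull
can be added to it in a small multiple without leaving the chamber.\<close>
lemma span_flat_of:
  assumes "wf_pattern c" "feasible c"
  shows "span (flat_of c) = pattern_space c \<inter> {v. total (psize c) v = 0}"
proof (rule antisym)
  let ?n = "psize c"
  show "span (flat_of c) \<subseteq> pattern_space c \<inter> {v. total ?n v = 0}"
    by (rule span_minimal[OF _ subspace_total]) (auto simp: flat_of_eq mem_W_s_iff' total_def)
  show "pattern_space c \<inter> {v. total ?n v = 0} \<subseteq> span (flat_of c)"
  proof
    fix v assume v: "v \<in> pattern_space c \<inter> {v. total ?n v = 0}"
    obtain xs where xs: "realizes (>) c xs" "length xs = ?n" "vec xs \<in> flat_of c"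
      using flat_point[OF assms] by blast
    let ?vs = "coords ?n v"
    have "sorted_wrt tie_order (zip xs ?vs)"
      using realizes_ties[OF xs(1) _ assms(1)] v mem_pattern_space_iff[OF assms(1)] by auto
    then have cmp: "xs ! j < xs ! i \<or> xs ! i = xs ! j \<and> ?vs ! i = ?vs ! j" if "i < j" "j < ?n" for i j
      using that xs(2) by (force simp: sorted_wrt_iff_nth_less tie_order_def)
    have "\<forall>\<^sub>F e in at_right 0. \<forall>p\<in>{..<?n} \<times> {..<?n}. fst p < snd p \<longrightarrow>
       xs ! snd p + e * ?vs ! snd p \<le> xs ! fst p + e * ?vs ! fst p"
    proof (rule eventually_ball_finite)
      show "\<forall>p\<in>{..<?n} \<times> {..<?n}. \<forall>\<^sub>F e in at_right 0. fst p < snd p \<longrightarrow>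
         xs ! snd p + e * ?vs ! snd p \<le> xs ! fst p + e * ?vs ! fst p"
      proof
        fix p assume p: "p \<in> {..<?n} \<times> {..<?n}"
        show "\<forall>\<^sub>F e in at_right 0. fst p < snd p \<longrightarrow> xs ! snd p + e * ?vs ! snd p \<le> xs ! fst p + e * ?vs ! fst p"
        proof (cases "fst p < snd p \<and> xs ! snd p < xs ! fst p")
          case True
          have "((\<lambda>e. (xs ! fst p + e * ?vs ! fst p) - (xs ! snd p + e * ?vs ! snd p)) \<longlongrightarrow>
              (xs ! fst p + 0 * ?vs ! fst p) - (xs ! snd p + 0 * ?vs ! snd p)) (at_right 0)"
            by (intro tendsto_intros)
          then have "\<forall>\<^sub>F e in at_right 0. 0 < (xs ! fst p + e * ?vs ! fst p) - (xs ! snd p + e * ?vs ! snd p)"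
            by (rule order_tendstoD(1)) (use True in simp)
          then show ?thesis by (rule eventually_mono) auto
        next
          case False
          then show ?thesis using cmp[of "fst p" "snd p"] p by (cases "fst p < snd p") auto
        qed
      qed
    qed simp
    moreover have "\<forall>\<^sub>F e::real in at_right 0. 0 < e" by (rule eventually_at_right_less)
    ultimately have "\<forall>\<^sub>F e in at_right 0. 0 < e \<and> (\<forall>p\<in>{..<?n} \<times> {..<?n}. fst p < snd p \<longrightarrow>
       xs ! snd p + e * ?vs ! snd p \<le> xs ! fst p + e * ?vs ! fst p)"
      by eventually_elim blast
    then obtain e where e: "0 < e" "\<And>i j. i < j \<Longrightarrow> j < ?n \<Longrightarrow> xs ! j + e * ?vs ! j \<le> xs ! i + e * ?vs ! i"
      by (auto dest!: eventually_happens simp: trivial_limit_at_right_real)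
    define y where "y = vec xs + e *\<^sub>R v"
    have "y \<in> pattern_space c"
      unfolding y_def using xs(3) v subspace_pattern_space[of c]
      by (intro subspace_add subspace_scale) (auto simp: flat_of_eq)
    moreover have "total ?n (vec xs) = 0"
      using xs(3) by (auto simp: flat_of_eq mem_W_s_iff' total_def)
    then have "total ?n y = 0" using v by (simp add: y_def total_add total_scaleR)
    moreover have "coord y (Suc j) \<le> coord y (Suc i)" if "i < j" "j < ?n" for i j
      using e(2)[OF that] that xs(2) by (simp add: y_def lookup_add coord_scaleR coord_vec)
    ultimately have "y \<in> flat_of c"
      by (auto simp: flat_of_eq mem_W_s_iff' total_def) (auto simp: pattern_space_def)
    then have "(1 / e) *\<^sub>R (y - vec xs) \<in> span (flat_of c)"
      using xs(3) by (intro span_scale span_diff span_base)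
    then show "v \<in> span (flat_of c)" using e(1) by (simp add: y_def)
  qed
qed

text \<open>A set of coordinates that determines the vectors of \<open>V\<close> and can take arbitrary values on \<open>V\<close>.\<close>
lemma dim_by_pivots:
  fixes V :: "rvec set"
  assumes V: "subspace V" and J: "finite J"
    and b: "\<And>j. j \<in> J \<Longrightarrow> b j \<in> V"
    and unit: "\<And>i j. i \<in> J \<Longrightarrow> j \<in> J \<Longrightarrow> coord (b j) (Suc i) = (if i = j then 1 else 0)"
    and determined: "\<And>v. v \<in> V \<Longrightarrow> (\<And>i. i \<in> J \<Longrightarrow> coord v (Suc i) = 0) \<Longrightarrow> v = 0"
  shows "dim V = card J" and "\<And>v. v \<in> V \<Longrightarrow> v = (\<Sum>j\<in>J. coord v (Suc j) *\<^sub>R b j)"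
proof -
  have coord_sum: "coord (\<Sum>j\<in>J. g j *\<^sub>R b j) (Suc i) = g i" if "i \<in> J" for g i
  proof -
    have "coord (\<Sum>j\<in>J. g j *\<^sub>R b j) (Suc i) = (\<Sum>j\<in>J. g j * coord (b j) (Suc i))"
      by (simp add: lookup_sum coord_scaleR)
    also have "\<dots> = (\<Sum>j\<in>J. if i = j then g j else 0)"
      using unit that by (intro sum.cong) auto
    finally show ?thesis using J that by simp
  qed
  show expand: "v = (\<Sum>j\<in>J. coord v (Suc j) *\<^sub>R b j)" if "v \<in> V" for v
  proof -
    have "v - (\<Sum>j\<in>J. coord v (Suc j) *\<^sub>R b j) = 0"
    proof (rule determined)
      show "v - (\<Sum>j\<in>J. coord v (Suc j) *\<^sub>R b j) \<in> V"
        using V that b by (intro subspace_diff subspace_sum subspace_scale)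
    qed (simp add: lookup_minus coord_sum)
    then show ?thesis by simp
  qed
  have inj: "inj_on b J"
  proof (rule inj_onI)
    fix i j assume "i \<in> J" "j \<in> J" "b i = b j"
    then show "i = j" using unit[of i i] unit[of i j] by (auto split: if_splits)
  qed
  have "independent (b ` J)"
  proof (rule independent_if_scalars_zero)
    fix f x assume "(\<Sum>x\<in>b ` J. f x *\<^sub>R x) = 0" "x \<in> b ` J"
    then obtain i where i: "i \<in> J" "x = b i" and 0: "(\<Sum>j\<in>J. f (b j) *\<^sub>R b j) = 0"
      by (auto simp: sum.reindex[OF inj])
    show "f x = 0" using coord_sum[OF i(1), of "\<lambda>j. f (b j)"] 0 i by simp
  qed (use J in simp)
  moreover have "V \<subseteq> span (b ` J)"
  proof
    fix v assume "v \<in> V"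
    have "(\<Sum>j\<in>J. coord v (Suc j) *\<^sub>R b j) \<in> span (b ` J)"
      by (intro span_sum span_scale span_base imageI)
    then show "v \<in> span (b ` J)" using expand[OF \<open>v \<in> V\<close>] by simp
  qed
  ultimately show "dim V = card J"
    using b inj by (intro dim_unique[of "b ` J"]) (auto simp: card_image)
qed

text \<open>The unmatched positions together with the first position of every layer.\<close>
fun pivots :: "nat \<Rightarrow> pattern \<Rightarrow> nat set" where
  "pivots l (Core b a z) = {l..<l + a} \<union> {l + a + z..<l + a + z + b}"
| "pivots l (Layer b a p q c) = {l..<l + a} \<union> {l + a} \<union> pivots (l + a + p) c \<union>
     {l + a + p + psize c + q..<l + a + p + psize c + q + b}"

text \<open>The vector of the space of the pattern with prescribed values at the pivots.\<close>
fun extend :: "nat \<Rightarrow> pattern \<Rightarrow> (nat \<Rightarrow> real) \<Rightarrow> real list" where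
  "extend l (Core b a z) g = map g [l..<l + a] @ replicate z 0 @ map g [l + a + z..<l + a + z + b]"
| "extend l (Layer b a p q c) g = map g [l..<l + a] @ replicate p (g (l + a)) @ extend (l + a + p) c g @
     replicate q (- g (l + a)) @ map g [l + a + p + psize c + q..<l + a + p + psize c + q + b]"

lemma pivots_bounds: "wf_pattern c \<Longrightarrow> i \<in> pivots l c \<Longrightarrow> l \<le> i \<and> i < l + psize c"
proof (induction c arbitrary: l)
  case (Layer b a p q c)
  show ?case using Layer.IH[of "l + a + p"] Layer.prems by auto
qed auto

lemma finite_pivots: "finite (pivots l c)"
  by (induction c arbitrary: l) auto

lemma card_pivots: "wf_pattern c \<Longrightarrow> card (pivots l c) = pfree c"
proof (induction c arbitrary: l)
  case (Core b a z)
  then show ?case by (auto simp: card_Un_disjoint)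
next
  case (Layer b a p q c)
  have bd: "l + a + p \<le> i \<and> i < l + a + p + psize c" if "i \<in> pivots (l + a + p) c" for i
    using pivots_bounds[OF _ that] Layer.prems by simp
  have "card (({l..<l + a} \<union> {l + a}) \<union> pivots (l + a + p) c \<union> {l + a + p + psize c + q..<l + a + p + psize c + q + b})
    = card ({l..<l + a} \<union> {l + a}) + card (pivots (l + a + p) c) + card {l + a + p + psize c + q..<l + a + p + psize c + q + b}"
    using bd Layer.prems finite_pivots by (subst card_Un_disjoint; (subst card_Un_disjoint)?; fastforce)
  then show ?case using Layer by simp
qed

lemma compat_extend: "compat c (extend l c g)"
proof (induction c arbitrary: l)
  case (Core b a z)
  show ?case unfolding compat.simps extend.simps
    by (rule exI[of _ "map g [l..<l + a]"], rule exI[of _ "map g [l + a + z..<l + a + z + b]"]) simp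
next
  case (Layer b a p q c)
  show ?case unfolding compat.simps extend.simps
    by (rule exI[of _ "map g [l..<l + a]"], rule exI[of _ "g (l + a)"], rule exI[of _ "extend (l + a + p) c g"],
      rule exI[of _ "map g [l + a + p + psize c + q..<l + a + p + psize c + q + b]"])
      (simp add: Layer.IH)
qed

lemma length_extend [simp]: "length (extend l c g) = psize c"
  by (rule compat_length[OF compat_extend])

lemma extend_pivot: "wf_pattern c \<Longrightarrow> i \<in> pivots l c \<Longrightarrow> extend l c g ! (i - l) = g i"
proof (induction c arbitrary: l)
  case (Core b a z)
  then show ?case by (auto simp: nth_append)
next
  case (Layer b a p q c)
  from Layer.prems consider "l \<le> i" "i < l + a" | "i = l + a" | "i \<in> pivots (l + a + p) c"
    | "l + a + p + psize c + q \<le> i" "i < l + a + p + psize c + q + b" by auto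
  then show ?case
  proof cases
    case 3
    then have "l + a + p \<le> i" "i < l + a + p + psize c" "extend (l + a + p) c g ! (i - (l + a + p)) = g i"
      using pivots_bounds[of c i "l + a + p"] Layer.IH[of "l + a + p"] Layer.prems(1) by simp_all
    then show ?thesis by (auto simp: nth_append)
  qed (use Layer.prems in \<open>auto simp: nth_append\<close>)
qed

lemma compat_zero_on_pivots:
  "wf_pattern c \<Longrightarrow> compat c xs \<Longrightarrow> (\<And>i. i \<in> pivots l c \<Longrightarrow> xs ! (i - l) = 0) \<Longrightarrow> x \<in> set xs \<Longrightarrow> x = 0"
proof (induction c arbitrary: xs l x)
  case (Core b a z)
  then obtain as bs where xs: "xs = as @ replicate z 0 @ bs" "length as = a" "length bs = b" by auto
  have "as ! k = 0" if "k < a" for k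
    using Core.prems(3)[of "l + k"] that xs by (auto simp: nth_append)
  moreover have "bs ! k = 0" if "k < b" for k
    using Core.prems(3)[of "l + a + z + k"] that xs by (auto simp: nth_append)
  ultimately show ?case using Core.prems(4) xs by (auto simp: in_set_conv_nth)
next
  case (Layer b a p q c)
  then obtain as t ys bs where xs: "xs = as @ replicate p t @ ys @ replicate q (- t) @ bs"
    "length as = a" "length bs = b" and ys: "compat c ys" by auto
  have m: "length ys = psize c" using compat_length[OF ys] .
  have "as ! k = 0" if "k < a" for k
    using Layer.prems(3)[of "l + k"] that xs by (auto simp: nth_append)
  moreover have "t = 0"
    using Layer.prems(1) Layer.prems(3)[of "l + a"] xs by (auto simp: nth_append)
  moreover have "bs ! k = 0" if "k < b" for k
    using Layer.prems(3)[of "l + a + p + psize c + q + k"] that xs m by (auto simp: nth_append)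
  moreover have "y = 0" if "y \<in> set ys" for y
  proof (rule Layer.IH[OF _ ys _ that])
    fix i assume i: "i \<in> pivots (l + a + p) c"
    then have "l + a + p \<le> i" "i < l + a + p + psize c"
      using pivots_bounds[of c i "l + a + p"] Layer.prems(1) by simp_all
    then obtain k where k: "i = l + a + p + k" "k < psize c" using le_Suc_ex by fastforce
    have "xs ! (i - l) = 0" using Layer.prems(3)[of i] i by simp
    moreover have "xs ! (i - l) = ys ! k" using k xs m by (simp add: nth_append)
    ultimately show "ys ! (i - (l + a + p)) = 0" using k by simp
  qed (use Layer.prems in simp)
  ultimately show ?case using Layer.prems(4) xs by (auto simp: in_set_conv_nth)
qed

text \<open>The condition on the sum of the coordinates cuts down the space of an unbalanced pattern.\<close>
lemma unbalanced_sum: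
  "wf_pattern c \<Longrightarrow> \<not> balanced c \<Longrightarrow> \<exists>xs. compat c xs \<and> sum_list xs \<noteq> 0"
proof (induction c)
  case (Core b a z)
  have "compat (Core b a z) (replicate a 1 @ replicate z 0 @ replicate b 1)"
    unfolding compat.simps by (rule exI[of _ "replicate a 1"], rule exI[of _ "replicate b 1"]) simp
  moreover have "real a + real b \<noteq> 0" using Core.prems by (simp add: add_nonneg_eq_0_iff)
  then have "sum_list (replicate a 1 @ replicate z 0 @ replicate b 1) \<noteq> (0 :: real)"
    by (simp add: sum_list_replicate)
  ultimately show ?case by blast
next
  case (Layer b a p q c)
  let ?xs = "\<lambda>(r :: real) t ys. replicate a r @ replicate p t @ ys @ replicate q (- t) @ replicate b r"
  have L: "compat (Layer b a p q c) (?xs r t ys)" if "compat c ys" for r t ys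
    unfolding compat.simps
    by (rule exI[of _ "replicate a r"], rule exI[of _ t], rule exI[of _ ys], rule exI[of _ "replicate b r"])
      (simp add: that)
  have S: "sum_list (?xs r t ys) = (a + b) * r + (real p - real q) * t + sum_list ys" for r t ys
    by (simp add: sum_list_replicate algebra_simps)
  have 0: "compat c (replicate (psize c) 0)"
  proof -
    have "i < psize c \<and> j < psize c" if "(i, j) \<in> pattern_zeros 0 c" for i j
      using pattern_zeros_bounds[OF that] by auto
    then show ?thesis using Layer.prems by (subst compat_iff) auto
  qed
  consider "a + b \<noteq> 0" | "a = 0" "b = 0" "p \<noteq> q" | "a = 0" "b = 0" "\<not> balanced c"
    using Layer.prems by auto
  then show ?case
  proof cases
    case 1
    then have "real a + real b \<noteq> 0" by (simp add: add_nonneg_eq_0_iff)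
    then have "sum_list (?xs 1 0 (replicate (psize c) 0)) \<noteq> 0"
      unfolding S by (simp add: sum_list_replicate)
    then show ?thesis using L[OF 0] by blast
  next
    case 2
    then have "sum_list (?xs 0 1 (replicate (psize c) 0)) \<noteq> 0"
      unfolding S by (simp add: sum_list_replicate)
    then show ?thesis using L[OF 0] by blast
  next
    case 3
    then obtain ys where ys: "compat c ys" "sum_list ys \<noteq> 0" using Layer by auto
    then have "sum_list (?xs 0 0 ys) \<noteq> 0" by (simp add: sum_list_replicate)
    then show ?thesis using L[OF ys(1)] by blast
  qed
qed

text \<open>The pivots are coordinates on the space of the pattern. If the pattern is not balanced, then the sum of
the coordinates is not zero on some basis vector; that vector is used to correct
the others and is dropped from the basis.\<close>
lemma dim_flat_of:
  assumes "wf_pattern c" "feasible c"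
  shows "dim (span (flat_of c)) = pdim c"
proof -
  let ?n = "psize c"
  define J where "J = pivots 0 c"
  define b where "b j = vec (extend 0 c (\<lambda>i. if i = j then 1 else 0))" for j
  have J: "finite J" "card J = pfree c" "\<And>j. j \<in> J \<Longrightarrow> j < ?n"
    using finite_pivots card_pivots[OF assms(1)] pivots_bounds[OF assms(1), of _ 0] by (simp_all add: J_def)
  have bV: "b j \<in> pattern_space c" for j
    unfolding mem_pattern_space_iff[OF assms(1)] b_def
    using vec_in_h[of _ ?n] compat_extend coords_vec[of "extend 0 c g" for g] by simp
  have unit: "coord (b j) (Suc i) = (if i = j then 1 else 0)" if "i \<in> J" for i j
    using extend_pivot[OF assms(1), of i 0] that J(3)[OF that] by (simp add: b_def coord_vec J_def)
  have det: "v = 0" if v: "v \<in> pattern_space c" and 0: "\<And>i. i \<in> J \<Longrightarrow> coord v (Suc i) = 0" for v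
  proof -
    have "x = 0" if "x \<in> set (coords ?n v)" for x
      using compat_zero_on_pivots[OF assms(1) _ _ that, of 0] v mem_pattern_space_iff[OF assms(1)] 0 J(3)
      by (auto simp: J_def)
    then have "coord v (Suc i) = 0" if "i < ?n" for i
      using that nth_mem[of i "coords ?n v"] by force
    moreover have "v \<in> h ?n" using v by (simp add: pattern_space_def)
    ultimately have "coord v i = 0" for i
      by (cases i; cases "i \<le> ?n") (auto simp: mem_h_iff)
    then show ?thesis by (intro poly_mapping_eqI) simp
  qed
  have expand: "v = (\<Sum>j\<in>J. coord v (Suc j) *\<^sub>R b j)" if "v \<in> pattern_space c" for v
    by (rule dim_by_pivots(2)[of "pattern_space c" J b]) (blast intro: subspace_pattern_space J(1) bV unit det that)+
  have dim: "dim (pattern_space c) = card J"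
    by (rule dim_by_pivots(1)[of "pattern_space c" J b]) (blast intro: subspace_pattern_space J(1) bV unit det)+
  have tot: "total ?n v = sum_list (coords ?n v)" for v by (simp only: total_def sum_coords)
  show ?thesis
  proof (cases "balanced c")
    case True
    then have "pattern_space c \<inter> {v. total ?n v = 0} = pattern_space c"
      using balanced_sum mem_pattern_space_iff[OF assms(1)] tot by auto
    then show ?thesis using True dim J(2) by (simp add: span_flat_of[OF assms] pdim_def del: dim_span)
  next
    case False
    obtain xs where xs: "compat c xs" "sum_list xs \<noteq> 0" using unbalanced_sum[OF assms(1) False] by blast
    have len: "length xs = ?n" using compat_length[OF xs(1)] .
    have x: "vec xs \<in> pattern_space c" "total ?n (vec xs) \<noteq> 0"
      using xs len coords_vec[of xs] vec_in_h[of xs] by (auto simp: mem_pattern_space_iff[OF assms(1)] tot)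
    have "\<exists>k\<in>J. total ?n (b k) \<noteq> 0"
    proof (rule ccontr)
      assume "\<not> (\<exists>k\<in>J. total ?n (b k) \<noteq> 0)"
      then have "total ?n (\<Sum>j\<in>J. coord (vec xs) (Suc j) *\<^sub>R b j) = 0"
        using J(1) by (simp add: total_sum total_scaleR)
      then show False using expand[OF x(1)] x(2) by simp
    qed
    then obtain k where k: "k \<in> J" "total ?n (b k) \<noteq> 0" by blast
    \<comment> \<open>the part of \<open>b j\<close> on which the sum of the coordinates vanishes\<close>
    define b' where "b' j = b j - (total ?n (b j) / total ?n (b k)) *\<^sub>R b k" for j
    have "dim (pattern_space c \<inter> {v. total ?n v = 0}) = card (J - {k})"
    proof (rule dim_by_pivots[of _ _ b'])
      show "subspace (pattern_space c \<inter> {v. total ?n v = 0})" by (rule subspace_total)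
      show "finite (J - {k})" using J by simp
      show "b' j \<in> pattern_space c \<inter> {v. total ?n v = 0}" for j
      proof
        show "b' j \<in> pattern_space c" unfolding b'_def
          using subspace_pattern_space bV by (intro subspace_diff subspace_scale)
        have "total ?n (b' j + (total ?n (b j) / total ?n (b k)) *\<^sub>R b k) = total ?n (b j)"
          by (simp add: b'_def)
        then show "b' j \<in> {v. total ?n v = 0}" using k by (simp add: total_add total_scaleR)
      qed
      show "coord (b' j) (Suc i) = (if i = j then 1 else 0)" if "i \<in> J - {k}" "j \<in> J - {k}" for i j
        using that unit[of i j] unit[of i k] by (simp add: b'_def lookup_minus coord_scaleR)
      fix v assume v: "v \<in> pattern_space c \<inter> {v. total ?n v = 0}" "\<And>i. i \<in> J - {k} \<Longrightarrow> coord v (Suc i) = 0"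
      have "v = (\<Sum>j\<in>J. coord v (Suc j) *\<^sub>R b j)" using expand v by blast
      also have "\<dots> = coord v (Suc k) *\<^sub>R b k"
        using J(1) k(1) v(2) by (subst sum.remove[of _ k]) auto
      finally have "v = coord v (Suc k) *\<^sub>R b k" .
      moreover from this have "coord v (Suc k) * total ?n (b k) = 0"
        using v(1) by (metis (mono_tags, lifting) IntD2 mem_Collect_eq total_scaleR)
      ultimately show "v = 0" using k by simp
    qed
    then show ?thesis using False J k by (simp add: span_flat_of[OF assms] pdim_def del: dim_span)
  qed
qed

lemma num_flats_eq: "num_flats n k = card {c \<in> patterns. feasible c \<and> psize c = n \<and> pdim c = k}"
proof -
  have "{A \<in> flats n. dim (span A) = k} = flat_of ` {c \<in> patterns. feasible c \<and> psize c = n \<and> pdim c = k}"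
    unfolding flats_eq using dim_flat_of by auto
  moreover have "inj_on flat_of {c \<in> patterns. feasible c \<and> psize c = n \<and> pdim c = k}"
    by (rule inj_on_subset[OF inj_flat_of[of n]]) auto
  ultimately show ?thesis by (simp add: num_flats_def card_image)
qed

section \<open>Generating functions of weighted sets\<close>

text \<open>The generating function of \<open>S\<close> with \<open>X\<close> marking \<open>f\<close> and \<open>Y\<close> marking \<open>g\<close>.\<close>
definition wgf :: "'a set \<Rightarrow> ('a \<Rightarrow> nat) \<Rightarrow> ('a \<Rightarrow> nat) \<Rightarrow> R" where
  "wgf S f g = Abs_fps (\<lambda>n. Abs_fps (\<lambda>k. of_nat (card {c \<in> S. f c = n \<and> g c = k})))"

definition finite_levels :: "'a set \<Rightarrow> ('a \<Rightarrow> nat) \<Rightarrow> bool" where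
  "finite_levels S f \<longleftrightarrow> (\<forall>n. finite {c \<in> S. f c = n})"

lemma wgf_nth: "wgf S f g $ n $ k = of_nat (card {c \<in> S. f c = n \<and> g c = k})"
  by (simp add: wgf_def)

lemma finite_levels_subset: "finite_levels T f \<Longrightarrow> S \<subseteq> T \<Longrightarrow> finite_levels S f"
  unfolding finite_levels_def by (blast intro: finite_subset[rotated])

lemma finite_levels_le: "finite_levels S f \<Longrightarrow> finite {c \<in> S. f c \<le> n}"
proof -
  assume "finite_levels S f"
  then have "finite (\<Union>m\<le>n. {c \<in> S. f c = m})" by (simp add: finite_levels_def)
  then show ?thesis by (rule rev_finite_subset) auto
qed

lemma wgf_Un:
  assumes "finite_levels S f" "finite_levels T f" "S \<inter> T = {}"
  shows "wgf (S \<union> T) f g = wgf S f g + wgf T f g"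
proof (intro fps_ext)
  fix n k
  have "finite {c \<in> S. f c = n \<and> g c = k}" "finite {c \<in> T. f c = n \<and> g c = k}"
    using assms(1,2) unfolding finite_levels_def by (blast intro: finite_subset[rotated])+
  then have "card ({c \<in> S. f c = n \<and> g c = k} \<union> {c \<in> T. f c = n \<and> g c = k})
      = card {c \<in> S. f c = n \<and> g c = k} + card {c \<in> T. f c = n \<and> g c = k}"
    using assms(3) by (intro card_Un_disjoint) auto
  moreover have "{c \<in> S \<union> T. f c = n \<and> g c = k} = {c \<in> S. f c = n \<and> g c = k} \<union> {c \<in> T. f c = n \<and> g c = k}"
    by auto
  ultimately show "wgf (S \<union> T) f g $ n $ k = (wgf S f g + wgf T f g) $ n $ k"
    by (simp add: wgf_nth)
qed

lemma wgf_Diff: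
  assumes "finite_levels T f" "S \<subseteq> T"
  shows "wgf (T - S) f g = wgf T f g - wgf S f g"
proof -
  have "wgf (S \<union> (T - S)) f g = wgf S f g + wgf (T - S) f g"
    using assms by (intro wgf_Un) (auto elim: finite_levels_subset)
  moreover have "S \<union> (T - S) = T" using assms by auto
  ultimately show ?thesis by simp
qed

lemma wgf_empty [simp]: "wgf {} f g = 0"
  by (simp add: fps_eq_iff wgf_nth)

lemma X_pow_Y_pow_nth:
  "(X^i * Y^j * f) $ n $ k = (if i \<le> n \<and> j \<le> k then f $ (n - i) $ (k - j) else 0)"
  by (simp add: X_def Y_def mult.assoc fps_X_power_mult_nth fps_const_power)

lemma wgf_image:
  assumes "inj_on \<phi> S" and "\<And>c. c \<in> S \<Longrightarrow> f' (\<phi> c) = f c + i" and "\<And>c. c \<in> S \<Longrightarrow> g' (\<phi> c) = g c + j"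
  shows "wgf (\<phi> ` S) f' g' = X^i * Y^j * wgf S f g"
proof (intro fps_ext)
  fix n k
  have "{c \<in> \<phi> ` S. f' c = n \<and> g' c = k} = \<phi> ` {c \<in> S. f c + i = n \<and> g c + j = k}"
    using assms(2,3) by auto
  moreover have "inj_on \<phi> {c \<in> S. f c + i = n \<and> g c + j = k}"
    using assms(1) by (rule inj_on_subset) auto
  ultimately have "card {c \<in> \<phi> ` S. f' c = n \<and> g' c = k} = card {c \<in> S. f c + i = n \<and> g c + j = k}"
    by (simp add: card_image)
  moreover have "{c \<in> S. f c + i = n \<and> g c + j = k} =
      (if i \<le> n \<and> j \<le> k then {c \<in> S. f c = n - i \<and> g c = k - j} else {})"
    by auto
  ultimately show "wgf (\<phi> ` S) f' g' $ n $ k = (X^i * Y^j * wgf S f g) $ n $ k"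
    by (simp add: X_pow_Y_pow_nth wgf_nth)
qed

lemma wgf_singleton: "wgf {c} f g = X^f c * Y^g c"
proof (intro fps_ext)
  fix n k
  have "{d \<in> {c}. f d = n \<and> g d = k} = (if f c = n \<and> g c = k then {c} else {})" by auto
  moreover have "(X^f c * Y^g c * 1) $ n $ k = (if f c \<le> n \<and> g c \<le> k then (1 :: R) $ (n - f c) $ (k - g c) else 0)"
    by (rule X_pow_Y_pow_nth)
  ultimately show "wgf {c} f g $ n $ k = (X^f c * Y^g c) $ n $ k"
    by (auto simp: wgf_nth)
qed

lemma wgf_bij:
  assumes "inj_on \<phi> S" "\<phi> ` S = T" and "\<And>c. c \<in> S \<Longrightarrow> f' (\<phi> c) = f c" and "\<And>c. c \<in> S \<Longrightarrow> g' (\<phi> c) = g c"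
  shows "wgf T f' g' = wgf S f g"
  using wgf_image[of \<phi> S f' f 0 g' g 0] assms by simp

lemma finite_levels_image:
  assumes "finite_levels S f" and "\<And>c. c \<in> S \<Longrightarrow> f c \<le> f' (\<phi> c)"
  shows "finite_levels (\<phi> ` S) f'"
  unfolding finite_levels_def
proof
  fix n
  have "{c \<in> \<phi> ` S. f' c = n} \<subseteq> \<phi> ` {c \<in> S. f c \<le> n}"
    using assms(2) by auto
  then show "finite {c \<in> \<phi> ` S. f' c = n}"
    using finite_levels_le[OF assms(1)] finite_surj by blast
qed

lemma finite_levels_Un: "finite_levels S f \<Longrightarrow> finite_levels T f \<Longrightarrow> finite_levels (S \<union> T) f"
proof -
  assume *: "finite_levels S f" "finite_levels T f"
  have "{c \<in> S \<union> T. f c = n} = {c \<in> S. f c = n} \<union> {c \<in> T. f c = n}" for n by auto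
  with * show ?thesis by (simp add: finite_levels_def)
qed

lemma finite_levels_counter:
  assumes "finite_levels U f" and "\<And>i. S i \<subseteq> U"
    and "\<And>i t. i + f t \<le> w (i, t)"
  shows "finite_levels {(i, t). t \<in> S i} w"
  unfolding finite_levels_def
proof
  fix n
  have "i \<le> n \<and> f t \<le> n" if "w (i, t) = n" for i t using assms(3)[of i t] that by linarith
  then have "{c \<in> {(i, t). t \<in> S i}. w c = n} \<subseteq> {..n} \<times> {t \<in> U. f t \<le> n}"
    using assms(2) by auto
  then show "finite {c \<in> {(i, t). t \<in> S i}. w c = n}"
    using finite_levels_le[OF assms(1)] by (meson finite_SigmaI finite_atMost finite_subset)
qed

text \<open>The geometric series in combinatorial form: an object that consists of a number \<open>i\<close> and an element of \<open>S i\<close>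
either has \<open>i = 0\<close>, or \<open>i\<close> can be lowered by one. Iterating this builds patterns from their
multiplicities, even when the admissible rest depends on \<open>i\<close>.\<close>
lemma wgf_counter:
  assumes fin: "finite_levels {(i, t). t \<in> S i} f'"
    and f': "\<And>i t. f' (i, t) = i * m + f t" and g': "\<And>i t. g' (i, t) = i * l + g t"
  shows "wgf {(i, t). t \<in> S i} f' g' = wgf (S 0) f g + X^m * Y^l * wgf {(i, t). t \<in> S (Suc i)} f' g'"
proof -
  let ?D = "{(i, t). t \<in> S i}" and ?D' = "{(i, t). t \<in> S (Suc i)}"
  have D: "?D = Pair 0 ` S 0 \<union> (\<lambda>(i, t). (Suc i, t)) ` ?D'"
  proof (intro set_eqI)
    fix x :: "nat \<times> 'a"
    obtain i t where "x = (i, t)" by (cases x)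
    then show "x \<in> ?D \<longleftrightarrow> x \<in> Pair 0 ` S 0 \<union> (\<lambda>(i, t). (Suc i, t)) ` ?D'"
      by (cases i) (auto simp: image_iff)
  qed
  have "wgf ?D f' g' = wgf (Pair 0 ` S 0) f' g' + wgf ((\<lambda>(i, t). (Suc i, t)) ` ?D') f' g'"
    unfolding D by (rule wgf_Un) (use fin D in \<open>auto elim!: finite_levels_subset\<close>)
  also have "wgf (Pair 0 ` S 0) f' g' = wgf (S 0) f g"
    by (rule wgf_bij[where \<phi> = "Pair 0"]) (auto simp: f' g' inj_on_def)
  also have "wgf ((\<lambda>(i, t). (Suc i, t)) ` ?D') f' g' = X^m * Y^l * wgf ?D' f' g'"
    by (rule wgf_image) (auto simp: f' g' inj_on_def)
  finally show ?thesis .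
qed

lemma F_eq: "F = wgf {c \<in> patterns. feasible c} psize pdim"
  by (intro fps_ext) (simp add: F_def wgf_nth num_flats_eq conj_assoc)

section \<open>Counting patterns\<close>

lemma finite_levels_patterns: "finite_levels patterns psize"
  unfolding finite_levels_def
proof
  fix n
  show "finite {c \<in> patterns. psize c = n}"
  proof (induction n rule: less_induct)
    case (less n)
    define U where "U = (\<Union>m<n. {c \<in> patterns. psize c = m})"
    have U: "finite U" unfolding U_def using less by auto
    have "{c \<in> patterns. psize c = n} \<subseteq>
      (\<lambda>(b, a, z). Core b a z) ` ({..n} \<times> {..n} \<times> {..n}) \<union>
      (\<lambda>(b, a, p, q, c). Layer b a p q c) ` ({..n} \<times> {..n} \<times> {..n} \<times> {..n} \<times> U)"
    proof
      fix c assume "c \<in> {c \<in> patterns. psize c = n}"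
      then show "c \<in> (\<lambda>(b, a, z). Core b a z) ` ({..n} \<times> {..n} \<times> {..n}) \<union>
        (\<lambda>(b, a, p, q, c). Layer b a p q c) ` ({..n} \<times> {..n} \<times> {..n} \<times> {..n} \<times> U)"
        by (cases c) (auto simp: U_def image_iff)
    qed
    then show ?case by (rule finite_subset) (use U in auto)
  qed
qed

text \<open>The possible continuations of the innermost negative segment if no further layer follows.\<close>
definition ends :: "(nat \<times> nat) set" where
  "ends = {(a, z). z = 0 \<longrightarrow> a = 0}"

definition ends_gf :: R where
  "ends_gf = wgf ends (\<lambda>(a, z). a + z) (\<lambda>(a, z). a)"

lemma finite_levels_plus_UNIV: "finite_levels (UNIV :: (nat \<times> nat) set) (\<lambda>(a, z). a + z)"
proof -
  have "{c \<in> UNIV. (\<lambda>(a, z). a + z) c = n} \<subseteq> {..n} \<times> {..n}" for n :: nat by auto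
  then show ?thesis unfolding finite_levels_def by (meson finite_SigmaI finite_atMost finite_subset)
qed

lemma finite_levels_id: "finite_levels (S :: nat set) (\<lambda>i. i)"
  unfolding finite_levels_def by auto

lemma wgf_nat: "(1 - X) * wgf (UNIV :: nat set) (\<lambda>i. i) (\<lambda>i. 0) = 1"
proof -
  have "i \<in> {0} \<union> Suc ` UNIV" for i by (cases i) auto
  then have "(UNIV :: nat set) = {0} \<union> Suc ` UNIV" by blast
  then have "wgf (UNIV :: nat set) (\<lambda>i. i) (\<lambda>i. 0) = wgf ({0} \<union> Suc ` UNIV) (\<lambda>i. i) (\<lambda>i. 0)"
    by simp
  also have "\<dots> = wgf {0::nat} (\<lambda>i. i) (\<lambda>i. 0) + wgf (Suc ` UNIV) (\<lambda>i. i) (\<lambda>i. 0)"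
    by (rule wgf_Un) (auto simp: finite_levels_id)
  also have "wgf (Suc ` UNIV) (\<lambda>i. i) (\<lambda>i. 0) = X^1 * Y^0 * wgf (UNIV :: nat set) (\<lambda>i. i) (\<lambda>i. 0)"
    by (rule wgf_image) auto
  finally show ?thesis by (simp add: wgf_singleton algebra_simps)
qed

lemma ends_gf: "(1 - X) * (1 - X*Y) * ends_gf = 1 - X*Y + X^2*Y"
proof -
  define D where "D = wgf (UNIV :: (nat \<times> nat) set) (\<lambda>(a, z). a + z) (\<lambda>(a, z). a)"
  have "wgf {(a, z). z \<in> UNIV} (\<lambda>(a, z). a + z) (\<lambda>(a, z). a)
      = wgf (UNIV :: nat set) (\<lambda>i. i) (\<lambda>i. 0)
        + X^1 * Y^1 * wgf {(a, z). z \<in> UNIV} (\<lambda>(a, z). a + z) (\<lambda>(a, z). a)"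
    by (rule wgf_counter[where S = "\<lambda>_. UNIV"]) (auto simp: finite_levels_plus_UNIV)
  then have D: "D = wgf (UNIV :: nat set) (\<lambda>i. i) (\<lambda>i. 0) + X * Y * D"
    by (simp add: D_def)
  have "x \<in> {(0, 0)} \<union> (\<lambda>(a, z). (a, Suc z)) ` UNIV \<longleftrightarrow> x \<in> ends" for x
    by (cases x; cases "snd x") (auto simp: ends_def image_iff)
  then have "ends = {(0, 0)} \<union> (\<lambda>(a, z). (a, Suc z)) ` UNIV" by blast
  then have "ends_gf = wgf ({(0, 0)} \<union> (\<lambda>(a, z). (a, Suc z)) ` UNIV) (\<lambda>(a, z). a + z) (\<lambda>(a, z). a)"
    by (simp add: ends_gf_def)
  also have "\<dots> = wgf {(0, 0)} (\<lambda>(a, z). a + z) (\<lambda>(a, z). a)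
      + wgf ((\<lambda>(a, z). (a, Suc z)) ` UNIV) (\<lambda>(a, z). a + z) (\<lambda>(a, z). a)"
    by (rule wgf_Un) (auto intro: finite_levels_subset[OF finite_levels_plus_UNIV])
  also have "wgf ((\<lambda>(a, z). (a, Suc z)) ` UNIV) (\<lambda>(a, z). a + z) (\<lambda>(a, z). a) = X^1 * Y^0 * D"
    unfolding D_def by (rule wgf_image) (auto simp: inj_on_def)
  finally have "ends_gf = 1 + X * D" by (simp add: wgf_singleton)
  with D wgf_nat show ?thesis by algebra
qed

text \<open>Patterns are taken apart one multiplicity at a time. For a family \<open>C\<close> of sets of patterns, indexed
by the height at which they start, the sets \<open>layer_q\<close>, \<open>layer_p\<close> and \<open>layer_a\<close> contain the layers
from their \<open>q\<close>, \<open>p\<close> and \<open>a\<close> entries on, followed by a pattern of \<open>C\<close> at the height reached. The stored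
numbers are \<open>q - 1\<close> and \<open>p - 1\<close>, as both are positive.\<close>
definition layer_q :: "(int \<Rightarrow> pattern set) \<Rightarrow> int \<Rightarrow> (nat \<times> pattern) set" where
  "layer_q C s = {(j, c). c \<in> C (s - 1 - int j)}"
definition layer_p :: "(int \<Rightarrow> pattern set) \<Rightarrow> int \<Rightarrow> (nat \<times> nat \<times> pattern) set" where
  "layer_p C s = {(i, t). t \<in> layer_q C (s + 1 + int i)}"
definition layer_a :: "(int \<Rightarrow> pattern set) \<Rightarrow> int \<Rightarrow> (nat \<times> nat \<times> nat \<times> pattern) set" where
  "layer_a C s = {(a, t). t \<in> layer_p C (s + int a)}"
definition tails :: "(int \<Rightarrow> pattern set) \<Rightarrow> int \<Rightarrow> (nat \<times> nat + nat \<times> nat \<times> nat \<times> pattern) set" where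
  "tails C s = Inl ` ends \<union> Inr ` layer_a C s"

fun attach :: "nat \<times> (nat \<times> nat + nat \<times> nat \<times> nat \<times> pattern) \<Rightarrow> pattern" where
  "attach (b, Inl (a, z)) = Core b a z"
| "attach (b, Inr (a, i, j, c)) = Layer b a (Suc i) (Suc j) c"

fun size_q where "size_q (j, c) = Suc j + psize c"
fun size_p where "size_p (i, t) = Suc i + size_q t"
fun size_a where "size_a (a, t) = a + size_p t"
fun size_tail where "size_tail (Inl (a, z)) = a + z" | "size_tail (Inr t) = size_a t"
fun free_q where "free_q (j :: nat, c) = Suc (pfree c)"
fun free_p where "free_p (i :: nat, t) = free_q t"
fun free_a where "free_a (a, t) = a + free_p t"
fun free_tail where "free_tail (Inl (a, z :: nat)) = a" | "free_tail (Inr t) = free_a t"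

lemma finite_levels_layers:
  assumes "\<And>s. C s \<subseteq> patterns"
  shows "finite_levels (layer_q C s) size_q" "finite_levels (layer_p C s) size_p"
    "finite_levels (layer_a C s) size_a" "finite_levels (tails C s) size_tail"
proof -
  have uq: "finite_levels {(j::nat, c). c \<in> patterns} size_q"
    by (rule finite_levels_counter[OF finite_levels_patterns]) auto
  have up: "finite_levels {(i::nat, t). t \<in> {(j::nat, c). c \<in> patterns}} size_p"
    by (rule finite_levels_counter[OF uq]) auto
  have ua: "finite_levels {(i::nat, t). t \<in> {(i::nat, t). t \<in> {(j::nat, c). c \<in> patterns}}} size_a"
    by (rule finite_levels_counter[OF up]) auto
  have lq: "layer_q C s \<subseteq> {(j::nat, c). c \<in> patterns}" for s
    using assms by (auto simp: layer_q_def)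
  have lp: "layer_p C s \<subseteq> {(i::nat, t). t \<in> {(j::nat, c). c \<in> patterns}}" for s
    using lq by (auto simp: layer_p_def)
  have la: "layer_a C s \<subseteq> {(i::nat, t). t \<in> {(i::nat, t). t \<in> {(j::nat, c). c \<in> patterns}}}" for s
    using lp by (auto simp: layer_a_def)
  show "finite_levels (layer_q C s) size_q" "finite_levels (layer_p C s) size_p"
    using uq up lq lp finite_levels_subset by blast+
  show a: "finite_levels (layer_a C s) size_a"
    using ua la finite_levels_subset by blast
  show "finite_levels (tails C s) size_tail"
    unfolding tails_def
    by (intro finite_levels_Un finite_levels_image[OF a]
          finite_levels_image[OF finite_levels_subset[OF finite_levels_plus_UNIV]]) auto
qed

text \<open>Each equation lowers one multiplicity of the layer. A step of \<open>p\<close> or \<open>a\<close> changes the height by \<open>1\<close>, a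
step of \<open>q\<close> by \<open>- 1\<close>; the degree of freedom of the layer is charged to the last entry of \<open>q\<close>.\<close>
lemma layer_system:
  assumes C: "\<And>s. C s \<subseteq> patterns"
  shows "wgf (layer_q C s) size_q free_q = X * Y * wgf (C (s - 1)) psize pfree + X * wgf (layer_q C (s - 1)) size_q free_q"
    and "wgf (layer_p C s) size_p free_p = X * (wgf (layer_p C (s + 1)) size_p free_p + wgf (layer_q C (s + 1)) size_q free_q)"
    and "wgf (layer_a C s) size_a free_a = wgf (layer_p C s) size_p free_p + X * (Y * wgf (layer_a C (s + 1)) size_a free_a)"
    and "wgf (tails C s) size_tail free_tail = ends_gf + wgf (layer_a C s) size_a free_a"
proof -
  note fin = finite_levels_layers[of C, OF C]
  have "wgf (layer_q C s) size_q free_q = wgf (C (s - 1 - int 0)) (\<lambda>c. psize c + 1) (\<lambda>c. pfree c + 1)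
    + X^1 * Y^0 * wgf {(j, c). c \<in> C (s - 1 - int (Suc j))} size_q free_q"
    unfolding layer_q_def
    by (rule wgf_counter) (use fin(1)[of s] in \<open>simp_all add: layer_q_def\<close>)
  also have "{(j, c). c \<in> C (s - 1 - int (Suc j))} = layer_q C (s - 1)"
    by (simp add: layer_q_def algebra_simps)
  also have "wgf (C (s - 1 - int 0)) (\<lambda>c. psize c + 1) (\<lambda>c. pfree c + 1) = X^1 * Y^1 * wgf (C (s - 1)) psize pfree"
    using wgf_image[of id "C (s - 1)" "\<lambda>c. psize c + 1" psize 1 "\<lambda>c. pfree c + 1" pfree 1] by simp
  finally show "wgf (layer_q C s) size_q free_q = X * Y * wgf (C (s - 1)) psize pfree + X * wgf (layer_q C (s - 1)) size_q free_q"
    by simp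
  have "wgf (layer_p C s) size_p free_p = wgf (layer_q C (s + 1 + int 0)) (\<lambda>t. size_q t + 1) free_q
    + X^1 * Y^0 * wgf {(i, t). t \<in> layer_q C (s + 1 + int (Suc i))} size_p free_p"
    unfolding layer_p_def
    by (rule wgf_counter) (use fin(2)[of s] in \<open>simp_all add: layer_p_def\<close>)
  also have "{(i, t). t \<in> layer_q C (s + 1 + int (Suc i))} = layer_p C (s + 1)"
    by (simp add: layer_p_def algebra_simps)
  also have "wgf (layer_q C (s + 1 + int 0)) (\<lambda>t. size_q t + 1) free_q = X^1 * Y^0 * wgf (layer_q C (s + 1)) size_q free_q"
    using wgf_image[of id "layer_q C (s + 1)" "\<lambda>t. size_q t + 1" size_q 1 free_q free_q 0] by simp
  finally show "wgf (layer_p C s) size_p free_p = X * (wgf (layer_p C (s + 1)) size_p free_p + wgf (layer_q C (s + 1)) size_q free_q)"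
    by (simp add: algebra_simps)
  have "wgf (layer_a C s) size_a free_a = wgf (layer_p C (s + int 0)) size_p free_p
    + X^1 * Y^1 * wgf {(a, t). t \<in> layer_p C (s + int (Suc a))} size_a free_a"
    unfolding layer_a_def
    by (rule wgf_counter) (use fin(3)[of s] in \<open>simp_all add: layer_a_def\<close>)
  also have "{(a, t). t \<in> layer_p C (s + int (Suc a))} = layer_a C (s + 1)"
    by (simp add: layer_a_def algebra_simps)
  finally show "wgf (layer_a C s) size_a free_a = wgf (layer_p C s) size_p free_p + X * (Y * wgf (layer_a C (s + 1)) size_a free_a)"
    by (simp add: mult.assoc)
  have "wgf (tails C s) size_tail free_tail = wgf (Inl ` ends) size_tail free_tail + wgf (Inr ` layer_a C s) size_tail free_tail"
    unfolding tails_def using fin(4)[of s] unfolding tails_def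
    by (intro wgf_Un) (auto elim!: finite_levels_subset)
  also have "wgf (Inl ` ends) size_tail free_tail = ends_gf"
    unfolding ends_gf_def by (rule wgf_bij) auto
  also have "wgf (Inr ` layer_a C s) size_tail free_tail = wgf (layer_a C s) size_a free_a"
    by (rule wgf_bij) auto
  finally show "wgf (tails C s) size_tail free_tail = ends_gf + wgf (layer_a C s) size_a free_a" .
qed

text \<open>Here \<open>S b\<close> are the continuations that are allowed after \<open>b\<close> negative entries.\<close>
lemma attach_system:
  assumes C: "\<And>s. C s \<subseteq> patterns" and img: "C s = attach ` {(b, t). t \<in> S b}"
    and S: "\<And>b. S b \<subseteq> tails C (s - int b)"
  shows "wgf (C s) psize pfree = wgf (S 0) size_tail free_tail
     + X * Y * wgf (attach ` {(b, t). t \<in> S (Suc b)}) psize pfree"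
proof -
  define f' where "f' = (\<lambda>(b::nat, t). b * 1 + size_tail t)"
  define g' where "g' = (\<lambda>(b::nat, t). b * 1 + free_tail t)"
  have inj: "inj attach"
  proof (rule injI)
    fix x y assume "attach x = attach y"
    then show "x = y" by (cases x rule: attach.cases; cases y rule: attach.cases) auto
  qed
  have weights: "psize (attach x) = f' x" "pfree (attach x) = g' x" for x
    by (cases x rule: attach.cases; simp add: f'_def g'_def)+
  have "finite_levels {(b, t). t \<in> S b} f'"
    unfolding finite_levels_def
  proof
    fix n
    have "attach ` {x \<in> {(b, t). t \<in> S b}. f' x = n} \<subseteq> {c \<in> patterns. psize c = n}"
      using C[of s] unfolding img by (auto simp: weights)
    then show "finite {x \<in> {(b, t). t \<in> S b}. f' x = n}"
      using finite_levels_patterns inj unfolding finite_levels_def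
      by (meson finite_imageD finite_subset inj_on_subset subset_UNIV)
  qed
  then have "wgf {(b, t). t \<in> S b} f' g' = wgf (S 0) size_tail free_tail + X^1 * Y^1 * wgf {(b, t). t \<in> S (Suc b)} f' g'"
    by (rule wgf_counter) (simp_all add: f'_def g'_def)
  moreover have "wgf (attach ` D) psize pfree = wgf D f' g'" for D
    by (rule wgf_bij[of attach]) (use inj in \<open>auto simp: weights intro: inj_on_subset\<close>)
  ultimately show ?thesis by (simp add: img)
qed

text \<open>Without a condition on heights the family is constant, and the system closes after one step.\<close>
lemma wgf_all_patterns:
  "wgf patterns psize pfree * ((1 - X*Y) * ((1 - X)^2 * (1 - X*Y)^2 - X^2*Y)) = ends_gf * (1 - X)^2 * (1 - X*Y)^2"
proof -
  define C :: "int \<Rightarrow> pattern set" where "C = (\<lambda>_. patterns)"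
  have C: "C s \<subseteq> patterns" for s by (simp add: C_def)
  note sys = layer_system[of C, OF C]
  have const: "layer_q C s = layer_q C 0" "layer_p C s = layer_p C 0" "layer_a C s = layer_a C 0" "tails C s = tails C 0" for s
    by (simp_all add: C_def layer_q_def layer_p_def layer_a_def tails_def)
  have img: "C s = attach ` {(b, t). t \<in> tails C 0}" for s
  proof (intro set_eqI iffI)
    fix c assume "c \<in> C s"
    then show "c \<in> attach ` {(b, t). t \<in> tails C 0}"
    proof (cases c)
      case (Core b a z)
      with \<open>c \<in> C s\<close> have "c = attach (b, Inl (a, z))" "Inl (a, z) \<in> tails C 0"
        by (auto simp: C_def tails_def ends_def)
      then show ?thesis by blast
    next
      case (Layer b a p q d)
      with \<open>c \<in> C s\<close> have "c = attach (b, Inr (a, p - 1, q - 1, d))" "Inr (a, p - 1, q - 1, d) \<in> tails C 0"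
        by (auto simp: C_def tails_def layer_q_def layer_p_def layer_a_def)
      then show ?thesis by blast
    qed
  qed (auto simp: C_def tails_def layer_q_def layer_p_def layer_a_def ends_def)
  have 1: "wgf (C 0) psize pfree = wgf (tails C 0) size_tail free_tail
     + X * Y * wgf (attach ` {(b, t). t \<in> tails C 0}) psize pfree"
    by (rule attach_system[OF C img]) (use const(4) in auto)
  define N where "N = wgf patterns psize pfree"
  define q where "q = wgf (layer_q C 0) size_q free_q"
  define p where "p = wgf (layer_p C 0) size_p free_p"
  define a where "a = wgf (layer_a C 0) size_a free_a"
  have "N = ends_gf + a + X * Y * N"
    using 1 sys(4)[of 0] unfolding img[of 0, symmetric] by (simp add: N_def a_def C_def)
  moreover have "a = p + X * (Y * a)"
    using sys(3)[of 0] const(3)[of "0+1"] unfolding a_def p_def by metis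
  moreover have "p = X * (p + q)"
    using sys(2)[of 0] const(1,2)[of "0+1"] unfolding q_def p_def by metis
  moreover have "q = X * Y * N + X * q"
    using sys(1)[of 0] const(1)[of "0-1"] unfolding q_def N_def C_def by metis
  ultimately have "N * ((1 - X*Y) * ((1 - X)^2 * (1 - X*Y)^2 - X^2*Y)) = ends_gf * (1 - X)^2 * (1 - X*Y)^2"
    by algebra
  then show ?thesis by (simp add: N_def)
qed

definition nonneg_from :: "int \<Rightarrow> pattern set" where
  "nonneg_from s = {c \<in> patterns. nonneg s c}"

lemma nonneg_neg: "s < 0 \<Longrightarrow> \<not> nonneg s c"
  by (cases c) auto

lemma nonneg_from_neg: "s < 0 \<Longrightarrow> nonneg_from s = {}"
  by (auto simp: nonneg_from_def nonneg_neg)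

text \<open>Below height zero there are no nonnegative patterns, which yields the two boundary equations. The other
ones express each series at a height by series at neighbouring heights.\<close>
lemma wgf_nonneg_system:
  defines "N \<equiv> \<lambda>s::nat. wgf (nonneg_from (int s)) psize pfree"
    and "V \<equiv> \<lambda>s::nat. wgf (layer_a nonneg_from (int s)) size_a free_a"
    and "P \<equiv> \<lambda>s::nat. wgf (layer_p nonneg_from (int s)) size_p free_p"
    and "Q \<equiv> \<lambda>s::nat. wgf (layer_q nonneg_from (int s)) size_q free_q"
  shows "N 0 = ends_gf + V 0" "N (Suc s) = ends_gf + V (Suc s) + X * (Y * N s)"
    "V s = P s + X * (Y * V (Suc s))" "P s = X * (P (Suc s) + Q (Suc s))"
    "Q 0 = 0" "Q (Suc s) = X * (Q s + Y * N s)"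
proof -
  have C: "nonneg_from s \<subseteq> patterns" for s by (auto simp: nonneg_from_def)
  note sys = layer_system[of nonneg_from, OF C]
  show "V s = P s + X * (Y * V (Suc s))" "P s = X * (P (Suc s) + Q (Suc s))"
    using sys(3)[of "int s"] sys(2)[of "int s"] by (simp_all add: V_def P_def Q_def add.commute)
  show "Q (Suc s) = X * (Q s + Y * N s)"
    using sys(1)[of "int (Suc s)"] by (simp add: N_def Q_def algebra_simps)
  show "Q 0 = 0"
    by (simp add: Q_def layer_q_def nonneg_from_neg)
  define S where "S s b = (if int b \<le> s then tails nonneg_from (s - int b) else {})" for s b
  have img: "nonneg_from s = attach ` {(b, t). t \<in> S s b}" for s
  proof (intro set_eqI iffI)
    fix c assume c: "c \<in> nonneg_from s"
    show "c \<in> attach ` {(b, t). t \<in> S s b}"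
    proof (cases c)
      case (Core b a z)
      with c have "c = attach (b, Inl (a, z))" "Inl (a, z) \<in> S s b"
        by (auto simp: nonneg_from_def tails_def ends_def S_def)
      then show ?thesis by blast
    next
      case (Layer b a p q d)
      with c have "c = attach (b, Inr (a, p - 1, q - 1, d))" "Inr (a, p - 1, q - 1, d) \<in> S s b"
        by (auto simp: nonneg_from_def tails_def S_def layer_q_def layer_p_def layer_a_def of_nat_diff algebra_simps Suc_le_eq)
      then show ?thesis by blast
    qed
  next
    fix c assume "c \<in> attach ` {(b, t). t \<in> S s b}"
    then obtain b t where c: "c = attach (b, t)" "t \<in> S s b" by auto
    then show "c \<in> nonneg_from s"
      by (cases "(b, t)" rule: attach.cases)
        (auto simp: nonneg_from_def tails_def S_def layer_q_def layer_p_def layer_a_def ends_def algebra_simps split: if_splits)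
  qed
  have step: "wgf (nonneg_from s) psize pfree = wgf (S s 0) size_tail free_tail
     + X * Y * wgf (attach ` {(b, t). t \<in> S s (Suc b)}) psize pfree" for s
    by (rule attach_system[OF C img]) (auto simp: S_def)
  have "S s (Suc b) = S (s - 1) b" for s b
    by (auto simp: S_def algebra_simps)
  then have step: "wgf (nonneg_from s) psize pfree = wgf (S s 0) size_tail free_tail
     + X * Y * wgf (nonneg_from (s - 1)) psize pfree" for s
    using step[of s] img[of "s - 1"] by simp
  have S0: "wgf (S (int s) 0) size_tail free_tail = ends_gf + V s" for s
    using sys(4)[of "int s"] by (simp add: S_def V_def)
  show "N 0 = ends_gf + V 0"
    using step[of "int 0"] S0[of 0] by (simp add: N_def nonneg_from_neg)
  show "N (Suc s) = ends_gf + V (Suc s) + X * (Y * N s)"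
    using step[of "int (Suc s)"] S0[of "Suc s"] by (simp add: N_def mult.assoc)
qed

text \<open>Layers with \<open>p = q\<close> contribute a geometric series in \<open>X\<^sup>2\<close>.\<close>
lemma wgf_twin:
  assumes "finite_levels S psize"
  shows "(1 - X^2) * wgf ((\<lambda>(i, c). Layer b a (Suc i) (Suc i) c) ` {(i, c). c \<in> S}) psize pfree
     = X^(a + b + 2) * Y^(a + b + 1) * wgf S psize pfree"
proof -
  let ?D = "{(i::nat, c). c \<in> S}"
  let ?f = "\<lambda>(i::nat, c). i * 2 + psize c" and ?g = "\<lambda>(i::nat, c). i * 0 + pfree c"
  have fin: "finite_levels ?D ?f"
    by (rule finite_levels_counter[OF assms]) auto
  have "wgf ?D ?f ?g = wgf S psize pfree + X^2 * Y^0 * wgf ?D ?f ?g"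
    by (rule wgf_counter[OF fin]) auto
  then have "(1 - X^2) * wgf ?D ?f ?g = wgf S psize pfree" by algebra
  moreover have "wgf ((\<lambda>(i, c). Layer b a (Suc i) (Suc i) c) ` ?D) psize pfree = X^(a + b + 2) * Y^(a + b + 1) * wgf ?D ?f ?g"
    by (rule wgf_image) (auto simp: inj_on_def)
  ultimately show ?thesis by (simp only: mult.left_commute[of "1 - X^2"])
qed

lemma finite_levels_pattern_set: "S \<subseteq> patterns \<Longrightarrow> finite_levels S psize"
  using finite_levels_patterns finite_levels_subset by blast

lemma wgf_balanced:
  defines "B \<equiv> {c \<in> patterns. balanced c}"
  shows "wgf B psize pfree * ((1 - X) * (1 - X^2 * (1 + Y))) = 1 - X^2"
proof -
  define L where "L = (\<lambda>(i, c). Layer 0 0 (Suc i) (Suc i) c) ` {(i, c). c \<in> B}"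
  have "c \<in> B \<longleftrightarrow> c \<in> Core 0 0 ` UNIV \<union> L" for c
  proof (cases c)
    case (Layer b a p q d)
    then show ?thesis by (cases p) (auto simp: B_def L_def image_iff)
  qed (auto simp: B_def L_def)
  then have B: "B = Core 0 0 ` UNIV \<union> L" by blast
  have fin: "finite_levels B psize" by (rule finite_levels_pattern_set) (auto simp: B_def)
  have "wgf B psize pfree = wgf (Core 0 0 ` UNIV) psize pfree + wgf L psize pfree"
    unfolding B by (rule wgf_Un) (use finite_levels_subset[OF fin, unfolded B] in \<open>auto simp: L_def\<close>)
  moreover have "wgf (Core 0 0 ` UNIV) psize pfree = wgf (UNIV :: nat set) (\<lambda>i. i) (\<lambda>i. 0)"
    by (rule wgf_bij[of "Core 0 0"]) (auto simp: inj_on_def)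
  moreover have "(1 - X^2) * wgf L psize pfree = X^2 * Y * wgf B psize pfree"
    using wgf_twin[OF fin, of 0 0] by (simp add: L_def power2_eq_square)
  ultimately show ?thesis using wgf_nat by algebra
qed

lemma wgf_exceptional:
  defines "B \<equiv> {c \<in> patterns. balanced c}" and "E \<equiv> {c \<in> patterns. exceptional c}"
  shows "wgf E psize pfree * ((1 - X) * (1 - X^2 * (1 + Y)))
    = (1 - X^2) * (X^3*Y^2 + (1 - X) * (X*Y + X^2*Y^2)) + (1 - X) * X^4*Y^3 * wgf B psize pfree"
proof -
  define L where "L = (\<lambda>(i, c). Layer 0 0 (Suc i) (Suc i) c) ` {(i, c). c \<in> E}"
  define M where "M = (\<lambda>(i, c). Layer 1 1 (Suc i) (Suc i) c) ` {(i, c). c \<in> B}"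
  let ?Z = "(\<lambda>i. Core 1 1 (Suc i)) ` UNIV"
  have "c \<in> E \<longleftrightarrow> c \<in> {Core 1 0 0} \<union> ({Core 2 0 0} \<union> (?Z \<union> (L \<union> M)))" for c
  proof (cases c)
    case (Core b a z)
    then show ?thesis by (cases z) (auto simp: E_def L_def M_def image_iff)
  next
    case (Layer b a p q d)
    then show ?thesis by (cases p) (auto simp: E_def B_def L_def M_def image_iff)
  qed
  then have E: "E = {Core 1 0 0} \<union> ({Core 2 0 0} \<union> (?Z \<union> (L \<union> M)))" by blast
  have fin: "finite_levels E psize" "finite_levels B psize"
    by (rule finite_levels_pattern_set; auto simp: B_def E_def)+
  have sub: "finite_levels S psize" if "S \<subseteq> {Core 1 0 0} \<union> ({Core 2 0 0} \<union> (?Z \<union> (L \<union> M)))" for S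
    using finite_levels_subset[OF fin(1)] that unfolding E[symmetric] by blast
  have "wgf E psize pfree = wgf {Core 1 0 0} psize pfree + (wgf {Core 2 0 0} psize pfree
      + (wgf ?Z psize pfree + (wgf L psize pfree + wgf M psize pfree)))"
    unfolding E
    apply (subst wgf_Un, (rule sub; blast)+, force simp: L_def M_def)
    apply (subst wgf_Un, (rule sub; blast)+, force simp: L_def M_def)
    apply (subst wgf_Un, (rule sub; blast)+, force simp: L_def M_def)
    apply (subst wgf_Un, (rule sub; blast)+, force simp: L_def M_def)
    apply (rule refl)
    done
  moreover have "wgf ?Z psize pfree = X^3 * Y^2 * wgf (UNIV :: nat set) (\<lambda>i. i) (\<lambda>i. 0)"
    by (rule wgf_image) (auto simp: inj_on_def)
  moreover have "(1 - X^2) * wgf L psize pfree = X^2 * Y * wgf E psize pfree"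
    using wgf_twin[OF fin(1), of 0 0] by (simp add: L_def power2_eq_square)
  moreover have "(1 - X^2) * wgf M psize pfree = X^4 * Y^3 * wgf B psize pfree"
    using wgf_twin[OF fin(2), of 1 1] by (simp add: M_def eval_nat_numeral)
  moreover have "wgf {Core 1 0 0} psize pfree = X * Y" "wgf {Core 2 0 0} psize pfree = X^2 * Y^2"
    by (simp_all add: wgf_singleton)
  ultimately show ?thesis using wgf_nat by algebra
qed

text \<open>The patterns without negative and those without positive heights are exchanged by duality, they meet in
the balanced patterns, and both are disjoint from the exceptional ones. The factor \<open>Y\<close> accounts for the degree of
freedom lost by patterns that are not balanced.\<close>
lemma wgf_feasible:
  "Y * wgf {c \<in> patterns. feasible c} psize pdim =
    wgf patterns psize pfree - 2 * wgf (nonneg_from 0) psize pfree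
    + (1 + Y) * wgf {c \<in> patterns. balanced c} psize pfree - wgf {c \<in> patterns. exceptional c} psize pfree"
proof -
  define B where "B = {c \<in> patterns. balanced c}"
  define E where "E = {c \<in> patterns. exceptional c}"
  define NN where "NN = nonneg_from 0"
  define NP where "NP = {c \<in> patterns. nonneg 0 (dual c)}"
  define G where "G = {c \<in> patterns. feasible c \<and> \<not> balanced c}"
  have sub: "finite_levels S psize" if "S \<subseteq> patterns" for S
    using that by (rule finite_levels_pattern_set)
  have BN: "B \<subseteq> NN" "B \<subseteq> NP"
    using balanced_imp_nonneg balanced_dual by (auto simp: B_def NN_def NP_def nonneg_from_def)
  have inter: "NN \<inter> NP = B"
    using BN nonneg_both[of _ 0] by (auto simp: B_def NN_def NP_def nonneg_from_def)
  have EN: "E \<inter> NN = {}" "E \<inter> NP = {}" "E \<inter> B = {}"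
    using exceptional_not_nonneg by (auto simp: E_def B_def NN_def NP_def nonneg_from_def)
  have all: "patterns = G \<union> ((NN - B) \<union> ((NP - B) \<union> (B \<union> E)))"
    unfolding G_def feasible_def B_def E_def NN_def NP_def nonneg_from_def by auto
  have subs: "G \<subseteq> patterns" "NN \<subseteq> patterns" "NP \<subseteq> patterns" "B \<subseteq> patterns" "E \<subseteq> patterns"
    by (auto simp: G_def feasible_def B_def E_def NN_def NP_def nonneg_from_def)
  have disj: "G \<inter> ((NN - B) \<union> ((NP - B) \<union> (B \<union> E))) = {}"
    unfolding G_def feasible_def B_def E_def NN_def NP_def nonneg_from_def by auto
  have "wgf patterns psize pfree = wgf G psize pfree + (wgf (NN - B) psize pfree
      + (wgf (NP - B) psize pfree + (wgf B psize pfree + wgf E psize pfree)))"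
    apply (subst all)
    apply (subst wgf_Un)
    using subs disj apply (auto intro!: sub)[3]
    apply (subst wgf_Un)
    using subs EN inter apply (auto intro!: sub)[3]
    apply (subst wgf_Un)
    using subs EN inter apply (auto intro!: sub)[3]
    apply (subst wgf_Un)
    using subs EN inter apply (auto intro!: sub)[3]
    apply (rule refl)
    done
  moreover have "wgf (NN - B) psize pfree = wgf NN psize pfree - wgf B psize pfree"
    using subs BN by (intro wgf_Diff sub)
  moreover have "wgf (NP - B) psize pfree = wgf NP psize pfree - wgf B psize pfree"
    using subs BN by (intro wgf_Diff sub)
  moreover have "wgf NP psize pfree = wgf NN psize pfree"
  proof (rule wgf_bij[of dual])
    show "inj_on dual NN"
      by (rule inj_on_inverseI[of _ dual]) (auto simp: NN_def nonneg_from_def)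
    show "dual ` NN = NP"
    proof (intro set_eqI iffI)
      fix c assume "c \<in> NP"
      then have "c = dual (dual c)" "dual c \<in> NN" by (auto simp: NN_def NP_def nonneg_from_def)
      then show "c \<in> dual ` NN" by blast
    qed (auto simp: NN_def NP_def nonneg_from_def)
  qed auto
  moreover have "wgf G psize pfree = Y * wgf G psize pdim"
    using wgf_image[of id G psize psize 0 pfree pdim 1] pfree_pos
    by (auto simp: G_def pdim_def Suc_le_eq)
  moreover have "wgf {c \<in> patterns. feasible c} psize pdim = wgf G psize pdim + wgf B psize pfree"
  proof -
    have "{c \<in> patterns. feasible c} = G \<union> B" by (auto simp: G_def B_def feasible_def)
    then have "wgf {c \<in> patterns. feasible c} psize pdim = wgf G psize pdim + wgf B psize pdim"
      using subs by (auto simp: G_def B_def intro!: wgf_Un sub)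
    moreover have "wgf B psize pdim = wgf B psize pfree"
      by (rule wgf_bij[of id]) (auto simp: B_def pdim_def)
    ultimately show ?thesis by simp
  qed
  ultimately show ?thesis unfolding NN_def[symmetric] B_def[symmetric] E_def[symmetric] by algebra
qed

section \<open>The kernel of the nonnegative patterns\<close>

lemma sqrt_R_square:
  assumes "f $ 0 $ 0 = 1"
  shows "sqrt_R f ^ 2 = f" and "sqrt_R f $ 0 $ 0 = 1"
  using theI'[OF sqrt_R_ex1[OF assms]] by (simp_all add: sqrt_R_def)

lemma unit_if_constant_term:
  fixes f :: R
  assumes "f $ 0 $ 0 \<noteq> 0"
  obtains g where "f * g = 1"
proof -
  have "f $ 0 * inverse (f $ 0) = 1"
    using assms by (rule inverse_mult_eq_1')
  then show ?thesis using that fps_right_inverse by blast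
qed

lemma X_mult_nth: "(X * f) $ m = (if m = 0 then 0 else f $ (m - 1))"
  by (simp add: X_def)

lemma Y_mult_nth: "(Y * f) $ m = fps_X * f $ m"
  by (simp add: Y_def)

text \<open>The sums \<open>w = t + 1/t\<close> at which the kernel vanishes are the roots of
\<open>x\<^sup>2 y w\<^sup>2 - x A w + Q = 0\<close>, with discriminant \<open>x\<^sup>2 c\<close>; their inverses are \<open>x (A \<mp> g) / (2 Q)\<close>. The
small solution \<open>t\<close> of \<open>t + 1/t = w\<close> is \<open>2 v / (1 + \<surd>(1 - 4 v\<^sup>2))\<close> with \<open>v = 1/w\<close>, where
\<open>Q\<^sup>2 (1 - 4 v\<^sup>2)\<close> is \<open>z \<plusminus> e g\<close>. This gives \<open>rp\<close> and \<open>rm\<close>. In the last identity, the factors are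
\<open>(Q + hp) (1 - rp)\<close> and \<open>(Q + hm) (1 - rm)\<close>, because \<open>b = Q - x A\<close>.\<close>
lemma kernel_factorization:
  fixes x y g hp hm ip im :: "'a::idom"
  defines "A \<equiv> (1 + y) * (1 + x^2*y)"
    and "Q \<equiv> (1 + x^2) * (1 + x^2*y^2) - x^2*y"
    and "b \<equiv> 1 - x + x^2 - x*y - x^2*y - x^3*y + x^2*y^2 - x^3*y^2 + x^4*y^2"
    and "c \<equiv> 1 - 2*y - 2*x^2*y + y^2 + 8*x^2*y^2 + x^4*y^2 - 2*x^2*y^3 - 2*x^4*y^3 + x^4*y^4"
    and "z \<equiv> 1 + x^4 - 2*x^2*y - 2*x^4*y - 7*x^4*y^2 - 2*x^4*y^3 - 2*x^6*y^3 + x^4*y^4 + x^8*y^4"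
    and "e \<equiv> 2*x^2*(1 + y)*(1 + x^2*y)"
  assumes g: "g^2 = c" and hp: "hp^2 = z + e*g" and hm: "hm^2 = z - e*g"
    and ip: "(Q + hp) * ip = 1" and im: "(Q + hm) * im = 1"
  defines "rp \<equiv> x * (A - g) * ip" and "rm \<equiv> x * (A + g) * im"
  defines "\<sigma> \<equiv> rp + rm" and "p \<equiv> rp * rm" and "\<kappa> \<equiv> 4 * Q * ip * im"
  shows "p = \<kappa> * x^2 * y"
    and "\<sigma> * (1 + p) = \<kappa> * x * A"
    and "1 + \<sigma>^2 + p^2 = \<kappa> * (Q + 2*x^2*y)"
    and "(b + x*g + hp) * (b - x*g + hm) * \<kappa> = 4 * Q * (1 - \<sigma> + p)"
proof -
  have bQ: "b = Q - x * A"
    unfolding b_def Q_def A_def by algebra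
  have c1: "A^2 - c = 4 * y * Q"
    unfolding c_def Q_def A_def by algebra
  have z1: "z = Q^2 - x^2 * (A^2 + c)"
    unfolding c_def Q_def A_def z_def by algebra
  have e1: "e = 2 * x^2 * A" unfolding e_def A_def by algebra
  have hp': "hp^2 = Q^2 - (x * (A - g))^2"
    unfolding hp z1 e1 g[symmetric] by algebra
  have hm': "hm^2 = Q^2 - (x * (A + g))^2"
    unfolding hm z1 e1 g[symmetric] by algebra
  have Ag: "(A - g) * (A + g) = 4 * y * Q"
    using c1 g by algebra
  show p: "p = \<kappa> * x^2 * y"
    unfolding p_def rp_def rm_def \<kappa>_def using Ag by algebra
  have rp2: "1 + rp^2 = 2 * Q * ip"
    unfolding rp_def using ip hp' by algebra
  have rm2: "1 + rm^2 = 2 * Q * im"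
    unfolding rm_def using im hm' by algebra
  have "\<sigma> * (1 + p) = rp * (1 + rm^2) + rm * (1 + rp^2)"
    unfolding \<sigma>_def p_def by algebra
  also have "\<dots> = \<kappa> * x * A"
    unfolding rp2 rm2 unfolding rp_def rm_def \<kappa>_def by algebra
  finally show "\<sigma> * (1 + p) = \<kappa> * x * A" .
  have "1 + \<sigma>^2 + p^2 = (1 + rp^2) * (1 + rm^2) + 2 * p"
    unfolding \<sigma>_def p_def by algebra
  also have "\<dots> = \<kappa> * Q + 2 * (\<kappa> * x^2 * y)"
    unfolding rp2 rm2 p unfolding \<kappa>_def by algebra
  also have "\<dots> = \<kappa> * (Q + 2*x^2*y)" by algebra
  finally show "1 + \<sigma>^2 + p^2 = \<kappa> * (Q + 2*x^2*y)" .
  have u1: "(b + x*g + hp) * ip = 1 - rp"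
    unfolding bQ rp_def using ip by algebra
  have u2: "(b - x*g + hm) * im = 1 - rm"
    unfolding bQ rm_def using im by algebra
  have "(b + x*g + hp) * (b - x*g + hm) * \<kappa>
      = 4 * Q * (((b + x*g + hp) * ip) * ((b - x*g + hm) * im))"
    unfolding \<kappa>_def by algebra
  also have "\<dots> = 4 * Q * (1 - \<sigma> + p)"
    unfolding u1 u2 \<sigma>_def p_def by algebra
  finally show "(b + x*g + hp) * (b - x*g + hm) * \<kappa> = 4 * Q * (1 - \<sigma> + p)" .
qed

text \<open>Every equation expresses a coefficient in \<open>X\<close> by lower coefficients or by series that have been
treated already, in the order \<open>Q\<close>, \<open>P\<close>, \<open>V\<close>, \<open>N\<close>.\<close>
lemma homogeneous_system_trivial:
  fixes N V P Q :: "nat \<Rightarrow> R"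
  assumes N0: "N 0 = V 0" and N: "\<And>s. N (Suc s) = V (Suc s) + X * (Y * N s)"
    and V: "\<And>s. V s = P s + X * (Y * V (Suc s))"
    and P: "\<And>s. P s = X * (P (Suc s) + Q (Suc s))"
    and Q0: "Q 0 = 0" and Q: "\<And>s. Q (Suc s) = X * (Q s + Y * N s)"
  shows "N s = 0"
proof -
  have "\<forall>s. N s $ m = 0 \<and> V s $ m = 0 \<and> P s $ m = 0 \<and> Q s $ m = 0" for m
  proof (induction m rule: less_induct)
    case (less m)
    have X0: "(X * f) $ m = 0" if "\<And>i. i < m \<Longrightarrow> f $ i = 0" for f
      using that by (simp add: X_mult_nth)
    have q: "Q s $ m = 0" for s
      using less by (cases s) (auto simp: Q0 Q Y_mult_nth intro!: X0)
    have p: "P s $ m = 0" for s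
      using less by (subst P) (auto intro!: X0)
    have v: "V s $ m = 0" for s
      using less by (subst V) (auto simp: p Y_mult_nth intro!: X0)
    have n: "N s $ m = 0" for s
      using less by (cases s) (auto simp: v N0 N Y_mult_nth intro!: X0)
    from q p v n show ?case by blast
  qed
  then show ?thesis by (simp add: fps_eq_iff)
qed

text \<open>Coefficients of \<open>t\<^sup>2 / ((1 - t) (1 - \<sigma> t + p t\<^sup>2))\<close>. The two leading zeros stand for the
coefficients with negative index that occur in the solution of the system.\<close>
fun hsum :: "'a::comm_ring_1 \<Rightarrow> 'a \<Rightarrow> nat \<Rightarrow> 'a" where
  "hsum \<sigma> p 0 = 0"
| "hsum \<sigma> p (Suc 0) = 0"
| "hsum \<sigma> p (Suc (Suc m)) = 1 + \<sigma> * hsum \<sigma> p (Suc m) - p * hsum \<sigma> p m"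

text \<open>The equations on \<open>\<sigma>\<close>, \<open>p\<close> and \<open>\<kappa>\<close> say that \<open>\<kappa>\<close> times the kernel is
\<open>(1 - \<sigma> t + p t\<^sup>2) (1 - \<sigma>/t + p/t\<^sup>2)\<close>. The solution has
\<open>N(t) = n (1 - X t) / ((1 - t) (1 - \<sigma> t + p t\<^sup>2))\<close> as its generating function in the height; the constant \<open>n\<close>
is then determined by the one equation of the system that is not satisfied identically.\<close>
lemma nonneg_system_solution:
  fixes N V P Q :: "nat \<Rightarrow> R" and \<sigma> p \<kappa> e :: R
  assumes N0: "N 0 = e + V 0" and N: "\<And>s. N (Suc s) = e + V (Suc s) + X * (Y * N s)"
    and V: "\<And>s. V s = P s + X * (Y * V (Suc s))"
    and P: "\<And>s. P s = X * (P (Suc s) + Q (Suc s))"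
    and Q0: "Q 0 = 0" and Q: "\<And>s. Q (Suc s) = X * (Q s + Y * N s)"
    and p: "p = \<kappa> * X^2 * Y"
    and \<sigma>: "\<sigma> * (1 + p) = \<kappa> * X * ((1 + Y) * (1 + X^2*Y))"
    and \<kappa>: "1 + \<sigma>^2 + p^2 = \<kappa> * ((1 + X^2) * (1 + X^2*Y^2) + X^2*Y)"
    and unit: "(1 - \<sigma> + p) * u = 1"
    and nz: "\<kappa> \<noteq> 0"
  shows "N 0 * (1 - \<sigma> + p) = e * \<kappa> * (1 - X) * (1 - X*Y)"
proof -
  define n where "n = e * \<kappa> * (1 - X) * (1 - X*Y) * u"
  have n: "n * (1 - \<sigma> + p) = e * \<kappa> * (1 - X) * (1 - X*Y)"
    using unit unfolding n_def by algebra
  define H where "H = hsum \<sigma> p"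
  have H [simp]: "H 0 = 0" "H (Suc 0) = 0" by (simp_all add: H_def)
  have H2: "H (Suc (Suc m)) = 1 + \<sigma> * H (Suc m) - p * H m" for m by (simp add: H_def)
  define N' where "N' s = n * (H (s+2) - X * H (s+1))" for s
  define Q' where "Q' s = X * Y * n * H (s+1)" for s
  define V' where "V' s = n * (H (s+2) - X * (1 + Y) * H (s+1) + X^2 * Y * H s) - e" for s
  define P' where "P' s = V' s - X * (Y * V' (Suc s))" for s
  have P': "P' s = X * (P' (Suc s) + Q' (Suc s))" for s
  proof -
    define a where "a = H s"
    define b where "b = H (Suc s)"
    define c where "c = 1 + \<sigma> * b - p * a"
    define d where "d = 1 + \<sigma> * c - p * b"
    define f where "f = 1 + \<sigma> * d - p * c"
    have H_eqs: "H s = a" "H (Suc s) = b" "H (Suc (Suc s)) = c" "H (Suc (Suc (Suc s))) = d"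
      "H (Suc (Suc (Suc (Suc s)))) = f"
      by (simp_all add: a_def b_def c_def d_def f_def H2)
    let ?q = "(1 + X^2) * (1 + X^2*Y^2) + X^2*Y"
    let ?k = "X * ((1 + Y) * (1 + X^2*Y))"
    have "\<kappa> * (X^2*Y*a - ?k * b + ?q * c - ?k * d + X^2*Y*f)
        = p * (a + f) - \<sigma> * (1 + p) * (b + d) + (1 + \<sigma>^2 + p^2) * c"
      unfolding \<sigma> \<kappa> by (subst p) algebra
    also have "\<dots> = 1 - \<sigma> + p"
      unfolding f_def d_def c_def by algebra
    \<comment> \<open>the kernel, applied as a difference operator to the coefficients of the ansatz, yields a
      constant sequence\<close>
    finally have "n * \<kappa> * (X^2*Y*a - ?k * b + ?q * c - ?k * d + X^2*Y*f) = e * \<kappa> * (1 - X) * (1 - X*Y)"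
      using n by algebra
    then have "\<kappa> * (n * (X^2*Y*a - ?k * b + ?q * c - ?k * d + X^2*Y*f)) = \<kappa> * (e * (1 - X) * (1 - X*Y))"
      by algebra
    then have key: "n * (X^2*Y*a - ?k * b + ?q * c - ?k * d + X^2*Y*f) = e * (1 - X) * (1 - X*Y)"
      using nz by simp
    show ?thesis
      unfolding P'_def V'_def Q'_def by (simp add: H_eqs) (use key in algebra)
  qed
  have "N 0 - N' 0 = 0"
  proof (rule homogeneous_system_trivial[of "\<lambda>s. N s - N' s" "\<lambda>s. V s - V' s" "\<lambda>s. P s - P' s" "\<lambda>s. Q s - Q' s"])
    show "N 0 - N' 0 = V 0 - V' 0"
      unfolding N0 N'_def V'_def by (simp add: H2)
    show "N (Suc s) - N' (Suc s) = V (Suc s) - V' (Suc s) + X * (Y * (N s - N' s))" for s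
      unfolding N N'_def V'_def by (simp add: algebra_simps power2_eq_square)
    show "V s - V' s = P s - P' s + X * (Y * (V (Suc s) - V' (Suc s)))" for s
      unfolding P'_def by (subst V) (simp add: algebra_simps)
    show "P s - P' s = X * (P (Suc s) - P' (Suc s) + (Q (Suc s) - Q' (Suc s)))" for s
      by (subst P, subst P') (simp add: algebra_simps)
    show "Q 0 - Q' 0 = 0" by (simp add: Q0 Q'_def)
    show "Q (Suc s) - Q' (Suc s) = X * (Q s - Q' s + Y * (N s - N' s))" for s
      unfolding Q Q'_def N'_def by (simp add: algebra_simps)
  qed
  moreover have "N' 0 = n" by (simp add: N'_def H2)
  ultimately show ?thesis using n by simp
qed

section \<open>The generating function of the flats\<close>

lemma constant_terms: "X $ 0 = 0" "Y $ 0 = fps_X" "(numeral k :: R) $ 0 = numeral k"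
  by (simp_all add: X_def Y_def)

lemma fps_power_nth_0: "((f :: 'a::comm_ring_1 fps) ^ n) $ 0 = (f $ 0) ^ n"
  by (induction n) auto

theorem theorem3p8:
  shows "to_fract F =
      to_fract 2 / to_fract (Y * (1 - X))
    + to_fract (1 - X + 2*X^3 - 2*X^4 - X^5 + X^6 - 2*X^2*Y + X^3*Y + X^4*Y - X^5*Y)
        / to_fract ((1 - X) * (1 - X^2 * (1 + Y))^2)
    + to_fract (X - X^3 + X^4 - X^2*Y + 2*X^3*Y - X^4*Y)
        / to_fract ((1 - X) * (1 - 2*X + X^2 - 2*X*Y + 3*X^2*Y - 2*X^3*Y
                                 + X^2*Y^2 - 2*X^3*Y^2 + X^4*Y^2))
    - to_fract (8 * (1 + X^2 - X*Y - X^3*Y + X^4*Y + X^2*Y^2 + X^3*Y^2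
                       - X^3*Y^3 + X^4*Y^3 - X^5*Y^3 + X^6*Y^3))
        / to_fract (Y * (\<beta> + X * sqrt_R \<gamma> + sqrt_R (\<zeta> + \<eta> * sqrt_R \<gamma>))
                      * (\<beta> - X * sqrt_R \<gamma> + sqrt_R (\<zeta> - \<eta> * sqrt_R \<gamma>)))"
proof -
  let ?T = "wgf patterns psize pfree" and ?N = "wgf (nonneg_from 0) psize pfree"
    and ?B = "wgf {c \<in> patterns. balanced c} psize pfree" and ?E = "wgf {c \<in> patterns. exceptional c} psize pfree"
  define P where "P = 1 + X^2 - X*Y - X^3*Y + X^4*Y + X^2*Y^2 + X^3*Y^2
                       - X^3*Y^3 + X^4*Y^3 - X^5*Y^3 + X^6*Y^3"
  define D1 where "D1 = 1 - X"
  define D2 where "D2 = 1 - X^2 * (1 + Y)"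
  define D3 where "D3 = 1 - 2*X + X^2 - 2*X*Y + 3*X^2*Y - 2*X^3*Y + X^2*Y^2 - 2*X^3*Y^2 + X^4*Y^2"
  define n2 where "n2 = 1 - X + 2*X^3 - 2*X^4 - X^5 + X^6 - 2*X^2*Y + X^3*Y + X^4*Y - X^5*Y"
  define n3 where "n3 = X - X^3 + X^4 - X^2*Y + 2*X^3*Y - X^4*Y"
  define Q where "Q = (1 + X^2) * (1 + X^2*Y^2) - X^2*Y"
  define g where "g = sqrt_R \<gamma>"
  define hp where "hp = sqrt_R (\<zeta> + \<eta> * g)"
  define hm where "hm = sqrt_R (\<zeta> - \<eta> * g)"
  define up where "up = \<beta> + X * g + hp"
  define um where "um = \<beta> - X * g + hm"
  note ct = constant_terms fps_power_nth_0
  have c: "\<gamma> $ 0 $ 0 = 1" "\<zeta> $ 0 = 1" "\<eta> $ 0 = 0" "Q $ 0 $ 0 = 1" "\<beta> $ 0 $ 0 = 1"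
    by (simp_all add: \<gamma>_def \<zeta>_def \<eta>_def Q_def \<beta>_def ct)
  have g: "g^2 = \<gamma>" "g $ 0 $ 0 = 1"
    using sqrt_R_square[OF c(1)] by (simp_all add: g_def)
  have hp: "hp^2 = \<zeta> + \<eta> * g" "hp $ 0 $ 0 = 1"
    using sqrt_R_square[of "\<zeta> + \<eta> * g"] c by (simp_all add: hp_def)
  have hm: "hm^2 = \<zeta> - \<eta> * g" "hm $ 0 $ 0 = 1"
    using sqrt_R_square[of "\<zeta> - \<eta> * g"] c by (simp_all add: hm_def)
  \<comment> \<open>the constant terms of \<open>Q + hp\<close> and \<open>Q + hm\<close> are \<open>2\<close>, so that the small roots are power series\<close>
  obtain ip where ip: "(Q + hp) * ip = 1"
    by (rule unit_if_constant_term[of "Q + hp"]) (use c hp in auto)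
  obtain im where im: "(Q + hm) * im = 1"
    by (rule unit_if_constant_term[of "Q + hm"]) (use c hm in auto)
  define A where "A = (1 + Y) * (1 + X^2*Y)"
  define rp where "rp = X * (A - g) * ip"
  define rm where "rm = X * (A + g) * im"
  define \<sigma> where "\<sigma> = rp + rm"
  define p where "p = rp * rm"
  define \<kappa> where "\<kappa> = 4 * Q * ip * im"
  note kf = kernel_factorization[of g Y X hp hm ip im, folded \<gamma>_def \<zeta>_def \<eta>_def Q_def A_def \<beta>_def,
      OF g(1) hp(1) hm(1) ip im, folded rp_def rm_def, folded \<sigma>_def p_def, folded \<kappa>_def]
  have "\<kappa> \<noteq> 0"
  proof
    assume "\<kappa> = 0"
    then have "4 * Q = 0" using ip im unfolding \<kappa>_def by algebra
    then have "(4 * Q) $ 0 $ 0 = 0" by simp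
    with c show False by (simp add: ct)
  qed
  obtain u where u: "(1 - \<sigma> + p) * u = 1"
    by (rule unit_if_constant_term[of "1 - \<sigma> + p"]) (auto simp: \<sigma>_def p_def rp_def rm_def ct)
  have k3: "1 + \<sigma>^2 + p^2 = \<kappa> * ((1 + X^2) * (1 + X^2*Y^2) + X^2*Y)"
    using kf(3) unfolding Q_def by algebra
  have "wgf (nonneg_from (int 0)) psize pfree * (1 - \<sigma> + p) = ends_gf * \<kappa> * (1 - X) * (1 - X*Y)"
    by (rule nonneg_system_solution[OF wgf_nonneg_system kf(1) kf(2)[unfolded A_def] k3 u \<open>\<kappa> \<noteq> 0\<close>])
  then have "?N * (1 - \<sigma> + p) = \<kappa> * (1 - X*Y + X^2*Y)"
    using ends_gf by (simp, algebra)
  then have "\<kappa> * (?N * (up * um)) = \<kappa> * (4 * Q * (1 - X*Y + X^2*Y))"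
    using kf(4) unfolding up_def um_def by algebra
  then have "?N * (up * um) = 4 * Q * (1 - X*Y + X^2*Y)"
    using \<open>\<kappa> \<noteq> 0\<close> by simp
  \<comment> \<open>the numerator of the last summand is \<open>8\<close> times the product of \<open>Q\<close> and the numerator of \<open>ends_gf\<close>\<close>
  also have "\<dots> = 4 * P" unfolding P_def Q_def by algebra
  finally have N: "?N * (up * um) = 4 * P" .
  \<comment> \<open>the rational part, which accounts for the first three summands\<close>
  define r where "r = ?T + (1 + Y) * ?B - ?E"
  have "1 - X*Y \<noteq> 0" "D1 \<noteq> 0" "D2 \<noteq> 0" "D3 \<noteq> 0" "up \<noteq> 0" "um \<noteq> 0" "Y \<noteq> 0"
    using c g hp hm by (auto simp: D1_def D2_def D3_def up_def um_def ct Y_def dest!: arg_cong[where f = "\<lambda>f. f $ 0 $ 0"])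
  note nz = this
  have D3: "D3 = (1 - X)^2 * (1 - X*Y)^2 - X^2*Y" unfolding D3_def by algebra
  have T: "(1 - X*Y)^2 * (?T * D3 * D1) = (1 - X*Y)^2 * (D1^2 * (1 - X*Y + X^2*Y))"
    using wgf_all_patterns ends_gf unfolding D3[symmetric] unfolding D1_def by algebra
  then have T: "?T * D3 = D1 * (1 - X*Y + X^2*Y)"
    using nz by (simp add: power2_eq_square)
  have B: "?B * (D1 * D2) = 1 - X^2"
    using wgf_balanced unfolding D1_def D2_def .
  have E: "?E * (D1 * D2) = (1 - X^2) * (X^3*Y^2 + D1 * (X*Y + X^2*Y^2)) + D1 * X^4*Y^3 * ?B"
    using wgf_exceptional unfolding D1_def D2_def .
  have r: "r * (D1 * D2^2 * D3) = 2 * D2^2 * D3 + Y * n2 * D3 + Y * n3 * D2^2"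
  proof -
    have "?E * (D1 * D2) * D2 = (1 - X^2) * ((X^3*Y^2 + D1 * (X*Y + X^2*Y^2)) * D2 + X^4*Y^3)"
      unfolding E using B by algebra
    then have "r * (D1 * D2^2 * D3) = D1^2 * (1 - X*Y + X^2*Y) * D2^2 + (1 + Y) * (1 - X^2) * D2 * D3
      - (1 - X^2) * ((X^3*Y^2 + D1 * (X*Y + X^2*Y^2)) * D2 + X^4*Y^3) * D3"
      unfolding r_def using T B by algebra
    also have "\<dots> = 2 * D2^2 * D3 + Y * n2 * D3 + Y * n3 * D2^2"
      unfolding D1_def D2_def D3_def n2_def n3_def by algebra
    finally show ?thesis .
  qed
  have "Y * F = r - 2 * ?N" using wgf_feasible[folded F_eq] unfolding r_def by algebra
  then have "Y * F * (D1 * D2^2 * D3 * (up * um)) =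
     (2 * D2^2 * D3 + Y * n2 * D3 + Y * n3 * D2^2) * (up * um) - 8 * P * (D1 * D2^2 * D3)"
    using r N by algebra
  then have *: "to_fract Y * to_fract F * (to_fract D1 * to_fract D2^2 * to_fract D3 * (to_fract up * to_fract um)) =
     (to_fract 2 * to_fract D2^2 * to_fract D3 + to_fract Y * to_fract n2 * to_fract D3 + to_fract Y * to_fract n3 * to_fract D2^2) * (to_fract up * to_fract um)
      - to_fract 8 * to_fract P * (to_fract D1 * to_fract D2^2 * to_fract D3)"
    by (simp only: power2_eq_square to_fract_mult[symmetric] to_fract_add[symmetric] to_fract_diff[symmetric])
  have nz': "to_fract D1 \<noteq> 0" "to_fract D2 \<noteq> 0" "to_fract D3 \<noteq> 0" "to_fract up \<noteq> 0" "to_fract um \<noteq> 0" "to_fract Y \<noteq> 0"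
    using nz by simp_all
  have "to_fract F = to_fract 2 / to_fract (Y * D1) + to_fract n2 / to_fract (D1 * D2^2)
     + to_fract n3 / to_fract (D1 * D3) - to_fract (8 * P) / to_fract (Y * up * um)"
    by (simp add: nz divide_simps power2_eq_square) (use * in algebra)
  then show ?thesis
    unfolding D1_def D2_def D3_def n2_def n3_def P_def up_def um_def hp_def hm_def g_def .
qed

end
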